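(* Up to affine unimodular equivalence there are exactly $1368$ sporadic $F$-hollow lattice $3$-polytopes. All of them are (up to affine unimodular equivalence) lattice subpolytopes of $\Delta_{(3,3,3)}$, $\Delta_{(2,4,4)}$ or $\Delta_{(2,3,6)}$. Exactly $300$ of them have $\mu=\frac43$, $632$ have $\mu=\frac54$ and $436$ have $\mu=\frac76$.
   Context: For $M\cong\mathbb Z^d$ with dual lattice $N$, a lattice $d$-polytope is a $d$-dimensional polytope in $M_{\mathbb R}=M\otimes\mathbb R$ with all vertices in $M$. Affine unimodular equivalence means equivalence under affine isomorphisms preserving the lattice. $\mathrm{Min}_P(y)=\min\{\langle x,y\rangle\mid x\in P\}$. The Fine interior of a polytope $P\subseteq M_{\mathbb R}$ is $F(P)=\{x\in M_{\mathbb R}\mid \langle x,n\rangle\ge \mathrm{Min}_P(n)+1\ \forall n\in N\setminus\{0\}\}$. The minimal multiplier $\mu=\mu(P)$ is the smallest real $\lambda\ge 0$ with $F(\lambda P)\ne\emptyset$. A lattice $d$-polytope $P$ is $F$-hollow if $\mu(P)>1$. It is weakly sporadic $F$-hollow if $\mu(P)>1$ and $\dim F(\mu(P)P)=0$. A weakly sporadic $F$-hollow lattice $d$-polytope is sporadic $F$-hollow if it is not affine unimodular equivalent to a subset of $P'\times\mathbb R^{d-k}$ for any $F$-hollow lattice $k$-polytope $P'\subseteq\mathbb R^k$ with $1\le k<d$. $\Delta_{(k_1,k_2,k_3)}=\mathrm{conv}(0,k_1e_1,k_2e_2,k_3e_3)\subseteq\mathbb R^3$, where $e_1,e_2,e_3$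 is the standard basis. *)

theory Defs
  imports "HOL-Analysis.Analysis"
begin

text \<open>
  Everything up to the notion of being sporadic is set up in an arbitrary Euclidean space of
  dimension d, with M the lattice of vectors having integer coordinates. The inner product
  identifies the dual lattice N with the same set of vectors. Working with Euclidean spaces rather
  than only with \<^typ>\<open>real^'n\<close> makes the product of R^k and R^m available as a product type.
\<close>

definition int_lattice :: "'a::euclidean_space set" where
  "int_lattice = {x. \<forall>b\<in>Basis. x \<bullet> b \<in> \<int>}"

definition lattice_polytope :: "'a::euclidean_space set \<Rightarrow> bool" where
  "lattice_polytope P \<longleftrightarrow> polytope P \<and> aff_dim P = int DIM('a) \<and>
     (\<forall>v. v extreme_point_of P \<longrightarrow> v \<in> int_lattice)"

definition affine_unimodular :: "('a::euclidean_space \<Rightarrow> 'b::euclidean_space) \<Rightarrow> bool" where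
  "affine_unimodular f \<longleftrightarrow> (\<exists>A b. linear A \<and> f = (\<lambda>x. A x + b)) \<and> bij f \<and>
     f ` int_lattice = int_lattice"

definition unimodular_equiv :: "('a::euclidean_space set \<times> 'a set) set" where
  "unimodular_equiv = {(P, Q). \<exists>f. affine_unimodular f \<and> f ` P = Q}"

text \<open>On nonempty compact sets, in particular on polytopes, the infimum is a minimum.\<close>

definition Min_on :: "'a::euclidean_space set \<Rightarrow> 'a \<Rightarrow> real" where
  "Min_on P y = (INF x\<in>P. x \<bullet> y)"

definition Fine_interior :: "'a::euclidean_space set \<Rightarrow> 'a set" where
  "Fine_interior P = {x. \<forall>n\<in>int_lattice - {0}. x \<bullet> n \<ge> Min_on P n + 1}"

definition min_multiplier :: "'a::euclidean_space set \<Rightarrow> real" where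
  "min_multiplier P = (LEAST c. c \<ge> 0 \<and> Fine_interior ((*\<^sub>R) c ` P) \<noteq> {})"

definition F_hollow :: "'a::euclidean_space set \<Rightarrow> bool" where
  "F_hollow P \<longleftrightarrow> lattice_polytope P \<and> min_multiplier P > 1"

definition weakly_sporadic_F_hollow :: "'a::euclidean_space set \<Rightarrow> bool" where
  "weakly_sporadic_F_hollow P \<longleftrightarrow> F_hollow P \<and>
     aff_dim (Fine_interior ((*\<^sub>R) (min_multiplier P) ` P)) = 0"

text \<open>
  \<open>in_cylinder_over P P' TYPE('c)\<close>: up to affine unimodular equivalence, \<open>P\<close> is a subset of
  the product of \<open>P'\<close> with the whole space \<open>'c\<close>. The bijection required by
  \<^const>\<open>affine_unimodular\<close> forces the dimensions to add up.
\<close>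

definition in_cylinder_over ::
    "'a::euclidean_space set \<Rightarrow> 'b::euclidean_space set \<Rightarrow> 'c::euclidean_space itself \<Rightarrow> bool" where
  "in_cylinder_over P P' T \<longleftrightarrow>
     (\<exists>f::'a \<Rightarrow> 'b \<times> 'c. affine_unimodular f \<and> f ` P \<subseteq> P' \<times> UNIV)"

text \<open>
  Dimensions are types, so the quantification over k with 1 \<le> k < d is written out for d = 3 as
  the two cases k = 1 and k = 2.
\<close>

definition sporadic_F_hollow :: "(real^3) set \<Rightarrow> bool" where
  "sporadic_F_hollow P \<longleftrightarrow> weakly_sporadic_F_hollow P \<and>
     \<not> (\<exists>P'::(real^1) set. F_hollow P' \<and> in_cylinder_over P P' TYPE(real^2)) \<and>
     \<not> (\<exists>P'::(real^2) set. F_hollow P' \<and> in_cylinder_over P P' TYPE(real^1))"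

definition Delta :: "nat \<Rightarrow> nat \<Rightarrow> nat \<Rightarrow> (real^3) set" where
  "Delta k1 k2 k3 = convex hull {0, axis 1 (real k1), axis 2 (real k2), axis 3 (real k3)}"

end

theory Submission imports Defs "HOL-Analysis.Analysis"
begin

text \<open>At a point of the Fine interior of \<open>\<mu>(P)P\<close> the tight lattice normals contain 0 in their
  convex hull. A minimal subset with this property spans a simplex without further lattice points;
  for sporadic \<open>P\<close> it has four elements, and a relation \<open>\<Sum>b\<^sub>n n = 0\<close> whose multiples modulo 1
  would give further lattice points or a projection to a hollow polygon unless the weights are
  \<open>(1,1,1,1)\<close>, \<open>(2,1,1,1)\<close> or \<open>(3,2,1,1)\<close> up to scaling and the normals generate the lattice.
  The four inequalities then place \<open>P\<close> in one of three simplices. There the polytopes correspond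
  to the lattice-convex point sets that meet finitely many half spaces, and two of them are
  equivalent only by an automorphism of the simplex, since the point of the Fine interior and the
  normals are determined by \<open>P\<close>. So Burnside's lemma reduces the numbers to counting models of
  clause sets.\<close>

subsection \<open>The lattice and the Fine interior\<close>

text \<open>Three of the conditions range over infinite families: the Fine interior over all lattice
  normals, sporadicity over all hollow segments and polygons, convexity over all half-spaces. The
  first and the last are traded for finite lists, checked in both directions
  (\<open>hit_list\<close>; \<open>hull_rules\<close> against \<open>separators\<close>); inside the
  three simplices the second follows from the first. The weights come from a gap. Put
  \<open>K = 1 / min_multiplier P\<close> and evaluate a relation modulo 1 with coefficients
  \<open>v\<close> on the lattice distances of a lattice point from the four supporting planes.
  Modulo 1 the value does not depend on the point, and unless \<open>v\<close> is integral it keeps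
  distance at least \<open>1 - K\<close> from the integers. Adding the basic relation
  \<open>b\<close> shifts it by \<open>K\<close>, that is by \<open>-(1 - K)\<close> modulo 1, so
  some multiple of \<open>b\<close> moves it into the gap. Hence every relation is a multiple of
  \<open>b\<close> modulo 1. This makes the normals generate the lattice and
  \<open>h = 1 / (1 - K)\<close> an integer that is a denominator of the weights; there remains an
  arithmetic problem on the residues of \<open>- j * w\<close> modulo \<open>h\<close>.\<close>

lemma int_lattice_inner_Basis: "x \<in> int_lattice \<Longrightarrow> b \<in> Basis \<Longrightarrow> x \<bullet> b \<in> \<int>"
  by (simp add: int_lattice_def)

lemma int_lattice_0 [simp]: "0 \<in> int_lattice"
  by (simp add: int_lattice_def)

lemma int_lattice_add: "x \<in> int_lattice \<Longrightarrow> y \<in> int_lattice \<Longrightarrow> x + y \<in> int_lattice"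
  by (simp add: int_lattice_def inner_add_left)

lemma int_lattice_minus: "x \<in> int_lattice \<Longrightarrow> - x \<in> int_lattice"
  by (simp add: int_lattice_def)

lemma int_lattice_diff: "x \<in> int_lattice \<Longrightarrow> y \<in> int_lattice \<Longrightarrow> x - y \<in> int_lattice"
  by (simp add: int_lattice_def inner_diff_left)

lemma int_lattice_scaleR: "k \<in> \<int> \<Longrightarrow> x \<in> int_lattice \<Longrightarrow> k *\<^sub>R x \<in> int_lattice"
  by (simp add: int_lattice_def)

lemma int_lattice_sum: "(\<And>i. i \<in> I \<Longrightarrow> f i \<in> int_lattice) \<Longrightarrow> sum f I \<in> int_lattice"
  by (auto simp: int_lattice_def inner_sum_left intro!: Ints_sum)

lemma int_lattice_Basis: "b \<in> Basis \<Longrightarrow> b \<in> int_lattice"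
  by (auto simp: int_lattice_def inner_Basis)

lemma int_lattice_inner: "x \<in> int_lattice \<Longrightarrow> y \<in> int_lattice \<Longrightarrow> x \<bullet> y \<in> \<int>"
  by (subst euclidean_inner) (auto simp: int_lattice_def intro!: Ints_sum)

lemma int_lattice_norm_ge_1:
  assumes "n \<in> int_lattice" "n \<noteq> 0"
  shows "1 \<le> norm n"
proof -
  obtain b where b: "b \<in> Basis" "n \<bullet> b \<noteq> 0"
    using assms(2) euclidean_all_zero_iff by blast
  then have "1 \<le> \<bar>n \<bullet> b\<bar>"
    using int_lattice_inner_Basis[OF assms(1)] by (simp add: Ints_nonzero_abs_ge1)
  also have "\<dots> \<le> norm n"
    using b Basis_le_norm by blast
  finally show ?thesis .
qed

lemma finite_int_lattice_bounded:
  fixes S :: "'a::euclidean_space set"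
  assumes "bounded S"
  shows "finite (int_lattice \<inter> S)"
proof -
  obtain B where B: "\<And>x. x \<in> S \<Longrightarrow> norm x \<le> B"
    using assms by (auto simp: bounded_iff)
  let ?f = "\<lambda>g. \<Sum>b\<in>Basis. real_of_int (g b) *\<^sub>R b"
  have "int_lattice \<inter> S \<subseteq> ?f ` (PiE (Basis :: 'a set) (\<lambda>_. {\<lfloor>-B\<rfloor>..\<lceil>B\<rceil>}))"
  proof
    fix x :: 'a assume x: "x \<in> int_lattice \<inter> S"
    let ?g = "restrict (\<lambda>b. \<lfloor>x \<bullet> b\<rfloor>) Basis"
    have "?f ?g = (\<Sum>b\<in>Basis. (x \<bullet> b) *\<^sub>R b)"
      using x by (intro sum.cong) (auto simp: int_lattice_def)
    then have "x = ?f ?g" by (simp add: euclidean_representation)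
    moreover have "?g \<in> PiE (Basis :: 'a set) (\<lambda>_. {\<lfloor>-B\<rfloor>..\<lceil>B\<rceil>})"
    proof -
      have "\<bar>x \<bullet> b\<bar> \<le> B" if "b \<in> Basis" for b
        using B[of x] x Basis_le_norm[OF that, of x] by auto
      then have "-B \<le> x \<bullet> b \<and> x \<bullet> b \<le> B" if "b \<in> Basis" for b
        using that by (metis abs_le_iff minus_le_iff)
      then show ?thesis
        by (auto intro!: floor_mono) (meson floor_le_ceiling floor_mono order_trans)
    qed
    ultimately show "x \<in> ?f ` (PiE (Basis :: 'a set) (\<lambda>_. {\<lfloor>-B\<rfloor>..\<lceil>B\<rceil>}))" by blast
  qed
  then show ?thesis
    by (meson finite_PiE finite_Basis finite_atLeastAtMost_int finite_imageI finite_subset)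
qed

section \<open>Minima of functionals and dilations\<close>

lemma Min_on_attained:
  assumes "compact P" "P \<noteq> {}"
  obtains x where "x \<in> P" "Min_on P y = x \<bullet> y"
proof -
  have "continuous_on P (\<lambda>x. x \<bullet> y)" by (intro continuous_intros)
  then obtain x where x: "x \<in> P" "\<forall>z\<in>P. x \<bullet> y \<le> z \<bullet> y"
    using continuous_attains_inf[OF assms] by blast
  have "Min_on P y = x \<bullet> y"
    unfolding Min_on_def
    using x by (intro cInf_eq_minimum) auto
  then show ?thesis using x that by blast
qed

lemma Min_on_le:
  assumes "compact P" "x \<in> P"
  shows "Min_on P y \<le> x \<bullet> y"
proof -
  have "compact ((\<lambda>x. x \<bullet> y) ` P)"
    using assms by (intro compact_continuous_image continuous_intros)
  then have "bdd_below ((\<lambda>x. x \<bullet> y) ` P)"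
    by (intro bounded_imp_bdd_below compact_imp_bounded)
  then show ?thesis
    unfolding Min_on_def using assms by (intro cINF_lower)
qed

lemma Min_on_greatest: "P \<noteq> {} \<Longrightarrow> (\<And>x. x \<in> P \<Longrightarrow> c \<le> x \<bullet> y) \<Longrightarrow> c \<le> Min_on P y"
  unfolding Min_on_def by (rule cINF_greatest)

lemma Min_on_scaleR:
  assumes "compact P" "P \<noteq> {}" "0 \<le> c"
  shows "Min_on ((*\<^sub>R) c ` P) y = c * Min_on P y"
proof (rule antisym)
  obtain x where "x \<in> P" "Min_on P y = x \<bullet> y"
    using Min_on_attained[OF assms(1,2)] .
  then show "Min_on ((*\<^sub>R) c ` P) y \<le> c * Min_on P y"
    using Min_on_le[of "(*\<^sub>R) c ` P" "c *\<^sub>R x" y] compact_scaling[OF assms(1)]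
    by (metis imageI inner_scaleR_left)
  show "c * Min_on P y \<le> Min_on ((*\<^sub>R) c ` P) y"
    using assms by (intro Min_on_greatest) (auto intro!: mult_left_mono Min_on_le)
qed

lemma Fine_interior_scaleR_iff:
  assumes "compact P" "P \<noteq> {}" "0 \<le> c"
  shows "x \<in> Fine_interior ((*\<^sub>R) c ` P) \<longleftrightarrow>
    (\<forall>n\<in>int_lattice - {0}. c * Min_on P n + 1 \<le> x \<bullet> n)"
  by (simp add: Fine_interior_def Min_on_scaleR[OF assms])

lemma Fine_interior_scaleR_D:
  assumes "x \<in> Fine_interior ((*\<^sub>R) c ` P)" "compact P" "P \<noteq> {}" "0 \<le> c" "n \<in> int_lattice" "n \<noteq> 0"
  shows "c * Min_on P n + 1 \<le> x \<bullet> n"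
  using assms Fine_interior_scaleR_iff by blast

text \<open>If \<open>Q\<close> has empty interior it lies in a hyperplane, whose normal or its
  negative works. Otherwise \<open>p\<close> is separated from the interior, and the inequality
  passes to \<open>Q\<close> by closure.\<close>

lemma not_interior_halfspace:
  fixes Q :: "'a::euclidean_space set"
  assumes "convex Q" "closed Q" "p \<notin> interior Q"
  obtains u where "u \<noteq> 0" "\<And>x. x \<in> Q \<Longrightarrow> u \<bullet> p \<le> u \<bullet> x"
proof (cases "interior Q = {}")
  case True
  then obtain a b where ab: "a \<noteq> 0" "Q \<subseteq> {x. a \<bullet> x = b}"
    using empty_interior_subset_hyperplane[OF assms(1)] by metis
  show ?thesis
  proof (cases "a \<bullet> p \<le> b")
    case True
    then show ?thesis using ab by (intro that[of a]) auto
  next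
    case False
    then show ?thesis using ab by (intro that[of "-a"]) auto
  qed
next
  case False
  then obtain a b where ab: "a \<noteq> 0" "\<forall>x\<in>{p}. a \<bullet> x \<le> b" "\<forall>x\<in>interior Q. b \<le> a \<bullet> x"
    using separating_hyperplane_sets[of "{p}" "interior Q"] assms by (auto simp: convex_interior)
  have "Q \<subseteq> closure (interior Q)"
    using convex_closure_interior[OF assms(1) False] closure_subset by metis
  moreover have "closure (interior Q) \<subseteq> {x. b \<le> a \<bullet> x}"
    using ab closed_halfspace_ge by (intro closure_minimal) auto
  ultimately show ?thesis using ab by (intro that[of a]) force+
qed

text \<open>A supporting functional of \<open>Q\<close> at a non-interior point would, after rescaling, be
  approximated by a lattice vector violating the defining inequality of the Fine interior.\<close>

lemma Fine_interior_subset_interior: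
  fixes Q :: "'a::euclidean_space set"
  assumes "compact Q" "convex Q" "Q \<noteq> {}"
  shows "Fine_interior Q \<subseteq> interior Q"
proof
  fix p assume p: "p \<in> Fine_interior Q"
  show "p \<in> interior Q"
  proof (rule ccontr)
    assume "p \<notin> interior Q"
    then obtain u0 where u0: "u0 \<noteq> 0" "\<And>x. x \<in> Q \<Longrightarrow> u0 \<bullet> p \<le> u0 \<bullet> x"
      using not_interior_halfspace[OF assms(2)] assms(1) compact_imp_closed by metis
    obtain b0 where b0: "b0 \<in> Basis" "u0 \<bullet> b0 \<noteq> 0"
      using u0(1) euclidean_all_zero_iff by blast
    \<comment> \<open>Coordinate \<open>b0\<close> of \<open>u\<close> is now 1 or -1, so that of
      \<open>q u\<close> has absolute value \<open>q >= 1\<close>; hence the lattice vector chosen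
      near \<open>q u\<close> is nonzero.\<close>
    define u where "u = (1 / \<bar>u0 \<bullet> b0\<bar>) *\<^sub>R u0"
    have ub0: "\<bar>u \<bullet> b0\<bar> = 1" using b0 by (simp add: u_def abs_mult)
    have u: "u \<bullet> p \<le> u \<bullet> x" if "x \<in> Q" for x
      using u0(2)[OF that] b0 by (simp add: u_def divide_right_mono)
    obtain D where D: "D > 0" "\<And>x. x \<in> Q \<Longrightarrow> norm (p - x) \<le> D"
    proof -
      have "bounded ((\<lambda>x. p - x) ` Q)"
        using assms(1) by (intro compact_imp_bounded compact_continuous_image continuous_intros)
      then show ?thesis using that by (auto simp: bounded_pos)
    qed
    define d where "d = DIM('a)"
    \<comment> \<open>With all \<open>d\<close> coordinates approximated to within
      \<open>1 / N\<close>, the error on a vector of length at most \<open>D\<close> is at most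
      \<open>D * d / N < 1\<close>, less than the 1 demanded by the Fine interior.\<close>
    obtain N where N: "real N > D * d + 2" using reals_Archimedean2 by blast
    have N0: "N > 0" using N D by (smt (verit) mult_nonneg_nonneg of_nat_0_le_iff of_nat_0_less_iff)
    obtain e where e: "bij_betw e {..<d} (Basis :: 'a set)"
      using ex_bij_betw_nat_finite[of "Basis :: 'a set"] by (auto simp: d_def atLeast0LessThan)
    obtain q k where q: "0 < q" "q \<le> int (N ^ d)"
      and k: "\<And>i. i < d \<Longrightarrow> \<bar>of_int q * (u \<bullet> e i) - of_int (k i)\<bar> < 1 / N"
      using Dirichlet_approx_simult[OF N0, of d "\<lambda>i. u \<bullet> e i"] by blast
    define n :: 'a where "n = (\<Sum>i<d. of_int (k i) *\<^sub>R e i)"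
    have e_Basis: "e i \<in> Basis" if "i < d" for i
      using e that by (auto simp: bij_betw_def)
    have n_lat: "n \<in> int_lattice"
      unfolding n_def by (intro int_lattice_sum int_lattice_scaleR int_lattice_Basis e_Basis) auto
    have n_e: "n \<bullet> e i = of_int (k i)" if "i < d" for i
    proof -
      have "n \<bullet> e i = (\<Sum>j<d. if j = i then of_int (k j) else 0)"
        unfolding n_def inner_sum_left
      proof (rule sum.cong)
        fix j assume j: "j \<in> {..<d}"
        have "e j \<bullet> e i = (if j = i then 1 else 0)"
          using e_Basis that j e by (auto simp: inner_Basis bij_betw_def inj_on_def)
        then show "(of_int (k j) *\<^sub>R e j) \<bullet> e i = (if j = i then of_int (k j) else 0)" by simp
      qed simp
      then show ?thesis using that by simp
    qed
    define r where "r = of_int q *\<^sub>R u - n"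
    have r_e: "\<bar>r \<bullet> e i\<bar> < 1 / N" if "i < d" for i
      using k[OF that] n_e[OF that] by (simp add: r_def inner_diff_left)
    have "norm r \<le> (\<Sum>b\<in>Basis. \<bar>r \<bullet> b\<bar>)" by (rule norm_le_l1)
    also have "\<dots> = (\<Sum>i<d. \<bar>r \<bullet> e i\<bar>)"
      using sum.reindex_bij_betw[OF e, of "\<lambda>b. \<bar>r \<bullet> b\<bar>"] by simp
    also have "\<dots> \<le> (\<Sum>i<d. 1 / N)" using r_e by (intro sum_mono) (force simp: less_imp_le)
    finally have nr: "norm r \<le> d / N" by simp
    have "n \<noteq> 0"
    proof
      assume n0: "n = 0"
      have "b0 \<in> e ` {..<d}" using e b0 by (simp add: bij_betw_def)
      then obtain i where i: "i < d" "e i = b0" by auto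
      have "\<bar>of_int q * (u \<bullet> b0)\<bar> < 1 / N"
        using r_e[OF i(1)] i n0 by (simp add: r_def)
      moreover have "\<bar>of_int q * (u \<bullet> b0)\<bar> \<ge> 1" using ub0 q by (simp add: abs_mult)
      moreover have "1 / real N \<le> 1" using N0 by simp
      ultimately show False by linarith
    qed
    obtain x where x: "x \<in> Q" "Min_on Q n = x \<bullet> n"
      using Min_on_attained[OF assms(1,3)] .
    have "1 \<le> (p - x) \<bullet> n"
      using p \<open>n \<noteq> 0\<close> n_lat x(2) by (force simp: Fine_interior_def inner_diff_left)
    also have "(p - x) \<bullet> n = of_int q * (u \<bullet> p - u \<bullet> x) - (p - x) \<bullet> r"
      by (simp add: r_def inner_diff_left inner_diff_right inner_commute algebra_simps)
    also have "\<dots> \<le> - ((p - x) \<bullet> r)"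
      using u[OF x(1)] q(1) by (simp add: mult_nonneg_nonpos)
    also have "\<dots> \<le> norm (p - x) * norm r"
      using norm_cauchy_schwarz[of "p - x" "-r"] by simp
    also have "\<dots> \<le> D * (d / N)"
      using D nr x(1) by (intro mult_mono) auto
    also have "\<dots> < 1"
      using N N0 by (simp add: field_simps)
    finally show False by simp
  qed
qed

section \<open>Lattice polytopes and the minimal multiplier\<close>

lemma lattice_polytope_vertices:
  assumes "lattice_polytope P"
  obtains V where "finite V" "V \<subseteq> int_lattice" "P = convex hull V" "V \<noteq> {}"
proof -
  let ?V = "{x. x extreme_point_of P}"
  have P: "polytope P" "aff_dim P = DIM('a)"
    using assms by (auto simp: lattice_polytope_def)
  have "P = convex hull ?V"
    using P Krein_Milman_Minkowski polytope_imp_compact polytope_imp_convex by blast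
  moreover have "finite ?V"
    using P(1) finite_polyhedron_extreme_points polytope_imp_polyhedron by blast
  moreover have "?V \<subseteq> int_lattice" using assms by (auto simp: lattice_polytope_def)
  moreover have "?V \<noteq> {}"
  proof
    assume "?V = {}"
    then have "P = {}" using \<open>P = convex hull ?V\<close> convex_hull_empty by metis
    then show False using P(2) by simp
  qed
  ultimately show ?thesis using that by blast
qed

lemma lattice_polytope_props:
  assumes "lattice_polytope P"
  shows "compact P" "convex P" "P \<noteq> {}" "polytope P" "interior P \<noteq> {}" "bounded P"
proof -
  show P: "polytope P" using assms by (simp add: lattice_polytope_def)
  show "compact P" "convex P" "bounded P"
    using P polytope_imp_compact polytope_imp_convex polytope_imp_bounded by auto
  show "P \<noteq> {}" using assms by (auto simp: lattice_polytope_def)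
  have "interior P = rel_interior P"
    using assms interior_rel_interior_gen[of P] by (auto simp: lattice_polytope_def)
  then show "interior P \<noteq> {}"
    using \<open>convex P\<close> \<open>P \<noteq> {}\<close> rel_interior_eq_empty[of P] by simp
qed

lemma lattice_polytope_Min_on:
  assumes "lattice_polytope P"
  obtains v where "v \<in> P" "v \<in> int_lattice" "Min_on P y = v \<bullet> y"
proof -
  obtain V where V: "finite V" "V \<subseteq> int_lattice" "P = convex hull V" "V \<noteq> {}"
    using lattice_polytope_vertices[OF assms] .
  obtain v where v: "v \<in> V" "\<forall>x\<in>V. v \<bullet> y \<le> x \<bullet> y"
    using finite_imp_compact[OF V(1)] V(4) continuous_attains_inf[of V "\<lambda>x. x \<bullet> y"]
    by (force intro!: continuous_intros)
  have "P \<subseteq> {x. y \<bullet> x \<ge> v \<bullet> y}"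
    unfolding V(3) using v
    by (intro hull_minimal convex_halfspace_ge) (auto simp: inner_commute)
  moreover have "v \<in> P" using v V(3) by (simp add: hull_inc)
  ultimately have "Min_on P y = v \<bullet> y"
    unfolding Min_on_def by (intro cInf_eq_minimum) (auto simp: inner_commute)
  then show ?thesis using \<open>v \<in> P\<close> v V(2) that by blast
qed

lemma lattice_polytope_Min_on_Ints:
  assumes "lattice_polytope P" "n \<in> int_lattice"
  shows "Min_on P n \<in> \<int>"
  using lattice_polytope_Min_on[OF assms(1), of n] int_lattice_inner[OF _ assms(2)] by metis

text \<open>\<open>LEAST\<close> on the reals is informative only if the minimum is attained. The
  pairs \<open>(c, x)\<close> with \<open>0 <= c <= C\<close> and \<open>x\<close> in the Fine
  interior of the dilate by \<open>c\<close> form a compact set: closed, being cut out by weak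
  inequalities, and bounded, because the Fine interior lies in the dilate. Its projection to
  \<open>c\<close> has a least element.\<close>

lemma min_multiplier_attained:
  fixes P :: "'a::euclidean_space set"
  assumes "compact P" "convex P" "interior P \<noteq> {}"
  shows "0 < min_multiplier P" "Fine_interior ((*\<^sub>R) (min_multiplier P) ` P) \<noteq> {}"
    "\<And>c. 0 \<le> c \<Longrightarrow> Fine_interior ((*\<^sub>R) c ` P) \<noteq> {} \<Longrightarrow> min_multiplier P \<le> c"
proof -
  have P0: "P \<noteq> {}" using assms(3) by auto
  obtain z r where r: "r > 0" "cball z r \<subseteq> P"
    using assms(3) mem_interior_cball by blast
  \<comment> \<open>Dilating by \<open>1 / r\<close> turns the ball of radius \<open>r\<close> in
    \<open>P\<close> into a unit ball; its centre meets every inequality, as nonzero lattice vectors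
    have norm at least 1.\<close>
  define C where "C = 1 / r"
  have "C > 0" using r by (simp add: C_def)
  have Cne: "C *\<^sub>R z \<in> Fine_interior ((*\<^sub>R) C ` P)"
    unfolding Fine_interior_scaleR_iff[OF assms(1) P0 less_imp_le[OF \<open>C > 0\<close>]]
  proof
    fix n :: 'a assume n: "n \<in> int_lattice - {0}"
    have "z - (r / norm n) *\<^sub>R n \<in> cball z r" using n r by (simp add: dist_norm)
    then have "Min_on P n \<le> (z - (r / norm n) *\<^sub>R n) \<bullet> n"
      using Min_on_le[OF assms(1)] r by blast
    also have "\<dots> = z \<bullet> n - r * norm n"
      using n by (simp add: inner_diff_left dot_square_norm power2_eq_square)
    finally have "C * Min_on P n \<le> C * (z \<bullet> n - r * norm n)"
      using \<open>C > 0\<close> by (intro mult_left_mono) auto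
    then have "C * Min_on P n \<le> C * (z \<bullet> n) - norm n"
      using r by (simp add: C_def field_simps)
    then show "C * Min_on P n + 1 \<le> (C *\<^sub>R z) \<bullet> n"
      using int_lattice_norm_ge_1[of n] n by auto
  qed
  let ?F = "\<lambda>c. Fine_interior ((*\<^sub>R) c ` P)"
  define K where "K = {(c, x). 0 \<le> c \<and> c \<le> C \<and> x \<in> ?F c}"
  obtain B where B: "\<And>x. x \<in> P \<Longrightarrow> norm x \<le> B"
    using compact_imp_bounded[OF assms(1)] by (auto simp: bounded_iff)
  have B0: "B \<ge> 0" using B P0 by (meson ex_in_conv norm_ge_zero order_trans)
  have bK: "bounded K"
  proof -
    have "norm x \<le> C * B" if "(c, x) \<in> K" for c x
    proof -
      have "compact ((*\<^sub>R) c ` P)" "convex ((*\<^sub>R) c ` P)" "(*\<^sub>R) c ` P \<noteq> {}"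
        using assms P0 by (auto simp: compact_scaling convex_scaling)
      then have "x \<in> interior ((*\<^sub>R) c ` P)"
        using Fine_interior_subset_interior that by (auto simp: K_def)
      then obtain y where "y \<in> P" "x = c *\<^sub>R y" using interior_subset by blast
      then show ?thesis using that B B0 by (auto simp: K_def intro!: mult_mono)
    qed
    then have "K \<subseteq> {0..C} \<times> cball 0 (C * B)" by (auto simp: K_def)
    then show ?thesis
      by (rule bounded_subset[rotated]) (intro bounded_Times bounded_closed_interval bounded_cball)
  qed
  have cK: "closed K"
  proof -
    have "K = ({0..C} \<times> UNIV) \<inter>
      (\<Inter>n\<in>int_lattice - {0}. {z. fst z * Min_on P n + 1 \<le> snd z \<bullet> n})"
      by (auto simp: K_def Fine_interior_scaleR_iff[OF assms(1) P0])
    moreover have "closed {z. fst z * Min_on P n + 1 \<le> (snd z :: 'a) \<bullet> n}" for n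
      by (intro closed_Collect_le continuous_intros)
    ultimately show ?thesis by (auto intro!: closed_Int closed_INT closed_Times)
  qed
  have "compact (fst ` K)"
    using bK cK by (intro compact_continuous_image continuous_intros) (simp add: compact_eq_bounded_closed)
  moreover have "fst ` K \<noteq> {}" using Cne \<open>C > 0\<close> by (auto simp: K_def)
  ultimately obtain s where s: "s \<in> fst ` K" "\<forall>t\<in>fst ` K. s \<le> t"
    using compact_attains_inf by blast
  have s': "0 \<le> s" "?F s \<noteq> {}" using s(1) by (auto simp: K_def)
  have least: "s \<le> c" if "0 \<le> c" "?F c \<noteq> {}" for c
  proof (cases "c \<le> C")
    case True
    then have "c \<in> fst ` K" using that by (force simp: K_def)
    then show ?thesis using s by blast
  next
    case False
    have "C \<in> fst ` K" using Cne \<open>C > 0\<close> by (force simp: K_def)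
    then show ?thesis using s False by force
  qed
  have mm: "min_multiplier P = s"
    unfolding min_multiplier_def using s' least by (intro Least_equality) auto
  show "?F (min_multiplier P) \<noteq> {}" using mm s' by simp
  show "\<And>c. 0 \<le> c \<Longrightarrow> ?F c \<noteq> {} \<Longrightarrow> min_multiplier P \<le> c" using mm least by simp
  \<comment> \<open>For the factor 0 a point \<open>x\<close> would need both
    \<open>x . b >= 1\<close> and \<open>x . (-b) >= 1\<close>.\<close>
  have "s \<noteq> 0"
  proof
    assume "s = 0"
    then obtain x where x: "x \<in> ?F 0" using s' by blast
    obtain b :: 'a where b: "b \<in> Basis" using nonempty_Basis by blast
    have "1 \<le> x \<bullet> b" "1 \<le> x \<bullet> (-b)"
      using Fine_interior_scaleR_D[OF x assms(1) P0, of b] Fine_interior_scaleR_D[OF x assms(1) P0, of "-b"]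
      using b int_lattice_Basis int_lattice_minus nonzero_Basis by auto
    then show False by simp
  qed
  then show "0 < min_multiplier P" using mm s' by simp
qed

subsection \<open>Tight normals\<close>

definition support :: "'a::euclidean_space set \<Rightarrow> 'a \<Rightarrow> 'a set" where
  "support P p = {n\<in>int_lattice - {0}. p \<bullet> n = min_multiplier P * Min_on P n + 1}"

text \<open>If all tight normals had positive product with some \<open>u\<close>, then moving \<open>p\<close> in direction
  \<open>u\<close> would show that \<open>F(cP)\<close> is nonempty for some \<open>c < \<mu>(P)\<close>.\<close>

lemma zero_in_hull_support:
  fixes P :: "'a::euclidean_space set"
  assumes P: "lattice_polytope P" and p: "p \<in> Fine_interior ((*\<^sub>R) (min_multiplier P) ` P)"
  shows "finite (support P p)" "0 \<in> convex hull (support P p)"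
proof -
  define \<mu> where "\<mu> = min_multiplier P"
  note Pp = lattice_polytope_props[OF P]
  have \<mu>: "0 < \<mu>" "\<And>c. 0 \<le> c \<Longrightarrow> Fine_interior ((*\<^sub>R) c ` P) \<noteq> {} \<Longrightarrow> \<mu> \<le> c"
    unfolding \<mu>_def by (rule min_multiplier_attained[OF Pp(1,2,5)]; assumption)+
  have pn: "\<mu> * Min_on P n + 1 \<le> p \<bullet> n" if "n \<in> int_lattice" "n \<noteq> 0" for n
    using Fine_interior_scaleR_D[OF p Pp(1,3) _ that] \<mu>(1) by (simp add: \<mu>_def)
  let ?Q = "(*\<^sub>R) \<mu> ` P"
  have Q: "compact ?Q" "convex ?Q" "?Q \<noteq> {}"
    using Pp by (auto simp: compact_scaling convex_scaling)
  have "p \<in> interior ?Q"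
    using Fine_interior_subset_interior[OF Q] p by (auto simp: \<mu>_def)
  then obtain r where r: "r > 0" "cball p r \<subseteq> ?Q" using mem_interior_cball by blast
  \<comment> \<open>The slack of a normal grows linearly with its norm, so only finitely many
    lattice vectors constrain a small move of \<open>p\<close>.\<close>
  have far: "\<mu> * Min_on P n \<le> p \<bullet> n - r * norm n" if "n \<noteq> 0" for n
  proof -
    have "p - (r / norm n) *\<^sub>R n \<in> ?Q" using r that by (auto simp: dist_norm subset_iff)
    then have "Min_on ?Q n \<le> (p - (r / norm n) *\<^sub>R n) \<bullet> n"
      using Min_on_le[OF Q(1)] by blast
    also have "\<dots> = p \<bullet> n - r * norm n"
      using that by (simp add: inner_diff_left dot_square_norm power2_eq_square)
    finally show ?thesis using Min_on_scaleR[OF Pp(1,3)] \<mu>(1) by simp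
  qed
  define R where "R = 2 / r"
  have R0: "R > 0" using r by (simp add: R_def)
  have small: "norm n \<le> R" if "n \<in> support P p" for n
  proof -
    have "r * norm n \<le> 1"
      using that far[of n] by (auto simp: support_def \<mu>_def)
    then have "norm n \<le> 1 / r" using r by (simp add: field_simps)
    also have "\<dots> \<le> R" using r by (simp add: R_def divide_right_mono)
    finally show ?thesis .
  qed
  have "support P p \<subseteq> int_lattice \<inter> cball 0 R" using small by (auto simp: support_def)
  then show fin: "finite (support P p)"
    using finite_int_lattice_bounded[OF bounded_cball] finite_subset by blast
  show "0 \<in> convex hull (support P p)"
  proof (rule ccontr)
    assume "0 \<notin> convex hull (support P p)"
    then obtain u \<delta> where u: "u \<noteq> 0" "\<delta> > 0" "\<forall>x\<in>convex hull support P p. u \<bullet> x > \<delta>"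
      using separating_hyperplane_closed_0[of "convex hull (support P p)"]
        compact_imp_closed[OF finite_imp_compact_convex_hull[OF fin]] by auto
    obtain D where D: "D > 0" "\<And>n. - Min_on P n \<le> D * norm n"
    proof -
      obtain D where D: "D > 0" "\<And>x. x \<in> P \<Longrightarrow> norm x \<le> D"
        using Pp(6) bounded_pos by metis
      have "- Min_on P n \<le> D * norm n" for n
      proof -
        obtain x where x: "x \<in> P" "Min_on P n = x \<bullet> n" using Min_on_attained[OF Pp(1,3)] .
        have "- (x \<bullet> n) \<le> norm x * norm n" using norm_cauchy_schwarz[of "-x" n] by simp
        also have "\<dots> \<le> D * norm n" using D x by (intro mult_right_mono) auto
        finally show ?thesis using x by simp
      qed
      then show ?thesis using that D by blast
    qed
    let ?N = "(int_lattice \<inter> cball 0 R) - {0} - support P p"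
    let ?s = "\<lambda>n. p \<bullet> n - \<mu> * Min_on P n - 1"
    have "finite ?N" using finite_int_lattice_bounded[OF bounded_cball] by blast
    have "?s n > 0" if "n \<in> ?N" for n
      using pn[of n] that by (auto simp: support_def \<mu>_def)
    then obtain e where e: "e > 0" "\<And>n. n \<in> ?N \<Longrightarrow> e \<le> ?s n"
    proof -
      let ?e = "Min (insert 1 (?s ` ?N))"
      have "?e > 0" using \<open>finite ?N\<close> \<open>\<And>n. n \<in> ?N \<Longrightarrow> ?s n > 0\<close> by (subst Min_gr_iff) auto
      moreover have "?e \<le> ?s n" if "n \<in> ?N" for n
        using \<open>finite ?N\<close> that by (intro Min_le) auto
      ultimately show ?thesis using that by blast
    qed
    \<comment> \<open>\<open>\<kappa>\<close> is the rate at which \<open>c\<close> falls below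
      \<open>\<mu>\<close>. On tight normals the motion gains more than \<open>\<delta>\<close> per
      unit of \<open>t\<close>, and lowering \<open>c\<close> costs at most
      \<open>\<kappa> * (D * R) = \<delta>\<close>.\<close>
    define \<kappa> where "\<kappa> = \<delta> / (D * R)"
    have \<kappa>: "\<kappa> > 0" "\<kappa> * (D * R) = \<delta>" using u D R0 by (auto simp: \<kappa>_def)
    define A where "A = norm u + \<kappa> * D"
    have A: "A > 0" using u D \<kappa> by (simp add: A_def add_pos_pos)
    \<comment> \<open>The bounds on \<open>t\<close> serve in turn the normals longer than
      \<open>R\<close> (\<open>t * A <= r / 2\<close>), the finitely many slack ones within
      \<open>R\<close> (\<open>t * A * R <= e\<close>), and \<open>c >= 0\<close>.\<close>
    define t where "t = min (min (r / 2) (e / R) / A) (\<mu> / \<kappa>)"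
    have "t > 0" using r e R0 A \<mu>(1) \<kappa> by (simp add: t_def)
    have "t \<le> min (r / 2) (e / R) / A" "t \<le> \<mu> / \<kappa>" by (simp_all add: t_def)
    then have "t * A \<le> min (r / 2) (e / R)" "t * \<kappa> \<le> \<mu>"
      using A \<kappa> by (simp_all add: pos_le_divide_eq)
    then have t: "t * A \<le> r / 2" "t * A * R \<le> e" "t * \<kappa> \<le> \<mu>"
      using R0 by (auto simp: pos_le_divide_eq)
    define c where "c = \<mu> - t * \<kappa>"
    have c: "0 \<le> c" "c < \<mu>" using t \<open>t > 0\<close> \<kappa> by (auto simp: c_def)
    have "p + t *\<^sub>R u \<in> Fine_interior ((*\<^sub>R) c ` P)"
      unfolding Fine_interior_scaleR_iff[OF Pp(1,3) c(1)]
    proof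
      fix n :: 'a assume n: "n \<in> int_lattice - {0}"
      have un: "- (norm u * norm n) \<le> u \<bullet> n" using norm_cauchy_schwarz[of "-u" n] by simp
      have "- (t * A * norm n) = t * (- (norm u * norm n) - \<kappa> * (D * norm n))"
        by (simp add: A_def algebra_simps)
      also have "\<dots> \<le> t * (u \<bullet> n + \<kappa> * Min_on P n)"
      proof -
        have "\<kappa> * (- Min_on P n) \<le> \<kappa> * (D * norm n)"
          using D(2)[of n] \<kappa> by (intro mult_left_mono) auto
        then have "- (norm u * norm n) - \<kappa> * (D * norm n) \<le> u \<bullet> n + \<kappa> * Min_on P n"
          using un by (simp add: algebra_simps)
        then show ?thesis using \<open>t > 0\<close> by (intro mult_left_mono) auto
      qed
      finally have low: "- (t * A * norm n) \<le> t * (u \<bullet> n + \<kappa> * Min_on P n)" .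
      have goal: "c * Min_on P n + 1 \<le> (p + t *\<^sub>R u) \<bullet> n"
        if "1 \<le> p \<bullet> n - \<mu> * Min_on P n + t * (u \<bullet> n + \<kappa> * Min_on P n)"
        using that by (simp add: c_def inner_add_left algebra_simps)
      consider "n \<in> support P p" | "norm n \<le> R" "n \<notin> support P p" | "norm n > R" by linarith
      then show "c * Min_on P n + 1 \<le> (p + t *\<^sub>R u) \<bullet> n"
      proof cases
        case 1
        have "\<delta> < u \<bullet> n" using u 1 by (simp add: hull_inc)
        moreover have "\<kappa> * (- Min_on P n) \<le> \<delta>"
        proof -
          have "\<kappa> * (- Min_on P n) \<le> \<kappa> * (D * R)"
            using D small[OF 1] \<kappa> by (intro mult_left_mono order_trans[OF D(2)[of n]]) auto
          then show ?thesis using \<kappa> by simp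
        qed
        ultimately have "0 \<le> t * (u \<bullet> n + \<kappa> * Min_on P n)"
          using \<open>t > 0\<close> by (intro mult_nonneg_nonneg) auto
        then show ?thesis using 1 by (intro goal) (auto simp: support_def \<mu>_def)
      next
        case 2
        then have "e \<le> ?s n" using n by (intro e) auto
        moreover have "t * A * norm n \<le> t * A * R"
          using 2 \<open>t > 0\<close> A by (intro mult_left_mono) auto
        ultimately show ?thesis using low t by (intro goal) linarith
      next
        case 3
        have "t * A * norm n \<le> r / 2 * norm n" using t by (intro mult_right_mono) auto
        moreover have "r * norm n \<ge> 2" using 3 r by (simp add: R_def field_simps)
        moreover have "\<mu> * Min_on P n \<le> p \<bullet> n - r * norm n" using far n by auto
        ultimately show ?thesis using low by (intro goal) (simp add: field_simps)
      qed
    qed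
    then show False using \<mu>(2)[OF c(1)] c(2) by auto
  qed
qed

section \<open>Circuits of tight normals without further lattice points\<close>

lemma Min_on_superadditive:
  assumes "compact P" "P \<noteq> {}" "finite C" "\<And>n. n \<in> C \<Longrightarrow> 0 \<le> v n"
  shows "(\<Sum>n\<in>C. v n * Min_on P n) \<le> Min_on P (\<Sum>n\<in>C. v n *\<^sub>R n)"
proof (rule Min_on_greatest[OF assms(2)])
  fix x assume "x \<in> P"
  then show "(\<Sum>n\<in>C. v n * Min_on P n) \<le> x \<bullet> (\<Sum>n\<in>C. v n *\<^sub>R n)"
    unfolding inner_sum_right inner_scaleR_right
    using assms by (intro sum_mono mult_left_mono Min_on_le) auto
qed

text \<open>\<open>Min_on P\<close> is concave, so \<open>p . n - mu * Min_on P n\<close> is convex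
  in \<open>n\<close>. It equals 1 on \<open>C\<close>, hence is at most 1 on the hull, while at
  nonzero lattice vectors it is at least 1.\<close>

lemma support_convex_hull:
  assumes P: "lattice_polytope P" and p: "p \<in> Fine_interior ((*\<^sub>R) (min_multiplier P) ` P)"
    and C: "C \<subseteq> support P p" and m: "m \<in> convex hull C" "m \<in> int_lattice" "m \<noteq> 0"
  shows "m \<in> support P p"
proof -
  define \<mu> where "\<mu> = min_multiplier P"
  note Pp = lattice_polytope_props[OF P]
  have \<mu>: "0 < \<mu>"
    unfolding \<mu>_def by (rule min_multiplier_attained[OF Pp(1,2,5)])
  have "finite C" using zero_in_hull_support(1)[OF P p] C finite_subset by blast
  then obtain v where v: "\<forall>x\<in>C. 0 \<le> v x" "sum v C = 1" "(\<Sum>x\<in>C. v x *\<^sub>R x) = m"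
    using m(1) by (auto simp: convex_hull_finite)
  have "p \<bullet> m = (\<Sum>n\<in>C. v n * (\<mu> * Min_on P n + 1))"
    unfolding v(3)[symmetric] inner_sum_right inner_scaleR_right
    using C by (intro sum.cong) (auto simp: support_def \<mu>_def)
  also have "\<dots> = \<mu> * (\<Sum>n\<in>C. v n * Min_on P n) + 1"
    using v(2) by (simp add: algebra_simps sum.distrib sum_distrib_left)
  also have "\<dots> \<le> \<mu> * Min_on P m + 1"
    using Min_on_superadditive[OF Pp(1,3) \<open>finite C\<close>, of v] v \<mu> by auto
  finally have "p \<bullet> m \<le> \<mu> * Min_on P m + 1" .
  moreover have "\<mu> * Min_on P m + 1 \<le> p \<bullet> m"
    using Fine_interior_scaleR_D[OF p Pp(1,3) _ m(2,3)] \<mu> by (simp add: \<mu>_def)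
  ultimately show ?thesis using m by (simp add: support_def \<mu>_def)
qed

text \<open>Among the subsets of the support containing 0 in their convex hull, take one with as few
  lattice points in its hull (and then as few elements) as possible.\<close>

lemma irreducible_circuit:
  fixes P :: "'a::euclidean_space set"
  assumes P: "lattice_polytope P" and p: "p \<in> Fine_interior ((*\<^sub>R) (min_multiplier P) ` P)"
  obtains C b where "C \<subseteq> support P p" "finite C" "\<not> affine_dependent C"
    "int_lattice \<inter> convex hull C \<subseteq> insert 0 C"
    "\<And>n. n \<in> C \<Longrightarrow> 0 < b n" "sum b C = 1" "(\<Sum>n\<in>C. b n *\<^sub>R n) = 0"
proof -
  \<comment> \<open>A single sum suffices: a proper subset has fewer elements and no more lattice
    points in its hull, an exchange keeps the number of elements and loses a lattice point.\<close>
  define f where "f C = card (int_lattice \<inter> convex hull C) + card C" for C :: "'a set"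
  define Z where "Z = {C. C \<subseteq> support P p \<and> 0 \<in> convex hull C}"
  have "support P p \<in> Z" using zero_in_hull_support[OF P p] by (auto simp: Z_def)
  then obtain C where C: "C \<in> Z" "\<And>D. D \<in> Z \<Longrightarrow> f C \<le> f D"
    using arg_min_nat_lemma[of "\<lambda>C. C \<in> Z" "support P p" f] by auto
  have Csub: "C \<subseteq> support P p" and C0: "0 \<in> convex hull C" using C(1) by (auto simp: Z_def)
  have fin: "finite C" using Csub zero_in_hull_support(1)[OF P p] finite_subset by blast
  have finL: "finite (int_lattice \<inter> convex hull C)"
    using fin by (intro finite_int_lattice_bounded bounded_convex_hull finite_imp_bounded)
  have proper: "0 \<notin> convex hull D" if "D \<subset> C" for D
  proof
    assume "0 \<in> convex hull D"
    then have "D \<in> Z" using that Csub by (auto simp: Z_def)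
    moreover have "card D < card C" using that fin psubset_card_mono by blast
    moreover have "card (int_lattice \<inter> convex hull D) \<le> card (int_lattice \<inter> convex hull C)"
      using finL hull_mono[of D C convex] that by (intro card_mono) auto
    ultimately show False using C(2)[of D] by (simp add: f_def)
  qed
  have aff: "\<not> affine_dependent C"
  proof -
    obtain S where S: "finite S" "S \<subseteq> C" "int (card S) \<le> aff_dim C + 1" "0 \<in> convex hull S"
      using C0 by (subst (asm) caratheodory_aff_dim) auto
    then have "S = C" using proper by blast
    then show ?thesis
      using S fin aff_dim_le_card[OF fin] by (simp add: affine_independent_iff_card)
  qed
  have irr: "int_lattice \<inter> convex hull C \<subseteq> insert 0 C"
  proof (rule ccontr)
    assume "\<not> ?thesis"
    then obtain m where m: "m \<in> int_lattice" "m \<in> convex hull C" "m \<noteq> 0" "m \<notin> C" by auto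
    obtain c where c: "c \<in> C" "0 \<in> convex hull (insert m (C - {c}))"
      using in_convex_hull_exchange[OF m(2) C0] .
    let ?D = "insert m (C - {c})"
    have "?D \<in> Z"
      using c support_convex_hull[OF P p Csub m(2,1,3)] Csub by (auto simp: Z_def)
    have sub: "convex hull ?D \<subseteq> convex hull C"
      using m(2) by (intro hull_minimal) (auto simp: hull_inc)
    \<comment> \<open>As a vertex of the simplex, \<open>c\<close> would remain extreme in the
      smaller hull and so be one of its generators.\<close>
    have "c \<notin> convex hull ?D"
    proof
      assume "c \<in> convex hull ?D"
      have "c extreme_point_of (convex hull C)"
        using c aff by (simp add: extreme_point_of_convex_hull_affine_independent)
      then have "c extreme_point_of (convex hull ?D)"
        using sub \<open>c \<in> convex hull ?D\<close> by (auto simp: extreme_point_of_def)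
      then show False using extreme_point_of_convex_hull m(4) c(1) by blast
    qed
    moreover have "c \<in> int_lattice \<inter> convex hull C"
      using c Csub by (auto simp: support_def hull_inc)
    ultimately have "int_lattice \<inter> convex hull ?D \<subset> int_lattice \<inter> convex hull C"
      using sub by blast
    then have "card (int_lattice \<inter> convex hull ?D) < card (int_lattice \<inter> convex hull C)"
      using finL psubset_card_mono by blast
    moreover have "card ?D = card C"
    proof -
      have "card ?D = Suc (card (C - {c}))" using m(4) fin by simp
      then show ?thesis using card.remove[OF fin c(1)] by simp
    qed
    ultimately show False using C(2)[OF \<open>?D \<in> Z\<close>] by (simp add: f_def)
  qed
  obtain b where b: "\<forall>x\<in>C. 0 \<le> b x" "sum b C = 1" "(\<Sum>x\<in>C. b x *\<^sub>R x) = 0"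
    using C0 fin by (auto simp: convex_hull_finite)
  \<comment> \<open>A vanishing weight would put 0 into the hull of a proper subset.\<close>
  have "0 < b n" if "n \<in> C" for n
  proof (rule ccontr)
    assume "\<not> 0 < b n"
    then have "b n = 0" using b that by force
    then have "sum b (C - {n}) = 1" "(\<Sum>x\<in>C - {n}. b x *\<^sub>R x) = 0"
      using b fin by (simp_all add: sum_diff1)
    then have "0 \<in> convex hull (C - {n})"
      using b fin by (auto simp: convex_hull_finite)
    then show False using proper[of "C - {n}"] that by blast
  qed
  then show ?thesis using that[OF Csub fin aff irr _ b(2,3)] by blast
qed

text \<open>Pair the relation with \<open>p\<close>: as the normals are tight, each
  \<open>p . n\<close> is \<open>mu * Min_on P n + 1\<close>.\<close>

lemma circuit_Min_on:
  assumes P: "lattice_polytope P"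
    and C: "C \<subseteq> support P p" "finite C" and b: "sum b C = 1" "(\<Sum>n\<in>C. b n *\<^sub>R n) = 0"
  shows "(\<Sum>n\<in>C. b n * Min_on P n) = - 1 / min_multiplier P"
proof -
  define \<mu> where "\<mu> = min_multiplier P"
  note Pp = lattice_polytope_props[OF P]
  have \<mu>: "0 < \<mu>" unfolding \<mu>_def by (rule min_multiplier_attained[OF Pp(1,2,5)])
  have "0 = p \<bullet> (\<Sum>n\<in>C. b n *\<^sub>R n)" using b by simp
  also have "\<dots> = (\<Sum>n\<in>C. b n * (\<mu> * Min_on P n + 1))"
    unfolding inner_sum_right inner_scaleR_right
    using C by (intro sum.cong) (auto simp: support_def \<mu>_def)
  also have "\<dots> = \<mu> * (\<Sum>n\<in>C. b n * Min_on P n) + 1"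
    using b(1) by (simp add: algebra_simps sum.distrib sum_distrib_left)
  finally show ?thesis using \<mu> by (simp add: \<mu>_def field_simps)
qed

lemma affine_independent_coeffs_eq:
  fixes C :: "'a::real_vector set"
  assumes "\<not> affine_dependent C" "finite C" "sum v C = sum v' C"
    "(\<Sum>n\<in>C. v n *\<^sub>R n) = (\<Sum>n\<in>C. v' n *\<^sub>R n)" "n \<in> C"
  shows "v n = v' n"
proof -
  have "(\<Sum>n\<in>C. v n - v' n) = 0" "(\<Sum>n\<in>C. (v n - v' n) *\<^sub>R n) = 0"
    using assms(3,4) by (simp_all add: sum_subtractf scaleR_diff_left)
  moreover have "\<not> (\<exists>U. sum U C = 0 \<and> (\<exists>v\<in>C. U v \<noteq> 0) \<and> (\<Sum>v\<in>C. U v *\<^sub>R v) = 0)"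
    using assms(1,2) by (simp add: affine_dependent_explicit_finite)
  ultimately have "v n - v' n = 0" using assms(5) by blast
  then show ?thesis by simp
qed

text \<open>The combination lies in the hull, so it is 0 or a vertex. A vertex would need a
  coefficient equal to 1; for 0, barycentric coordinates are unique.\<close>

lemma irreducible_circuit_weights_unique:
  fixes C :: "'a::euclidean_space set"
  assumes C: "finite C" "\<not> affine_dependent C" "int_lattice \<inter> convex hull C \<subseteq> insert 0 C"
    and b: "sum b C = 1" "(\<Sum>n\<in>C. b n *\<^sub>R n) = 0"
    and v: "\<And>n. n \<in> C \<Longrightarrow> 0 \<le> v n" "\<And>n. n \<in> C \<Longrightarrow> v n < 1"
      "sum v C = 1" "(\<Sum>n\<in>C. v n *\<^sub>R n) \<in> int_lattice" "n \<in> C"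
  shows "v n = b n"
proof -
  let ?m = "\<Sum>n\<in>C. v n *\<^sub>R n"
  have "?m \<in> convex hull C" using v C(1) by (auto simp: convex_hull_finite)
  then consider "?m = 0" | "?m \<in> C" using C(3) v(4) by blast
  then show ?thesis
  proof cases
    case 1
    then show ?thesis using affine_independent_coeffs_eq[OF C(2,1), of v b n] v b by simp
  next
    case 2
    let ?w = "\<lambda>n. if n = ?m then 1 else (0::real)"
    have "(\<Sum>n\<in>C. ?w n *\<^sub>R n) = (\<Sum>n\<in>C. if n = ?m then n else 0)"
      by (intro sum.cong) auto
    then have "(\<Sum>n\<in>C. ?w n *\<^sub>R n) = ?m" "sum ?w C = 1"
      using 2 C(1) by (simp_all only: sum.delta) auto
    then have "v ?m = ?w ?m"
      using affine_independent_coeffs_eq[OF C(2,1), of v ?w ?m] v 2 by simp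
    then show ?thesis using v(2)[OF 2] by simp
  qed
qed

text \<open>A circuit with 2 or 3 elements and no further lattice points has equal weights: if \<open>v\<close> are
  the fractional parts of twice the weights, then either \<open>v\<close> or its negative modulo 1
  represents a lattice point of the hull.\<close>

lemma small_circuit_weights:
  fixes C :: "'a::euclidean_space set"
  assumes C: "C \<subseteq> int_lattice" "finite C" "\<not> affine_dependent C" "0 \<notin> C"
      "int_lattice \<inter> convex hull C \<subseteq> insert 0 C"
    and b: "\<And>n. n \<in> C \<Longrightarrow> 0 < b n" "sum b C = 1" "(\<Sum>n\<in>C. b n *\<^sub>R n) = 0"
    and card: "card C \<le> 3" and n: "n \<in> C"
  shows "b n = 1 / card C"
proof -
  have one: "v n = b n" if v: "\<And>n. n \<in> C \<Longrightarrow> 0 \<le> v n" "\<And>n. n \<in> C \<Longrightarrow> v n < 1"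
      "sum v C = 1" "(\<Sum>n\<in>C. v n *\<^sub>R n) \<in> int_lattice" "n \<in> C" for v n
    by (rule irreducible_circuit_weights_unique[OF C(2,3,5) b(2,3) that])
  have lt1: "b n < 1" if "n \<in> C" for n
  proof -
    have "C - {n} \<noteq> {}"
    proof
      assume "C - {n} = {}"
      then have "C = {n}" using that by blast
      then show False using b C(4) by simp
    qed
    then have "0 < sum b (C - {n})" using b C(2) by (intro sum_pos) auto
    moreover have "sum b C = b n + sum b (C - {n})" using C(2) that by (rule sum.remove)
    ultimately show ?thesis using b(2) by linarith
  qed
  define v where "v n = frac (2 * b n)" for n
  have fl: "2 * b n = v n + of_int \<lfloor>2 * b n\<rfloor>" for n by (simp add: v_def frac_def)
  have v01: "0 \<le> v n" "v n < 1" for n by (simp_all add: v_def frac_lt_1)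
  have sumv: "sum v C = 2 - of_int (\<Sum>n\<in>C. \<lfloor>2 * b n\<rfloor>)"
    using b(2) by (simp add: v_def frac_def sum_subtractf sum_distrib_left[symmetric])
  have mv: "(\<Sum>n\<in>C. v n *\<^sub>R n) \<in> int_lattice"
  proof -
    have "(\<Sum>n\<in>C. v n *\<^sub>R n) = 2 *\<^sub>R (\<Sum>n\<in>C. b n *\<^sub>R n) - (\<Sum>n\<in>C. of_int \<lfloor>2 * b n\<rfloor> *\<^sub>R n)"
      by (simp add: v_def frac_def scaleR_diff_left sum_subtractf scaleR_sum_right)
    then show ?thesis using b(3) C(1)
      by (auto intro!: int_lattice_minus int_lattice_sum int_lattice_scaleR)
  qed
  \<comment> \<open>The negative of \<open>v\<close> modulo 1. Zeros stay 0, so that the entries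
    remain below 1 and the two sums add up to the number of nonzero entries.\<close>
  define w where "w n = (if v n = 0 then 0 else 1 - v n)" for n
  have w01: "0 \<le> w n" "w n < 1" for n using v01[of n] by (auto simp: w_def)
  have vw: "v n + w n = (if v n = 0 then 0 else 1)" for n by (simp add: w_def)
  let ?S = "{n\<in>C. v n \<noteq> 0}"
  have sumvw: "sum v C + sum w C = card ?S"
  proof -
    have "sum v C + sum w C = (\<Sum>n\<in>C. if v n = 0 then 0 else 1)"
      unfolding sum.distrib[symmetric] by (intro sum.cong refl vw)
    also have "\<dots> = card ?S" using C(2) by (simp add: sum.If_cases Int_def Collect_conj_eq[symmetric])
    finally show ?thesis .
  qed
  have mw: "(\<Sum>n\<in>C. w n *\<^sub>R n) \<in> int_lattice"
  proof -
    have "(\<Sum>n\<in>C. v n *\<^sub>R n) + (\<Sum>n\<in>C. w n *\<^sub>R n) = (\<Sum>n\<in>C. (if v n = 0 then 0 else 1) *\<^sub>R n)"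
      unfolding sum.distrib[symmetric] scaleR_add_left[symmetric] vw ..
    moreover have "\<dots> \<in> int_lattice"
      using C(1) by (intro int_lattice_sum int_lattice_scaleR) auto
    ultimately show ?thesis using mv int_lattice_diff by (metis add_diff_cancel_left')
  qed
  have eq: "b n = 1 / card C" if "\<forall>n\<in>C. b n = c" for c
  proof -
    have "real (card C) * c = 1" using b(2) that by simp
    moreover have "card C \<noteq> 0" using n C(2) by auto
    ultimately show ?thesis using that n by (simp add: field_simps)
  qed
  show ?thesis
  proof (cases "?S = {}")
    case True
    have "b m = 1 / 2" if "m \<in> C" for m
    proof -
      have "2 * b m = of_int \<lfloor>2 * b m\<rfloor>" using fl[of m] True that by auto
      moreover have "0 < 2 * b m" "2 * b m < 2" using b lt1 that by auto
      ultimately have "\<lfloor>2 * b m\<rfloor> = 1" by linarith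
      then show ?thesis using \<open>2 * b m = of_int \<lfloor>2 * b m\<rfloor>\<close> by simp
    qed
    then show ?thesis using eq by blast
  next
    case False
    have finS: "finite ?S" using C(2) by simp
    have posv: "0 < sum v C"
    proof -
      obtain n where n: "n \<in> C" "v n \<noteq> 0" using False by blast
      then have "0 < v n" using v01(1)[of n] by linarith
      then show ?thesis using C(2) v01 n by (intro sum_pos2[of C n]) auto
    qed
    have posw: "0 < sum w C"
    proof -
      obtain n where n: "n \<in> C" "v n \<noteq> 0" using False by blast
      then have "0 < w n" using v01(2)[of n] by (simp add: w_def)
      then show ?thesis using C(2) w01 n by (intro sum_pos2[of C n]) auto
    qed
    \<comment> \<open>Two positive integers of total at most 3: one of \<open>sum v C\<close> and
      \<open>sum w C\<close> is 1.\<close>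
    have cS: "card ?S \<le> 3" using card card_mono[OF C(2), of ?S] by force
    let ?s = "2 - (\<Sum>n\<in>C. \<lfloor>2 * b n\<rfloor>)"
    have s: "sum v C = of_int ?s" "sum w C = of_int (int (card ?S) - ?s)"
      using sumv sumvw by auto
    have "0 < ?s" "0 < int (card ?S) - ?s" using posv posw unfolding s by linarith+
    then have "?s = 1 \<or> int (card ?S) - ?s = 1" using cS by linarith
    then have "sum v C = 1 \<or> sum w C = 1" by (simp only: s of_int_eq_1_iff)
    then consider "sum v C = 1" | "sum v C \<noteq> 1" "sum w C = 1" by blast
    then show ?thesis
    proof cases
      case 1
      \<comment> \<open>Here \<open>2 b\<close> and \<open>b\<close> agree modulo 1, which would
        make \<open>b n\<close> an integer strictly between 0 and 1.\<close>
      have "v m = b m" if "m \<in> C" for m using one[OF v01 1 mv that] .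
      then have "2 * b n = b n + of_int \<lfloor>2 * b n\<rfloor>" using fl[of n] n by metis
      then have "b n = of_int \<lfloor>2 * b n\<rfloor>" by simp
      then have "0 < real_of_int \<lfloor>2 * b n\<rfloor>" "real_of_int \<lfloor>2 * b n\<rfloor> < 1"
        using b(1)[OF n] lt1[OF n] by simp_all
      then have "0 < \<lfloor>2 * b n\<rfloor>" "\<lfloor>2 * b n\<rfloor> < 1" by simp_all
      then have False by linarith
      then show ?thesis ..
    next
      case 2
      have wb: "w m = b m" if "m \<in> C" for m using one[OF w01 2(2) mw that] .
      have vb: "v m = 1 - b m" if "m \<in> C" for m
        using wb[OF that] b(1)[OF that] by (auto simp: w_def split: if_splits)
      \<comment> \<open>Now \<open>2 b\<close> and \<open>- b\<close> agree modulo 1, so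
        \<open>3 * b m\<close> is a positive integer; at most three such weights of sum 1, the case
        of two being excluded, all equal 1/3.\<close>
      have ge: "1 / 3 \<le> b m" if "m \<in> C" for m
      proof -
        have "3 * b m = of_int (1 + \<lfloor>2 * b m\<rfloor>)" using fl[of m] vb[OF that] by simp
        moreover have "0 < b m" using b that by auto
        ultimately have "1 \<le> 1 + \<lfloor>2 * b m\<rfloor>" by linarith
        then have "1 \<le> real_of_int (1 + \<lfloor>2 * b m\<rfloor>)" by linarith
        then show ?thesis using \<open>3 * b m = of_int (1 + \<lfloor>2 * b m\<rfloor>)\<close> by linarith
      qed
      have "sum v C = real (card C) - 1"
        using vb b(2) by (simp add: sum_subtractf)
      then have "card C \<noteq> 2" using 2(1) by auto
      moreover have "0 < sum v C" "sum v C = real (card C) - 1" by fact+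
      then have "1 < card C" by linarith
      ultimately have c3: "card C = 3" using card by linarith
      have "(\<Sum>m\<in>C. b m - 1 / 3) = 0" using b(2) c3 by (simp add: sum_subtractf)
      then have "\<forall>m\<in>C. b m - 1 / 3 = 0"
        using ge C(2) by (subst (asm) sum_nonneg_eq_0_iff) auto
      then show ?thesis using n c3 by simp
    qed
  qed
qed

subsection \<open>Projections\<close>

lemma lattice_polytope_linear_image:
  fixes f :: "'a::euclidean_space \<Rightarrow> 'b::euclidean_space"
  assumes P: "lattice_polytope P" and f: "linear f" "surj f"
    and L: "\<And>x. x \<in> int_lattice \<Longrightarrow> f x \<in> int_lattice"
  shows "lattice_polytope (f ` P)"
proof -
  obtain V where V: "finite V" "V \<subseteq> int_lattice" "P = convex hull V" "V \<noteq> {}"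
    using lattice_polytope_vertices[OF P] .
  have "polytope (f ` P)" using f(1) P polytope_linear_image lattice_polytope_def by blast
  moreover have "aff_dim (f ` P) = int DIM('b)"
  proof -
    have "affine hull P = UNIV" using P by (simp add: lattice_polytope_def aff_dim_eq_full)
    then have "affine hull (f ` P) = UNIV"
      using affine_hull_linear_image[of f P] f linear_conv_bounded_linear by metis
    then show ?thesis by (simp add: aff_dim_eq_full)
  qed
  moreover have "v \<in> int_lattice" if "v extreme_point_of (f ` P)" for v
  proof -
    have "f ` P = convex hull (f ` V)" using V(3) convex_hull_linear_image[OF f(1)] by metis
    then have "v \<in> f ` V" using that extreme_point_of_convex_hull by metis
    then show ?thesis using V(2) L by blast
  qed
  ultimately show ?thesis by (simp add: lattice_polytope_def)
qed

text \<open>The Bezout coefficients form the first row of a matrix in SL(2, Z); the second row is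
  \<open>(- b', a')\<close>, made of \<open>a\<close> and \<open>b\<close> divided by their
  gcd.\<close>

lemma bezout_unimodular:
  fixes a b :: int
  obtains p q r s where "p * s - q * r = 1" "r * a + s * b = 0"
proof (cases "a = 0 \<and> b = 0")
  case True
  then show ?thesis by (intro that[of 1 1 0 0]) auto
next
  case False
  obtain x y where xy: "x * a + y * b = gcd a b" using bezout_int by blast
  have g: "gcd a b \<noteq> 0" using False by simp
  obtain a' b' where ab: "a = gcd a b * a'" "b = gcd a b * b'" by (meson dvdE gcd_dvd1 gcd_dvd2)
  have "gcd a b * (x * a' + y * b') = gcd a b * 1" using xy ab by (metis distrib_left mult.left_commute mult.right_neutral)
  then have "x * a' + y * b' = 1" using g mult_left_cancel by metis
  moreover have "- b' * a + a' * b = 0"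
    by (subst ab(1), subst (2) ab(2)) (simp add: mult.commute mult.left_commute)
  ultimately show ?thesis by (intro that[of x a' y "- b'"]) auto
qed

section \<open>Coordinates of the lattice and projections along a lattice vector\<close>

lemma UNIV_1: "(UNIV :: 1 set) = {1}" by auto

lemma int_lattice_real1: "x \<in> int_lattice \<longleftrightarrow> x $ (1::1) \<in> \<int>" for x :: "real^1"
  by (auto simp: int_lattice_def Basis_vec_def inner_axis UNIV_1)

lemma int_lattice_real2: "x \<in> int_lattice \<longleftrightarrow> x $ 1 \<in> \<int> \<and> x $ 2 \<in> \<int>" for x :: "real^2"
  by (auto simp: int_lattice_def Basis_vec_def inner_axis UNIV_2)

lemma int_lattice_real3:
  "x \<in> int_lattice \<longleftrightarrow> x $ 1 \<in> \<int> \<and> x $ 2 \<in> \<int> \<and> x $ 3 \<in> \<int>" for x :: "real^3"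
  by (auto simp: int_lattice_def Basis_vec_def inner_axis UNIV_3)

lemma int_lattice_Times: "(x, y) \<in> int_lattice \<longleftrightarrow> x \<in> int_lattice \<and> y \<in> int_lattice"
  unfolding int_lattice_def Basis_prod_def by (auto simp: ball_Un)

lemma affine_unimodular_linearI:
  fixes f :: "'a::euclidean_space \<Rightarrow> 'b::euclidean_space"
  assumes "linear f" "\<And>x. g (f x) = x" "\<And>y. f (g y) = y"
    "\<And>x. x \<in> int_lattice \<Longrightarrow> f x \<in> int_lattice" "\<And>y. y \<in> int_lattice \<Longrightarrow> g y \<in> int_lattice"
  shows "affine_unimodular f"
  unfolding affine_unimodular_def
proof (intro conjI exI)
  show "linear f" by fact
  show "f = (\<lambda>x. f x + 0)" by simp
  show "bij f" using assms(2,3) by (metis bijI')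
  show "f ` int_lattice = int_lattice" using assms(3-5) by (metis (no_types, lifting) image_subset_iff rev_image_eqI subsetI subset_antisym)
qed

text \<open>Two steps of the Euclidean algorithm move \<open>u\<close> into the last coordinate.\<close>

lemma project_along:
  fixes u :: "real^3"
  assumes "u \<in> int_lattice"
  obtains f :: "real^3 \<Rightarrow> (real^2) \<times> (real^1)" and g
  where "linear f" "linear g" "\<And>x. g (f x) = x" "\<And>y. f (g y) = y"
    "\<And>x. x \<in> int_lattice \<Longrightarrow> f x \<in> int_lattice" "\<And>y. y \<in> int_lattice \<Longrightarrow> g y \<in> int_lattice"
    "fst (f u) = 0"
proof -
  obtain a b c where u: "u $ 1 = of_int a" "u $ 2 = of_int b" "u $ 3 = of_int c"
    using assms by (auto simp: int_lattice_real3 elim!: Ints_cases)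
  obtain p q r s :: int where *: "p * s - q * r = 1" "r * b + s * c = 0"
    using bezout_unimodular[of b c] by metis
  obtain p' q' r' s' :: int where **: "p' * s' - q' * r' = 1" "r' * a + s' * (p * b + q * c) = 0"
    using bezout_unimodular[of a "p * b + q * c"] by metis
  have e1: "of_int p * of_int s - of_int q * of_int r = (1::real)"
    "of_int r * of_int b + of_int s * of_int c = (0::real)"
    using * by (metis of_int_1 of_int_diff of_int_mult, metis of_int_0 of_int_add of_int_mult)
  have e2: "of_int p' * of_int s' - of_int q' * of_int r' = (1::real)"
    "of_int r' * of_int a + of_int s' * (of_int p * of_int b + of_int q * of_int c) = (0::real)"
    using ** by (metis of_int_1 of_int_diff of_int_mult, metis of_int_0 of_int_add of_int_mult)
  define f :: "real^3 \<Rightarrow> (real^2) \<times> (real^1)" where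
    "f x = (vector [of_int r * x$2 + of_int s * x$3,
                    of_int r' * x$1 + of_int s' * (of_int p * x$2 + of_int q * x$3)],
            vector [of_int p' * x$1 + of_int q' * (of_int p * x$2 + of_int q * x$3)])" for x
  \<comment> \<open>Both factors of \<open>f\<close> have determinant 1, so the inverse is read off
    from their adjugates and is integral.\<close>
  define g :: "(real^2) \<times> (real^1) \<Rightarrow> real^3" where
    "g z = (let t = fst z $ 1; t' = fst z $ 2; w = snd z $ 1; m = of_int p' * t' - of_int r' * w in
       vector [of_int s' * w - of_int q' * t', of_int s * m - of_int q * t, of_int p * t - of_int r * m])" for z
  show ?thesis
  proof (rule that)
    show "linear f"
      by (rule linearI) (simp_all add: f_def vec_eq_iff forall_1 forall_2 algebra_simps)
    show "linear g"
      by (rule linearI) (simp_all add: g_def Let_def vec_eq_iff forall_3 algebra_simps)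
    show "g (f x) = x" for x
    proof -
      let ?P = "of_int p :: real" and ?Q = "of_int q :: real" and ?R = "of_int r :: real" and ?S = "of_int s :: real"
      let ?P' = "of_int p' :: real" and ?Q' = "of_int q' :: real" and ?R' = "of_int r' :: real" and ?S' = "of_int s' :: real"
      define m where "m = ?P * x$2 + ?Q * x$3"
      define t where "t = ?R * x$2 + ?S * x$3"
      have m: "?P' * (?R' * x$1 + ?S' * m) - ?R' * (?P' * x$1 + ?Q' * m) = m"
      proof -
        have "?P' * (?R' * x$1 + ?S' * m) - ?R' * (?P' * x$1 + ?Q' * m) = (?P' * ?S' - ?Q' * ?R') * m"
          by (simp add: algebra_simps)
        then show ?thesis using e2 by simp
      qed
      have x1: "?S' * (?P' * x$1 + ?Q' * m) - ?Q' * (?R' * x$1 + ?S' * m) = x$1"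
      proof -
        have "?S' * (?P' * x$1 + ?Q' * m) - ?Q' * (?R' * x$1 + ?S' * m) = (?P' * ?S' - ?Q' * ?R') * x$1"
          by (simp add: algebra_simps)
        then show ?thesis using e2 by simp
      qed
      have "?S * m - ?Q * t = (?P * ?S - ?Q * ?R) * x$2" "?P * t - ?R * m = (?P * ?S - ?Q * ?R) * x$3"
        by (simp_all add: m_def t_def algebra_simps)
      then have x23: "?S * m - ?Q * t = x$2" "?P * t - ?R * m = x$3" using e1 by simp_all
      show ?thesis
        unfolding f_def g_def Let_def m_def[symmetric] t_def[symmetric]
        by (simp add: vec_eq_iff forall_3 m x1 x23)
    qed
    show "f (g y) = y" for y
    proof -
      let ?P = "of_int p :: real" and ?Q = "of_int q :: real" and ?R = "of_int r :: real" and ?S = "of_int s :: real"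
      let ?P' = "of_int p' :: real" and ?Q' = "of_int q' :: real" and ?R' = "of_int r' :: real" and ?S' = "of_int s' :: real"
      define t where "t = fst y $ 1"
      define t' where "t' = fst y $ 2"
      define w where "w = snd y $ 1"
      define m where "m = ?P' * t' - ?R' * w"
      have "?R * (?S * m - ?Q * t) + ?S * (?P * t - ?R * m) = (?P * ?S - ?Q * ?R) * t"
        "?P * (?S * m - ?Q * t) + ?Q * (?P * t - ?R * m) = (?P * ?S - ?Q * ?R) * m"
        by (simp_all add: algebra_simps)
      then have a: "?R * (?S * m - ?Q * t) + ?S * (?P * t - ?R * m) = t"
        "?P * (?S * m - ?Q * t) + ?Q * (?P * t - ?R * m) = m" using e1 by simp_all
      have "?R' * (?S' * w - ?Q' * t') + ?S' * m = (?P' * ?S' - ?Q' * ?R') * t'"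
        "?P' * (?S' * w - ?Q' * t') + ?Q' * m = (?P' * ?S' - ?Q' * ?R') * w"
        by (simp_all add: m_def algebra_simps)
      then have b: "?R' * (?S' * w - ?Q' * t') + ?S' * m = t'"
        "?P' * (?S' * w - ?Q' * t') + ?Q' * m = w" using e2 by simp_all
      show ?thesis
        unfolding g_def f_def Let_def t_def[symmetric] t'_def[symmetric] w_def[symmetric] m_def[symmetric]
        by (simp add: prod_eq_iff vec_eq_iff forall_1 forall_2 a b)
          (simp add: t_def t'_def w_def)
    qed
    show "f x \<in> int_lattice" if "x \<in> int_lattice" for x
      using that by (auto simp: f_def int_lattice_Times int_lattice_real1 int_lattice_real2 int_lattice_real3)
    show "g y \<in> int_lattice" if "y \<in> int_lattice" for y
      using that by (cases y) (auto simp: g_def Let_def int_lattice_Times int_lattice_real1 int_lattice_real2 int_lattice_real3)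
    have "of_int r' * of_int a + of_int s' * (of_int p * of_int b + of_int q * of_int c) = (0::real)" by fact
    then show "fst (f u) = 0" using e1(2)
      by (simp add: f_def u vec_eq_iff forall_2)
  qed
qed

text \<open>A positive relation among integral functionals vanishing on \<open>u\<close> bounds \<open>\<mu>\<close> of the
  projection along \<open>u\<close> from below.\<close>

lemma in_cylinder_of_relation:
  fixes P :: "(real^3) set" and u :: "real^3"
  assumes P: "lattice_polytope P" and u: "u \<in> int_lattice" "u \<noteq> 0"
    and I: "finite I" "\<And>i. i \<in> I \<Longrightarrow> c i \<in> int_lattice - {0}" "\<And>i. i \<in> I \<Longrightarrow> c i \<bullet> u = 0"
    and b: "\<And>i. i \<in> I \<Longrightarrow> 0 < b i" "(\<Sum>i\<in>I. b i *\<^sub>R c i) = 0" "I \<noteq> {}"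
    and pos: "0 < (\<Sum>i\<in>I. b i * (Min_on P (c i) + 1))"
  shows "\<exists>P'::(real^2) set. F_hollow P' \<and> in_cylinder_over P P' TYPE(real^1)"
proof -
  obtain f :: "real^3 \<Rightarrow> (real^2) \<times> (real^1)" and g
    where f: "linear f" "linear g" "\<And>x. g (f x) = x" "\<And>y. f (g y) = y"
    "\<And>x. x \<in> int_lattice \<Longrightarrow> f x \<in> int_lattice" "\<And>y. y \<in> int_lattice \<Longrightarrow> g y \<in> int_lattice"
    "fst (f u) = 0"
    using project_along[OF u(1)] by metis
  define P' where "P' = (\<lambda>x. fst (f x)) ` P"
  have lf: "linear (\<lambda>x. fst (f x))"
    using linear_compose[OF f(1) linear_fst] by (simp add: o_def)
  have P': "lattice_polytope P'"
    unfolding P'_def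
  proof (rule lattice_polytope_linear_image[OF P lf])
    show "surj (\<lambda>x. fst (f x))" by (rule surjI[of _ "\<lambda>y. g (y, 0)"]) (simp add: f(4))
    show "fst (f x) \<in> int_lattice" if "x \<in> int_lattice" for x
      using f(5)[OF that] by (metis int_lattice_Times prod.collapse)
  qed
  have aff: "affine_unimodular f" by (rule affine_unimodular_linearI[OF f(1,3,4,5,6)])
  have "f ` P \<subseteq> P' \<times> UNIV"
  proof
    fix z assume "z \<in> f ` P"
    then have "fst z \<in> P'" by (auto simp: P'_def)
    then show "z \<in> P' \<times> UNIV" by (cases z) simp
  qed
  then have cyl: "in_cylinder_over P P' TYPE(real^1)"
    using aff unfolding in_cylinder_over_def by blast
  have lg: "linear (\<lambda>y. g (y, 0))"
    using f(2) by (intro linearI) (simp_all add: linear_add[symmetric] linear_cmul[symmetric])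
  \<comment> \<open>Functionals vanishing on \<open>u\<close> descend along the projection;
    \<open>d i\<close> is the descended \<open>c i\<close>, obtained by restricting it to the
    section given by \<open>g (y, 0)\<close>.\<close>
  define d where "d i = adjoint (\<lambda>y. g (y, 0)) (c i)" for i
  have d: "y \<bullet> d i = g (y, 0) \<bullet> c i" for y i
    unfolding d_def by (rule adjoint_works[OF lg])
  have fu: "f u = (0, snd (f u))" using f(7) by (metis prod.collapse)
  have sfu: "snd (f u) $ 1 \<noteq> 0"
  proof
    assume "snd (f u) $ 1 = 0"
    then have "f u = 0" using fu by (simp add: vec_eq_iff forall_1 prod_eq_iff)
    then show False using f(3)[of u] u(2) linear_0[OF f(2)] by simp
  qed
  have dx: "fst (f x) \<bullet> d i = x \<bullet> c i" if "i \<in> I" for x i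
  proof -
    define k where "k = snd (f x) $ 1 / snd (f u) $ 1"
    have "f (x - k *\<^sub>R u) = (fst (f x), 0)"
      using fu sfu by (simp add: linear_diff[OF f(1)] linear_cmul[OF f(1)] prod_eq_iff vec_eq_iff forall_1 k_def f(7))
    then have "g (fst (f x), 0) = x - k *\<^sub>R u" using f(3) by metis
    then have "fst (f x) \<bullet> d i = (x - k *\<^sub>R u) \<bullet> c i" using d by simp
    moreover have "u \<bullet> c i = 0" using I(3)[OF that] by (simp add: inner_commute)
    ultimately show ?thesis by (simp add: inner_diff_left)
  qed
  have dL: "d i \<in> int_lattice" if "i \<in> I" for i
    unfolding int_lattice_def
  proof clarify
    fix b' :: "real^2" assume "b' \<in> Basis"
    then have "g (b', 0) \<in> int_lattice"
      by (intro f(6)) (simp add: int_lattice_Times int_lattice_Basis)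
    then show "d i \<bullet> b' \<in> \<int>"
      using d[of b' i] I(2)[OF that] int_lattice_inner[of "g (b', 0)" "c i"]
      by (simp add: inner_commute[of "d i"])
  qed
  have d0: "d i \<noteq> 0" if "i \<in> I" for i
  proof
    assume "d i = 0"
    then have "c i \<bullet> c i = 0" using dx[OF that, of "c i"] by simp
    then show False using I(2)[OF that] by simp
  qed
  have Min_d: "Min_on P' (d i) = Min_on P (c i)" if "i \<in> I" for i
    unfolding Min_on_def P'_def image_image dx[OF that] ..
  define \<nu> where "\<nu> = min_multiplier P'"
  note Pp = lattice_polytope_props[OF P']
  have \<nu>: "0 < \<nu>" "Fine_interior ((*\<^sub>R) \<nu> ` P') \<noteq> {}"
    unfolding \<nu>_def by (rule min_multiplier_attained[OF Pp(1,2,5)])+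
  then obtain x where x: "x \<in> Fine_interior ((*\<^sub>R) \<nu> ` P')" by blast
  have sd: "(\<Sum>i\<in>I. b i *\<^sub>R d i) = 0"
  proof -
    have "y \<bullet> (\<Sum>i\<in>I. b i *\<^sub>R d i) = g (y, 0) \<bullet> (\<Sum>i\<in>I. b i *\<^sub>R c i)" for y
      by (simp add: inner_sum_right d)
    then show ?thesis using b(2) by (metis inner_eq_zero_iff inner_zero_right)
  qed
  have "(\<Sum>i\<in>I. b i * (\<nu> * Min_on P (c i) + 1)) \<le> (\<Sum>i\<in>I. b i * (x \<bullet> d i))"
  proof (intro sum_mono mult_left_mono)
    fix i assume i: "i \<in> I"
    show "\<nu> * Min_on P (c i) + 1 \<le> x \<bullet> d i"
      using Fine_interior_scaleR_D[OF x Pp(1,3) less_imp_le[OF \<nu>(1)] dL[OF i] d0[OF i]] Min_d[OF i]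
      by simp
    show "0 \<le> b i" using b(1)[OF i] by simp
  qed
  also have "\<dots> = x \<bullet> (\<Sum>i\<in>I. b i *\<^sub>R d i)" by (simp add: inner_sum_right)
  finally have le0: "(\<Sum>i\<in>I. b i * (\<nu> * Min_on P (c i) + 1)) \<le> 0" using sd by simp
  \<comment> \<open>If \<open>\<nu>\<close> were at most 1, then \<open>\<nu> * ?M + sum b I\<close>
    would be positive together with \<open>?M + sum b I\<close>, contrary to the weighted sum of the
    inequalities at \<open>x\<close>.\<close>
  let ?M = "\<Sum>i\<in>I. b i * Min_on P (c i)"
  have "\<nu> * ?M + sum b I \<le> 0"
    using le0 by (simp add: algebra_simps sum.distrib sum_distrib_left)
  moreover have "0 < ?M + sum b I" using pos by (simp add: algebra_simps sum.distrib)
  moreover have "0 < sum b I" using b(1,3) I(1) by (intro sum_pos) auto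
  ultimately have "\<nu> > 1"
    using \<nu>(1) by (smt (verit) mult_left_le_one_le mult_le_cancel_right1 mult_nonneg_nonneg)
  then show ?thesis using cyl P' by (auto simp: F_hollow_def \<nu>_def)
qed

lemma int_orthogonal_vector:
  fixes a b :: "real^3"
  assumes "a \<in> int_lattice" "b \<in> int_lattice"
  obtains u where "u \<in> int_lattice" "u \<noteq> 0" "a \<bullet> u = 0" "b \<bullet> u = 0"
proof -
  have cross_int: "cross3 x y \<in> int_lattice" if "x \<in> int_lattice" "y \<in> int_lattice" for x y
    using that by (auto simp: cross3_def int_lattice_real3)
  have special: "\<exists>u\<in>int_lattice. u \<noteq> 0 \<and> x \<bullet> u = 0 \<and> y \<bullet> u = 0"
    if hx: "x \<in> int_lattice" "x \<noteq> 0" "cross3 x y = 0" for x y :: "real^3"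
  proof -
    note x0 = hx(2)
    obtain e :: "real^3" where e: "e \<in> Basis" "cross3 x e \<noteq> 0"
    proof -
      have "cross3 x (axis 1 1) \<noteq> 0 \<or> cross3 x (axis 2 1) \<noteq> 0"
        using x0 by (auto simp: cross3_def vec_eq_iff forall_3 axis_def)
      then show ?thesis using that[of "axis 1 1"] that[of "axis 2 1"] by (auto simp: axis_in_Basis_iff)
    qed
    have "collinear {0, x, y}" using hx(3) by (simp add: cross_eq_0)
    then obtain k where "y = k *\<^sub>R x" using hx(2) by (auto simp: collinear_lemma)
    then have "x \<bullet> cross3 x e = 0" "y \<bullet> cross3 x e = 0" by (simp_all add: dot_cross_self)
    then show ?thesis using e hx(1) cross_int int_lattice_Basis by blast
  qed
  consider "cross3 a b \<noteq> 0" | "cross3 a b = 0" "a \<noteq> 0" | "a = 0" "b \<noteq> 0" | "a = 0" "b = 0" by blast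
  then show ?thesis
  proof cases
    case 1
    then show ?thesis using that[of "cross3 a b"] cross_int assms by (simp add: dot_cross_self)
  next
    case 2
    then show ?thesis using special[OF assms(1) 2(2,1)] that by blast
  next
    case 3
    then have "cross3 b a = 0" by simp
    then show ?thesis using special[OF assms(2) 3(2)] that by blast
  next
    case 4
    have "axis 1 1 \<in> (int_lattice :: (real^3) set)" by (auto simp: int_lattice_real3 axis_def)
    then show ?thesis using that[of "axis 1 1"] 4 by simp
  qed
qed

text \<open>Of the two clauses on cylinders in the definition of being sporadic, the one with \<open>k = 2\<close>
  suffices to exclude all relations of rank at most 2.\<close>

lemma sporadic_relation:
  fixes P :: "(real^3) set"
  assumes P: "sporadic_F_hollow P" and I: "finite I" "I \<noteq> {}" "card I \<le> 3"
    and c: "\<And>i. i \<in> I \<Longrightarrow> c i \<in> int_lattice - {0}"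
    and b: "\<And>i. i \<in> I \<Longrightarrow> 0 < b i" "(\<Sum>i\<in>I. b i *\<^sub>R c i) = 0"
  shows "(\<Sum>i\<in>I. b i * (Min_on P (c i) + 1)) \<le> 0"
proof (rule ccontr)
  assume neg: "\<not> ?thesis"
  \<comment> \<open>A vector orthogonal to two of the three \<open>c i\<close> is orthogonal to the
    third, by the relation with its positive weights.\<close>
  have "\<exists>u\<in>int_lattice. u \<noteq> 0 \<and> (\<forall>i\<in>I. c i \<bullet> u = 0)"
  proof -
    obtain i where i: "i \<in> I" using I(2) by blast
    have "card (I - {i}) \<le> 2" using I i by simp
    have "\<exists>j. I - {i} = {} \<or> (j \<in> I \<and> card (I - {i} - {j}) \<le> 1 \<and> j \<noteq> i)"
    proof (cases "I - {i} = {}")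
      case False
      then obtain j where "j \<in> I - {i}" by blast
      then show ?thesis using \<open>card (I - {i}) \<le> 2\<close> I(1) by (intro exI[of _ j]) auto
    qed auto
    then obtain j where j: "I - {i} = {} \<or> (j \<in> I \<and> card (I - {i} - {j}) \<le> 1 \<and> j \<noteq> i)" by blast
    define j' where "j' = (if I - {i} = {} then i else j)"
    have j': "j' \<in> I" using i j by (auto simp: j'_def)
    obtain u where u: "u \<in> int_lattice" "u \<noteq> 0" "c i \<bullet> u = 0" "c j' \<bullet> u = 0"
      using int_orthogonal_vector[of "c i" "c j'"] c[OF i] c[OF j'] by auto
    have "c k \<bullet> u = 0" if k: "k \<in> I" for k
    proof (cases "k = i \<or> k = j'")
      case False
      then have "I - {i} \<noteq> {}" using k by blast
      then have jj: "j' = j" "j \<in> I" "card (I - {i} - {j}) \<le> 1" "j \<noteq> i" using j by (auto simp: j'_def)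
      have "I - {i} - {j} = {k}"
      proof -
        have k': "k \<in> I - {i} - {j}" using False k jj(1) by blast
        moreover have "finite (I - {i} - {j})" using I(1) by blast
        ultimately have "card (I - {i} - {j}) \<noteq> 0" by (metis card_eq_0_iff empty_iff)
        then have "card (I - {i} - {j}) = 1" using jj(3) by linarith
        then obtain z where z: "I - {i} - {j} = {z}" by (rule card_1_singletonE)
        have "k = z" using k' unfolding z by (rule singletonD)
        then show ?thesis using z by (simp only:)
      qed
      then have "I = {i, j, k}" using i jj k by blast
      then have "(\<Sum>l\<in>I. b l *\<^sub>R c l) = b i *\<^sub>R c i + b j *\<^sub>R c j + b k *\<^sub>R c k"
        using jj(1,4) False by (auto simp add: eq_commute[of i] add.assoc)
      then have "(b i *\<^sub>R c i + b j *\<^sub>R c j + b k *\<^sub>R c k) \<bullet> u = 0" using b(2) by simp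
      then have "b k * (c k \<bullet> u) = 0" using u jj(1) by (simp add: inner_add_left)
      then show ?thesis using b(1)[OF k] by simp
    qed (use u in auto)
    then show ?thesis using u by blast
  qed
  then obtain u where u: "u \<in> int_lattice" "u \<noteq> 0" "\<forall>i\<in>I. c i \<bullet> u = 0" by blast
  have lp: "lattice_polytope P"
    using P by (simp add: sporadic_F_hollow_def weakly_sporadic_F_hollow_def F_hollow_def)
  have "\<exists>P'::(real^2) set. F_hollow P' \<and> in_cylinder_over P P' TYPE(real^1)"
    using in_cylinder_of_relation[OF lp u(1,2) I(1) c _ b I(2)] neg u(3) by auto
  then show False using P by (simp add: sporadic_F_hollow_def)
qed

subsection \<open>The weights of the tight normals\<close>

text \<open>The condition pins down the weights one by one: \<open>j = 2\<close> forces
  \<open>w0\<close> near \<open>h / 2\<close>, \<open>j = 3\<close> forces \<open>w1\<close> near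
  \<open>h / 3\<close>, so \<open>w2\<close> and \<open>w3\<close> are at most about
  \<open>h / 6\<close>. For \<open>j = 5\<close> all four residues are then at least about
  \<open>h / 6\<close>, which exceeds 5 once \<open>h\<close> is beyond the convenient bound
  60.\<close>

lemma small_sum_bounds:
  fixes h w0 w1 w2 w3 :: int
  assumes w: "w0 \<ge> w1" "w1 \<ge> w2" "w2 \<ge> w3" "w3 \<ge> 1" "w0 + w1 + w2 + w3 = h" "2 * w0 \<le> h - 1"
    and pos: "\<And>j w. 1 \<le> j \<Longrightarrow> j < h \<Longrightarrow> w \<in> {w0, w1, w2, w3} \<Longrightarrow> 0 < (- j * w) mod h"
    and sol: "\<And>j. 2 \<le> j \<Longrightarrow> j \<le> h - 3 \<Longrightarrow> \<exists>w\<in>{w0, w1, w2, w3}. (- j * w) mod h \<le> j"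
    and h: "h \<ge> 5"
  shows "h - 2 \<le> 2 * w0" "h \<le> 60"
proof -
  have modI: "x mod h = y" if "0 \<le> y" "y < h" "x = y + h * k" for x y k :: int
    using that by simp
  have w_le: "w \<ge> 1 \<and> w \<le> w0" if "w \<in> {w0, w1, w2, w3}" for w using that w by auto
  obtain w where w2: "w \<in> {w0, w1, w2, w3}" "(- 2 * w) mod h \<le> 2" using sol[of 2] h by auto
  have "(- 2 * w) mod h = h - 2 * w"
    using w_le[OF w2(1)] w by (intro modI[of _ _ "-1"]) auto
  then show w0: "h - 2 \<le> 2 * w0" using w2 w_le[OF w2(1)] by auto
  show "h \<le> 60"
  proof (rule ccontr)
    assume "\<not> h \<le> 60"
    then have h60: "h > 60" by simp
    obtain u where u: "u \<in> {w0, w1, w2, w3}" "(- 3 * u) mod h \<le> 3" using sol[of 3] h60 by auto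
    have "3 * u < h"
    proof (rule ccontr)
      assume "\<not> 3 * u < h"
      moreover have "(- 3 * u) mod h = 2 * h - 3 * u" if "3 * u > h"
        using that w_le[OF u(1)] w by (intro modI[of _ _ "-2"]) auto
      moreover have "(- 3 * u) mod h = 0" if "3 * u = h" using that by (intro modI[of _ _ "-1"]) (use h in auto)
      moreover have "0 < (- 3 * u) mod h" using pos[of 3 u] u(1) h60 by simp
      ultimately have "2 * h - 3 * u \<le> 3" using u(2) by (cases "3 * u = h") auto
      then show False using w_le[OF u(1)] w h60 by linarith
    qed
    then have "(- 3 * u) mod h = h - 3 * u"
      using w_le[OF u(1)] by (intro modI[of _ _ "-1"]) auto
    then have u3: "h - 3 \<le> 3 * u" using u by simp
    have u1: "u = w1" if "u \<noteq> w1"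
    proof -
      have "u \<noteq> w0" using \<open>3 * u < h\<close> w0 h60 by auto
      then have "u \<le> w2" using u that w by auto
      then show ?thesis using u3 w w0 h60 by auto
    qed
    then have u1: "u = w1" by blast
    obtain v where v: "v \<in> {w0, w1, w2, w3}" "(- 5 * v) mod h \<le> 5" using sol[of 5] h60 by auto
    have v2: "w2 \<noteq> v" "w3 \<noteq> v"
    proof -
      have "6 * w2 \<le> h + 6" using w w0 u3 u1 by auto
      then have *: "(- 5 * x) mod h = h - 5 * x" "h - 5 * x > 5" if "x \<ge> 1" "x \<le> w2" for x
        using that h60 by (auto intro!: modI[of _ _ "-1"])
      show "w2 \<noteq> v" "w3 \<noteq> v" using *[of w2] *[of w3] v w by auto
    qed
    have "(- 5 * w0) mod h = 3 * h - 5 * w0"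
      using w w0 h60 by (intro modI[of _ _ "-3"]) auto
    then have "w0 \<noteq> v" using v w h60 by auto
    have "(- 5 * w1) mod h = 2 * h - 5 * w1"
      using u1 u3 \<open>3 * u < h\<close> h60 by (intro modI[of _ _ "-2"]) auto
    then have "w1 \<noteq> v" using v u1 \<open>3 * u < h\<close> h60 by auto
    then show False using v v2 \<open>w0 \<noteq> v\<close> by auto
  qed
qed

text \<open>For a primitive relation with weights \<open>w\<^sub>0, \<dots>, w\<^sub>3\<close> of sum \<open>h\<close>, the fractional parts of
  \<open>-j w\<^sub>i / h\<close> have sum 1, 2 or 3. For \<open>2 \<le> j \<le> h - 3\<close>, sums 1 and 3 would come from additional
  lattice points of the simplex.\<close>

definition weights_ok :: "int \<Rightarrow> int \<Rightarrow> int \<Rightarrow> int \<Rightarrow> int \<Rightarrow> int \<Rightarrow> bool" where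
  "weights_ok h w0 w1 w2 w3 j \<longleftrightarrow>
     (- j * w0) mod h + (- j * w1) mod h + (- j * w2) mod h + (- j * w3) mod h = 2 * h"

fun weights_fail :: "int \<Rightarrow> int \<Rightarrow> int \<Rightarrow> int \<Rightarrow> int \<Rightarrow> int list \<Rightarrow> bool" where
  "weights_fail h w0 w1 w2 w3 [] = False"
| "weights_fail h w0 w1 w2 w3 (j # js) =
     (if weights_ok h w0 w1 w2 w3 j then weights_fail h w0 w1 w2 w3 js else True)"

lemma weights_fail_iff:
  "weights_fail h w0 w1 w2 w3 js \<longleftrightarrow> (\<exists>j\<in>set js. \<not> weights_ok h w0 w1 w2 w3 j)"
  by (induction js) auto

text \<open>By \<open>small_sum_bounds\<close> the largest weight is \<open>(h - 1) div 2\<close>,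
  and \<open>w3\<close> is what is left of \<open>h\<close>. The bounds for \<open>w2\<close>
  express \<open>w3 <= w2 <= w1\<close> and \<open>w3 >= 1\<close>.\<close>

lemma weights_ok_small:
  "\<forall>h\<in>set [5..60]. \<forall>w1\<in>set [1..(h - 1) div 2].
     \<forall>w2\<in>set [(h - (h - 1) div 2 - w1 + 1) div 2..min w1 (h - (h - 1) div 2 - w1 - 1)].
       (if weights_fail h ((h - 1) div 2) w1 w2 (h - (h - 1) div 2 - w1 - w2) [2..h - 3] then True else
         [(h - 1) div 2, w1, w2, h - (h - 1) div 2 - w1 - w2] \<in> set [[2,1,1,1], [3,2,1,1], [5,3,2,1]])"
  by code_simp

lemma sporadic_weights:
  fixes h w0 w1 w2 w3 :: int
  assumes w: "w0 \<ge> w1" "w1 \<ge> w2" "w2 \<ge> w3" "w3 \<ge> 1" "w0 + w1 + w2 + w3 = h" "2 * w0 \<le> h - 1"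
    and pos: "\<And>j w. 1 \<le> j \<Longrightarrow> j < h \<Longrightarrow> w \<in> {w0, w1, w2, w3} \<Longrightarrow> 0 < (- j * w) mod h"
    and sum: "\<And>j. 2 \<le> j \<Longrightarrow> j \<le> h - 3 \<Longrightarrow>
      (- j * w0) mod h + (- j * w1) mod h + (- j * w2) mod h + (- j * w3) mod h = 2 * h"
    and sol: "\<And>j. 2 \<le> j \<Longrightarrow> j \<le> h - 3 \<Longrightarrow> \<exists>l0 l1 l2 l3 :: int. 0 \<le> l0 \<and> 0 \<le> l1 \<and> 0 \<le> l2 \<and> 0 \<le> l3 \<and>
      (- j * w0) mod h * l0 + (- j * w1) mod h * l1 + (- j * w2) mod h * l2 + (- j * w3) mod h * l3 = j"
  shows "(w0, w1, w2, w3) \<in> {(1,1,1,1), (2,1,1,1), (3,2,1,1)}"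
proof (cases "h \<ge> 5")
  case False
  then show ?thesis using w by auto
next
  case True
  \<comment> \<open>A sum of nonnegative multiples of the residues that equals \<open>j > 0\<close>
    needs a residue not exceeding \<open>j\<close>.\<close>
  have sol': "\<exists>w\<in>{w0, w1, w2, w3}. (- j * w) mod h \<le> j" if j: "2 \<le> j" "j \<le> h - 3" for j
  proof (rule ccontr)
    assume neg: "\<not> ?thesis"
    obtain l0 l1 l2 l3 where l: "0 \<le> l0" "0 \<le> l1" "0 \<le> l2" "0 \<le> l3"
      "(- j * w0) mod h * l0 + (- j * w1) mod h * l1 + (- j * w2) mod h * l2 + (- j * w3) mod h * l3 = j"
      using sol[OF j] by blast
    have *: "(- j * w) mod h * l \<ge> 0 \<and> ((- j * w) mod h * l = 0 \<or> (- j * w) mod h * l > j)"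
      if "w \<in> {w0, w1, w2, w3}" "0 \<le> l" for w l
    proof -
      have a: "(- j * w) mod h > j" using neg that by auto
      then have "0 \<le> (- j * w) mod h" using j by linarith
      moreover have "(- j * w) mod h * 1 \<le> (- j * w) mod h * l" if "l \<noteq> 0"
        using that \<open>0 \<le> l\<close> \<open>0 \<le> (- j * w) mod h\<close> by (intro mult_left_mono) auto
      ultimately show ?thesis using a that by (cases "l = 0") auto
    qed
    show False using *[of w0 l0] *[of w1 l1] *[of w2 l2] *[of w3 l3] l j by auto
  qed
  note b = small_sum_bounds[OF w pos sol' True]
  have w0: "w0 = (h - 1) div 2" using b w by auto
  have ok: "weights_ok h w0 w1 w2 w3 j" if "j \<in> set [2..h - 3]" for j
    using that pos[of j] sum[of j] by (auto simp: weights_ok_def)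
  have "[w0, w1, w2, w3] \<in> set [[2,1,1,1], [3,2,1,1], [5,3,2,1]]"
  proof -
    have m: "h \<in> set [5..60]" "w1 \<in> set [1..(h - 1) div 2]"
      "w2 \<in> set [(h - (h - 1) div 2 - w1 + 1) div 2..min w1 (h - (h - 1) div 2 - w1 - 1)]"
      unfolding set_upto using True b w w0 by auto
    have w3: "h - (h - 1) div 2 - w1 - w2 = w3" using w w0 by simp
    have nf: "\<not> weights_fail h w0 w1 w2 w3 [2..h - 3]"
      using ok by (auto simp: weights_fail_iff)
    show ?thesis
      using weights_ok_small[rule_format, OF m, unfolded w3, folded w0]
      by (simp only: nf if_False)
  qed
  \<comment> \<open>These weights, with \<open>h = 11\<close>, pass every sum test; only the
    solvability condition for \<open>j = 3\<close> rules them out.\<close>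
  moreover have "[w0, w1, w2, w3] \<noteq> [5,3,2,1]"
  proof
    assume "[w0, w1, w2, w3] = [5,3,2,1]"
    then have "h = 11" "w0 = 5" "w1 = 3" "w2 = 2" "w3 = 1" using w by auto
    then obtain l0 l1 l2 l3 :: int where "0 \<le> l0" "0 \<le> l1" "0 \<le> l2" "0 \<le> l3"
      "7 * l0 + 2 * l1 + 5 * l2 + 8 * l3 = 3" using sol[of 3] by auto
    then show False by presburger
  qed
  ultimately show ?thesis by auto
qed

subsection \<open>Relations modulo 1 among the tight normals\<close>

locale sporadic_circuit =
  fixes P :: "(real^3) set" and p :: "real^3" and C :: "(real^3) set" and b :: "real^3 \<Rightarrow> real"
  assumes sporadic: "sporadic_F_hollow P"
    and p: "p \<in> Fine_interior ((*\<^sub>R) (min_multiplier P) ` P)"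
    and C: "C \<subseteq> support P p" "finite C" "\<not> affine_dependent C"
      "int_lattice \<inter> convex hull C \<subseteq> insert 0 C"
    and b: "\<And>n. n \<in> C \<Longrightarrow> 0 < b n" "sum b C = 1" "(\<Sum>n\<in>C. b n *\<^sub>R n) = 0"
begin

text \<open>\<open>ell n x\<close> is the lattice distance of \<open>x\<close> from the supporting
  plane of \<open>P\<close> with normal \<open>n\<close>; \<open>K\<close> is the weighted mean of
  these distances over \<open>C\<close>, the same for all \<open>x\<close>
  (\<open>sum_b_ell\<close>).\<close>

definition K where "K = 1 / min_multiplier P"
definition ell where "ell n x = x \<bullet> n - Min_on P n"

lemma lp: "lattice_polytope P" and mult_gt_1: "min_multiplier P > 1"
  using sporadic by (auto simp: sporadic_F_hollow_def weakly_sporadic_F_hollow_def F_hollow_def)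

lemma K: "0 < K" "K < 1"
  using mult_gt_1 by (auto simp: K_def)

lemma C_lattice: "n \<in> C \<Longrightarrow> n \<in> int_lattice" "n \<in> C \<Longrightarrow> n \<noteq> 0"
  using C(1) by (auto simp: support_def)

lemma sum_b_Min: "(\<Sum>n\<in>C. b n * Min_on P n) = - K"
  using circuit_Min_on[OF lp C(1,2) b(2,3)] by (simp add: K_def)

text \<open>With at most three normals \<open>sporadic_relation\<close> would give
  \<open>1 - K <= 0\<close>; affine independence allows at most four.\<close>

lemma card_C: "card C = 4"
proof -
  have "card C \<noteq> 0" using b(2) C(2) by auto
  then have ne: "C \<noteq> {}" by auto
  have "int (card C) \<le> 4"
    using C(3) aff_dim_le_DIM[of C] by (simp add: affine_independent_iff_card)
  moreover have "\<not> card C \<le> 3"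
  proof
    assume "card C \<le> 3"
    then have "(\<Sum>n\<in>C. b n * (Min_on P n + 1)) \<le> 0"
      using sporadic_relation[OF sporadic C(2) ne, of "\<lambda>n. n" b] C_lattice b by auto
    then show False using sum_b_Min b(2) K by (simp add: algebra_simps sum.distrib)
  qed
  ultimately show ?thesis by linarith
qed

text \<open>The relation \<open>n + (- n) = 0\<close>: the lattice width of \<open>P\<close> is at
  least 2 in every direction.\<close>

lemma width_ge_2:
  assumes "n \<in> int_lattice" "n \<noteq> 0"
  shows "Min_on P n + Min_on P (- n) \<le> - 2"
proof -
  have "(if i then n else - n) \<in> int_lattice - {0}" for i
    using assms int_lattice_minus[OF assms(1)] by auto
  then show ?thesis
    using sporadic_relation[OF sporadic, of "{True, False}" "\<lambda>i. if i then n else - n" "\<lambda>_. 1"]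
    by (auto simp: card_insert_if)
qed

lemma triple_Min:
  assumes "a \<in> int_lattice" "a \<noteq> 0" "c \<in> int_lattice" "c \<noteq> 0" "a + c \<noteq> 0"
  shows "Min_on P a + Min_on P c + Min_on P (- (a + c)) \<le> - 3"
proof -
  \<comment> \<open>Indexing by numbers admits coincidences among the three vectors, such as
    \<open>a = c\<close>.\<close>
  let ?c = "\<lambda>i::nat. if i = 0 then a else if i = 1 then c else - (a + c)"
  have "?c i \<in> int_lattice - {0}" for i
    using assms int_lattice_minus[OF int_lattice_add[OF assms(1,3)]] by (auto simp: add_eq_0_iff)
  then show ?thesis
    using sporadic_relation[OF sporadic, of "{0, 1, 2}" ?c "\<lambda>_. 1"] by (auto simp: card_insert_if)
qed

lemma ell_nonneg: "x \<in> P \<Longrightarrow> 0 \<le> ell n x"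
  using Min_on_le[OF lattice_polytope_props(1)[OF lp]] by (simp add: ell_def)

lemma ell_Ints: "x \<in> int_lattice \<Longrightarrow> n \<in> C \<Longrightarrow> ell n x \<in> \<int>"
  by (auto simp: ell_def C_lattice intro!: Ints_diff lattice_polytope_Min_on_Ints[OF lp] int_lattice_inner)

lemma sum_b_ell: "(\<Sum>n\<in>C. b n * ell n x) = K"
proof -
  have "(\<Sum>n\<in>C. b n * ell n x) = x \<bullet> (\<Sum>n\<in>C. b n *\<^sub>R n) - (\<Sum>n\<in>C. b n * Min_on P n)"
    by (simp add: ell_def right_diff_distrib sum_subtractf inner_sum_right)
  then show ?thesis by (simp add: b(3) sum_b_Min)
qed

text \<open>At a point of \<open>P\<close> where \<open>n\<close> is largest, \<open>ell n\<close>
  is at least 2 by the width, and the other terms of \<open>sum_b_ell\<close> are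
  nonnegative.\<close>

lemma two_b_le_K:
  assumes "n \<in> C"
  shows "2 * b n \<le> K"
proof -
  obtain x where x: "x \<in> P" "Min_on P (- n) = x \<bullet> (- n)"
    using lattice_polytope_Min_on[OF lp] by metis
  have "2 \<le> ell n x" using width_ge_2[of n] C_lattice[OF assms] x by (simp add: ell_def)
  then have "b n * 2 \<le> b n * ell n x" using b(1)[OF assms] by simp
  also have "\<dots> \<le> (\<Sum>n\<in>C. b n * ell n x)"
    using assms C(2) b(1) ell_nonneg[OF x(1)] by (intro member_le_sum) (auto simp: less_imp_le)
  finally show ?thesis by (simp add: sum_b_ell)
qed

text \<open>Summing \<open>two_b_le_K\<close> over the four normals gives \<open>2 <= 4 * K\<close>.
  Equality would make all weights 1/4 and the minima sum to -2. But \<open>triple_Min\<close> for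
  \<open>n0\<close>, \<open>n1\<close> and \<open>n2 + n3\<close> bounds that sum by -3, and if
  \<open>n0 + n1 = 0\<close>, two widths bound it by -4.\<close>

lemma K_gt_half: "1 / 2 < K"
proof -
  have "(\<Sum>n\<in>C. 2 * b n) \<le> (\<Sum>n\<in>C. K)" by (intro sum_mono two_b_le_K)
  then have "2 \<le> 4 * K" using b(2) card_C by (simp add: sum_distrib_left[symmetric])
  moreover have "K \<noteq> 1 / 2"
  proof
    assume K2: "K = 1 / 2"
    have "(\<Sum>n\<in>C. K - 2 * b n) = 0"
      using b(2) card_C K2 by (simp add: sum_subtractf sum_distrib_left[symmetric])
    then have "K - 2 * b n = 0" if "n \<in> C" for n
      using two_b_le_K C(2) that by (intro sum_nonneg_0[of C "\<lambda>n. K - 2 * b n"]) auto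
    then have b4: "b n = 1 / 4" if "n \<in> C" for n using that K2 by force
    obtain n0 n1 n2 n3 where n: "C = {n0, n1, n2, n3}" "distinct [n0, n1, n2, n3]"
    proof -
      obtain xs where xs: "set xs = C" "distinct xs" using finite_distinct_list[OF C(2)] by auto
      then have "length xs = 4" using card_C distinct_card by metis
      then obtain a b c d where "xs = [a, b, c, d]" by (auto simp: length_Suc_conv numeral_eq_Suc)
      then show ?thesis using that xs by auto
    qed
    have s0: "n0 + n1 + n2 + n3 = 0"
    proof -
      have "(\<Sum>n\<in>C. b n *\<^sub>R n) = (\<Sum>n\<in>C. (1 / 4) *\<^sub>R n)"
        by (intro sum.cong refl arg_cong2[of _ _ _ _ "(*\<^sub>R)"] b4)
      also have "\<dots> = (1 / 4) *\<^sub>R (n0 + n1 + n2 + n3)"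
        using n by (simp add: scaleR_add_right add.assoc)
      finally show ?thesis using b(3) by simp
    qed
    have sM: "Min_on P n0 + Min_on P n1 + Min_on P n2 + Min_on P n3 = - 2"
      using sum_b_Min b4 n K2 by simp
    have L: "n \<in> int_lattice" "n \<noteq> 0" if "n \<in> {n0, n1, n2, n3}" for n using C_lattice n that by auto
    have c1: "Min_on P n2 + Min_on P n3 \<le> Min_on P (n2 + n3)"
    proof (rule Min_on_greatest)
      show "P \<noteq> {}" using lattice_polytope_props[OF lp] by blast
      show "Min_on P n2 + Min_on P n3 \<le> x \<bullet> (n2 + n3)" if "x \<in> P" for x
        using ell_nonneg[OF that, of n2] ell_nonneg[OF that, of n3] by (simp add: ell_def inner_add_right)
    qed
    have c2: "- (n0 + n1) = n2 + n3" using s0 by (metis add.assoc minus_unique)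
    have c3: "n0 + n1 \<noteq> 0"
    proof
      assume "n0 + n1 = 0"
      then have "n1 = - n0" by (rule minus_unique[symmetric])
      then have "Min_on P n0 + Min_on P n1 \<le> - 2"
        using width_ge_2[OF L(1)[of n0] L(2)[of n0]] by simp
      moreover have "n2 + n3 = 0" using s0 \<open>n0 + n1 = 0\<close> by (simp add: add.assoc)
      then have "n3 = - n2" by (rule minus_unique[symmetric])
      then have "Min_on P n2 + Min_on P n3 \<le> - 2"
        using width_ge_2[OF L(1)[of n2] L(2)[of n2]] by simp
      ultimately show False using sM by linarith
    qed
    have "Min_on P n0 + Min_on P n1 + Min_on P (- (n0 + n1)) \<le> - 3"
      using c3 by (intro triple_Min[OF L(1)[of n0] L(2)[of n0] L(1)[of n1] L(2)[of n1]]) simp_all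
    then show False using sM c1 c2 by simp
  qed
  ultimately show ?thesis by linarith
qed

text \<open>Modulo integer-valued functions these form the quotient of Z x N by the sublattice
  spanned by the pairs \<open>(1, n)\<close> with \<open>n\<close> in \<open>C\<close>; the weights
  \<open>b\<close> represent \<open>(1, 0)\<close>.\<close>

definition admissible where
  "admissible v \<longleftrightarrow> sum v C \<in> \<int> \<and> (\<Sum>n\<in>C. v n *\<^sub>R n) \<in> int_lattice"

lemma admissible_minus_Ints:
  assumes "admissible v" "\<And>n. n \<in> C \<Longrightarrow> z n \<in> \<int>"
  shows "admissible (\<lambda>n. z n - v n)"
proof -
  have "(\<Sum>n\<in>C. z n *\<^sub>R n) \<in> int_lattice"
    using assms(2) C_lattice by (intro int_lattice_sum int_lattice_scaleR)
  then show ?thesis using assms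
    by (auto simp: admissible_def sum_subtractf scaleR_diff_left intro!: Ints_diff Ints_sum int_lattice_diff)
qed

lemma admissible_frac:
  assumes "admissible v"
  shows "admissible (\<lambda>n. frac (v n))"
proof -
  have "admissible (\<lambda>n. (- of_int \<lfloor>v n\<rfloor>) - (0 - v n))"
    using assms by (intro admissible_minus_Ints) auto
  then show ?thesis by (simp add: frac_def algebra_simps)
qed

lemma admissible_unique:
  assumes "admissible v" "\<And>n. n \<in> C \<Longrightarrow> 0 \<le> v n" "\<And>n. n \<in> C \<Longrightarrow> v n < 1" "sum v C = 1" "n \<in> C"
  shows "v n = b n"
  using irreducible_circuit_weights_unique[OF C(2-4) b(2,3)] assms by (auto simp: admissible_def)

text \<open>If \<open>v\<close> vanished somewhere on \<open>C\<close>, then \<open>v\<close> and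
  its negative modulo 1 would have positive integral sums of total at most 3. The one with sum 1
  equals \<open>b\<close>, which vanishes nowhere.\<close>

lemma admissible_full_support:
  assumes v: "admissible v" "\<And>n. n \<in> C \<Longrightarrow> 0 \<le> v n" "\<And>n. n \<in> C \<Longrightarrow> v n < 1"
    and k: "k \<in> C" "v k \<noteq> 0" and m: "m \<in> C"
  shows "0 < v m"
proof (rule ccontr)
  assume "\<not> 0 < v m"
  then have vm: "v m = 0" using v(2)[OF m] by simp
  define z where "z n = (if v n = 0 then 0 else 1 :: real)" for n
  define w where "w n = z n - v n" for n
  have w: "admissible w"
    unfolding w_def[abs_def] using v by (intro admissible_minus_Ints) (auto simp: z_def)
  have w01: "0 \<le> w n" "w n < 1" if "n \<in> C" for n
    using v(2,3)[OF that] by (auto simp: w_def z_def)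
  have "0 < v k" using k v(2)[of k] by simp
  then have posv: "0 < sum v C" using C(2) v k by (intro sum_pos2[of C k]) auto
  have "0 < w k" using k v(3)[of k] by (simp add: w_def z_def)
  then have posw: "0 < sum w C" using C(2) w01 k by (intro sum_pos2[of C k]) auto
  have "sum v C + sum w C = sum z C" by (simp add: w_def sum_subtractf)
  also have "\<dots> = sum z (C - {m})" using C(2) m vm by (subst sum.remove[of C m]) (auto simp: z_def)
  also have "\<dots> \<le> (\<Sum>n\<in>C - {m}. 1)" by (intro sum_mono) (auto simp: z_def)
  also have "\<dots> = 3" using C(2) m card_C by simp
  finally have le3: "sum v C + sum w C \<le> 3" .
  obtain s t where "sum v C = of_int s" "sum w C = of_int t"
    using v(1) w by (auto simp: admissible_def elim!: Ints_cases)
  then have "0 < s" "0 < t" "s + t \<le> 3" using le3 posv posw by linarith+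
  then have "s = 1 \<or> t = 1" by linarith
  then consider "sum v C = 1" | "sum w C = 1" using \<open>sum v C = of_int s\<close> \<open>sum w C = of_int t\<close> by auto
  then show False
  proof cases
    case 1
    then show False using admissible_unique[OF v 1 m] b(1)[OF m] vm by simp
  next
    case 2
    then show False using admissible_unique[OF w w01 2 m] b(1)[OF m] vm by (simp add: w_def z_def)
  qed
qed

text \<open>By the value of \<open>sum v C\<close>: 1 gives \<open>b\<close> and 3 gives
  \<open>1 - b\<close> by uniqueness. For sum 2 let \<open>m\<close> be the combination. If
  \<open>m = 0\<close>, its coordinates agree with \<open>2 * b\<close>; otherwise the Fine interior
  inequality at \<open>m\<close> says that \<open>mu\<close> times the value of \<open>v\<close> at
  a lattice point minimizing \<open>m\<close> is at most 1.\<close>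

lemma admissible_cases:
  assumes v: "admissible v" "\<And>n. n \<in> C \<Longrightarrow> 0 \<le> v n" "\<And>n. n \<in> C \<Longrightarrow> v n < 1"
    and k: "k \<in> C" "v k \<noteq> 0"
  obtains "\<And>n. n \<in> C \<Longrightarrow> v n = b n" | "\<And>n. n \<in> C \<Longrightarrow> v n = 1 - b n"
  | "sum v C = 2" "\<And>n. n \<in> C \<Longrightarrow> v n = 2 * b n"
  | x where "sum v C = 2" "x \<in> P" "x \<in> int_lattice"
      "0 < (\<Sum>n\<in>C. v n * ell n x)" "(\<Sum>n\<in>C. v n * ell n x) \<le> K"
proof -
  have vpos: "0 < v n" if "n \<in> C" for n using admissible_full_support[OF v k that] .
  have "0 < sum v C" using vpos C(2) k(1) by (intro sum_pos) auto
  moreover have "sum v C < (\<Sum>n\<in>C. 1)" using v(3) C(2) k(1) by (intro sum_strict_mono) auto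
  ultimately have "0 < sum v C" "sum v C < 4" using card_C by auto
  moreover obtain s where s: "sum v C = of_int s" using v(1) by (auto simp: admissible_def elim!: Ints_cases)
  ultimately have "0 < s" "s < 4" by linarith+
  then consider "s = 1" | "s = 2" | "s = 3" by linarith
  then show ?thesis
  proof cases
    case 1
    then show ?thesis using admissible_unique[OF v] s that(1) by simp
  next
    case 3
    have "admissible (\<lambda>n. 1 - v n)" using v(1) by (intro admissible_minus_Ints) auto
    moreover have "(\<Sum>n\<in>C. 1 - v n) = 1" using s 3 card_C by (simp add: sum_subtractf)
    ultimately have "1 - v n = b n" if "n \<in> C" for n
      using vpos v(3) that by (intro admissible_unique[of "\<lambda>n. 1 - v n"]) (auto simp: less_imp_le)
    then show ?thesis using that(2) by (metis add_diff_cancel_left' diff_add_cancel diff_diff_eq2)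
  next
    case 2
    define m where "m = (\<Sum>n\<in>C. v n *\<^sub>R n)"
    have s2: "sum v C = 2" using s 2 by simp
    show ?thesis
    proof (cases "m = 0")
      case True
      have "v n = 2 * b n" if "n \<in> C" for n
      proof (rule affine_independent_coeffs_eq[OF C(3,2) _ _ that])
        show "sum v C = (\<Sum>n\<in>C. 2 * b n)" using s2 b(2) by (simp add: sum_distrib_left[symmetric])
        have "(\<Sum>n\<in>C. (2 * b n) *\<^sub>R n) = 2 *\<^sub>R (\<Sum>n\<in>C. b n *\<^sub>R n)" by (simp add: scaleR_sum_right)
        then show "(\<Sum>n\<in>C. v n *\<^sub>R n) = (\<Sum>n\<in>C. (2 * b n) *\<^sub>R n)" using True b(3) by (simp add: m_def)
      qed
      then show ?thesis using that(3) s2 by blast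
    next
      case False
      have mL: "m \<in> int_lattice" using v(1) by (simp add: admissible_def m_def)
      define \<mu> where "\<mu> = min_multiplier P"
      have \<mu>: "\<mu> > 1" using mult_gt_1 by (simp add: \<mu>_def)
      obtain x where x: "x \<in> P" "x \<in> int_lattice" "Min_on P m = x \<bullet> m"
        using lattice_polytope_Min_on[OF lp] by metis
      have "\<mu> * Min_on P m + 1 \<le> p \<bullet> m"
        using Fine_interior_scaleR_D[OF p lattice_polytope_props(1,3)[OF lp] _ mL False] \<mu> by (simp add: \<mu>_def)
      also have "p \<bullet> m = (\<Sum>n\<in>C. v n * (\<mu> * Min_on P n + 1))"
        unfolding m_def inner_sum_right inner_scaleR_right
        using C(1) by (intro sum.cong) (auto simp: support_def \<mu>_def)
      also have "\<dots> = \<mu> * (\<Sum>n\<in>C. v n * Min_on P n) + 2"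
        using s2 by (simp add: algebra_simps sum.distrib sum_distrib_left)
      finally have "\<mu> * (x \<bullet> m - (\<Sum>n\<in>C. v n * Min_on P n)) \<le> 1"
        by (simp add: x(3) algebra_simps)
      moreover have val: "x \<bullet> m - (\<Sum>n\<in>C. v n * Min_on P n) = (\<Sum>n\<in>C. v n * ell n x)"
        by (simp add: m_def ell_def right_diff_distrib sum_subtractf inner_sum_right)
      ultimately have "(\<Sum>n\<in>C. v n * ell n x) \<le> K" using \<mu> by (simp add: K_def \<mu>_def[symmetric] field_simps)
      moreover have "0 < (\<Sum>n\<in>C. v n * ell n x)"
      proof -
        have "\<exists>n\<in>C. ell n x \<noteq> 0"
        proof (rule ccontr)
          assume "\<not> ?thesis"
          then have "(\<Sum>n\<in>C. b n * ell n x) = 0" by simp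
          then show False using sum_b_ell[of x] K by simp
        qed
        then obtain n where n: "n \<in> C" "ell n x \<noteq> 0" by blast
        then have "0 < v n * ell n x" using vpos[OF n(1)] ell_nonneg[OF x(1), of n] by simp
        then show ?thesis using n C(2) vpos ell_nonneg[OF x(1)]
          by (intro sum_pos2[of C n]) (auto simp: less_imp_le)
      qed
      ultimately show ?thesis using that(4) x s2 by blast
    qed
  qed
qed

text \<open>Hence the value of \<open>v\<close> modulo 1 is the same at all lattice points.\<close>

lemma admissible_ell_diff:
  assumes "admissible v" "x \<in> int_lattice" "y \<in> int_lattice"
  shows "(\<Sum>n\<in>C. v n * ell n x) - (\<Sum>n\<in>C. v n * ell n y) \<in> \<int>"
proof -
  have "(\<Sum>n\<in>C. v n * ell n x) - (\<Sum>n\<in>C. v n * ell n y) = (x - y) \<bullet> (\<Sum>n\<in>C. v n *\<^sub>R n)"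
    by (simp add: ell_def sum_subtractf[symmetric] inner_sum_right inner_diff_left algebra_simps)
  then show ?thesis using assms by (auto simp: admissible_def intro!: int_lattice_inner int_lattice_diff)
qed

lemma sum_Ints_ell: "x \<in> int_lattice \<Longrightarrow> (\<And>n. n \<in> C \<Longrightarrow> z n \<in> \<int>) \<Longrightarrow> (\<Sum>n\<in>C. z n * ell n x) \<in> \<int>"
  using ell_Ints by (intro Ints_sum Ints_mult)

text \<open>In the cases of \<open>admissible_cases\<close> the value modulo 1 is represented by
  \<open>K\<close>, \<open>1 - K\<close>, \<open>2 * K - 1\<close> and the value at the point found
  there; \<open>K > 1/2\<close> puts the second and third into the interval.\<close>

lemma admissible_value_upper:
  assumes v: "admissible v" "\<And>n. n \<in> C \<Longrightarrow> 0 \<le> v n" "\<And>n. n \<in> C \<Longrightarrow> v n < 1"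
    and k: "k \<in> C" "v k \<noteq> 0" and x: "x \<in> int_lattice"
  obtains z :: int where "0 < (\<Sum>n\<in>C. v n * ell n x) - z" "(\<Sum>n\<in>C. v n * ell n x) - z \<le> K"
proof (rule admissible_cases[OF v k])
  assume "\<And>n. n \<in> C \<Longrightarrow> v n = b n"
  then have "(\<Sum>n\<in>C. v n * ell n x) = K" using sum_b_ell[of x] by simp
  then show ?thesis using that[of 0] K by simp
next
  assume "\<And>n. n \<in> C \<Longrightarrow> v n = 1 - b n"
  then have "(\<Sum>n\<in>C. v n * ell n x) = (\<Sum>n\<in>C. 1 * ell n x) - K"
    using sum_b_ell[of x] by (simp add: left_diff_distrib sum_subtractf)
  moreover obtain e where "(\<Sum>n\<in>C. 1 * ell n x) = of_int e"
    using sum_Ints_ell[OF x, of "\<lambda>_. 1"] by (auto elim!: Ints_cases)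
  ultimately show ?thesis using that[of "e - 1"] K K_gt_half by simp
next
  assume "\<And>n. n \<in> C \<Longrightarrow> v n = 2 * b n"
  then have "(\<Sum>n\<in>C. v n * ell n x) = 2 * K"
    using sum_b_ell[of x] by (simp add: sum_distrib_left[symmetric] mult.assoc)
  then show ?thesis using that[of 1] K K_gt_half by simp
next
  fix y assume y: "y \<in> int_lattice" "0 < (\<Sum>n\<in>C. v n * ell n y)" "(\<Sum>n\<in>C. v n * ell n y) \<le> K"
  obtain z where "(\<Sum>n\<in>C. v n * ell n x) - (\<Sum>n\<in>C. v n * ell n y) = of_int z"
    using admissible_ell_diff[OF v(1) x y(1)] by (auto elim!: Ints_cases)
  then show ?thesis using that[of z] y by (simp add: algebra_simps)
qed

text \<open>The upper bound is applied to \<open>v\<close> and to \<open>1 - v\<close>, whose values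
  are opposite modulo 1.\<close>

lemma admissible_value_fract:
  assumes v: "admissible v" "\<And>n. n \<in> C \<Longrightarrow> 0 \<le> v n" "\<And>n. n \<in> C \<Longrightarrow> v n < 1"
    and k: "k \<in> C" "v k \<noteq> 0" and x: "x \<in> int_lattice"
  obtains z :: int where "1 - K \<le> (\<Sum>n\<in>C. v n * ell n x) - z" "(\<Sum>n\<in>C. v n * ell n x) - z \<le> K"
proof -
  obtain z :: int where z: "0 < (\<Sum>n\<in>C. v n * ell n x) - z" "(\<Sum>n\<in>C. v n * ell n x) - z \<le> K"
    using admissible_value_upper[OF v k x] by blast
  have vpos: "0 < v n" if "n \<in> C" for n using admissible_full_support[OF v k that] .
  have "admissible (\<lambda>n. 1 - v n)" using v(1) by (intro admissible_minus_Ints) auto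
  moreover have "0 \<le> 1 - v n" "1 - v n < 1" if "n \<in> C" for n
    using vpos[OF that] v(3)[OF that] by auto
  moreover have "1 - v k \<noteq> 0" using v(3)[OF k(1)] by simp
  ultimately obtain z' where z': "0 < (\<Sum>n\<in>C. (1 - v n) * ell n x) - of_int z'"
    "(\<Sum>n\<in>C. (1 - v n) * ell n x) - of_int z' \<le> K"
    using admissible_value_upper[of "\<lambda>n. 1 - v n", OF _ _ _ k(1) _ x] by blast
  obtain e where e: "(\<Sum>n\<in>C. 1 * ell n x) = of_int e"
    using sum_Ints_ell[OF x, of "\<lambda>_. 1"] by (auto elim!: Ints_cases)
  have "(\<Sum>n\<in>C. (1 - v n) * ell n x) = of_int e - (\<Sum>n\<in>C. v n * ell n x)"
    using e by (simp add: left_diff_distrib sum_subtractf)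
  \<comment> \<open>The value lies strictly between the integers \<open>z\<close> and
    \<open>e - z'\<close>, within \<open>K\<close> of both; as these differ by at least 1, it is at
    least \<open>z + 1 - K\<close>.\<close>
  then have "of_int z < real_of_int (e - z')" "of_int (e - z') \<le> K + (\<Sum>n\<in>C. v n * ell n x)"
    using z z' by auto
  then have "z + 1 \<le> e - z'" by linarith
  then have "real_of_int z + 1 \<le> real_of_int (e - z')" by linarith
  then have "1 - K \<le> (\<Sum>n\<in>C. v n * ell n x) - z"
    using \<open>of_int (e - z') \<le> K + (\<Sum>n\<in>C. v n * ell n x)\<close> by linarith
  then show ?thesis using that z by blast
qed

text \<open>With \<open>\<delta> = 1 - K\<close>, each added \<open>b\<close> moves the value by
  \<open>- \<delta>\<close> modulo 1. After \<open>floor (t / \<delta>)\<close> steps it lies in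
  \<open>[0, \<delta>)\<close> modulo 1, where \<open>admissible_value_fract\<close> leaves room for
  integral coefficients only.\<close>

lemma admissible_integral:
  assumes v: "admissible v" and x: "x \<in> int_lattice" and t: "t - (\<Sum>n\<in>C. v n * ell n x) \<in> \<int>" and m: "m \<in> C"
  shows "v m + of_int \<lfloor>t / (1 - K)\<rfloor> * b m \<in> \<int>"
proof (rule ccontr)
  define \<delta> where "\<delta> = 1 - K"
  have \<delta>: "0 < \<delta>" using K by (simp add: \<delta>_def)
  define \<kappa> where "\<kappa> = \<lfloor>t / \<delta>\<rfloor>"
  assume neg: "v m + of_int \<lfloor>t / (1 - K)\<rfloor> * b m \<notin> \<int>"
  define w where "w n = v n + of_int \<kappa> * b n" for n
  have "w m \<notin> \<int>" using neg by (simp add: w_def \<kappa>_def \<delta>_def)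
  have w: "admissible w"
    using v b(2,3) by (auto simp: admissible_def w_def sum.distrib sum_distrib_left[symmetric]
        scaleR_add_left scaleR_scaleR[symmetric] scaleR_sum_right[symmetric] simp del: scaleR_scaleR)
  have "frac (w m) \<noteq> 0" using \<open>w m \<notin> \<int>\<close> by (simp add: frac_eq_0_iff)
  then obtain z :: int where z: "1 - K \<le> (\<Sum>n\<in>C. frac (w n) * ell n x) - z" "(\<Sum>n\<in>C. frac (w n) * ell n x) - z \<le> K"
    using admissible_value_fract[OF admissible_frac[OF w] _ _ m _ x] by (auto simp: frac_lt_1)
  obtain i where i: "(\<Sum>n\<in>C. of_int \<lfloor>w n\<rfloor> * ell n x) = of_int i"
    using sum_Ints_ell[OF x, of "\<lambda>n. of_int \<lfloor>w n\<rfloor>"] by (auto elim!: Ints_cases)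
  have "(\<Sum>n\<in>C. frac (w n) * ell n x) = (\<Sum>n\<in>C. w n * ell n x) - of_int i"
    using i by (simp add: frac_def left_diff_distrib sum_subtractf)
  also have "(\<Sum>n\<in>C. w n * ell n x) = (\<Sum>n\<in>C. v n * ell n x) + of_int \<kappa> * K"
    using sum_b_ell[of x] by (simp add: w_def distrib_right sum.distrib sum_distrib_left[symmetric] mult.assoc)
  finally have val: "(\<Sum>n\<in>C. frac (w n) * ell n x) = (\<Sum>n\<in>C. v n * ell n x) + of_int \<kappa> * K - of_int i" .
  obtain j where j: "t - (\<Sum>n\<in>C. v n * ell n x) = of_int j" using t by (auto elim!: Ints_cases)
  have "of_int \<kappa> \<le> t / \<delta>" "t / \<delta> < of_int \<kappa> + 1" by (simp_all add: \<kappa>_def)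
  then have fl: "0 \<le> t - of_int \<kappa> * \<delta>" "t - of_int \<kappa> * \<delta> < \<delta>" using \<delta> by (simp_all add: field_simps)
  define q where "q = \<kappa> - i - j - z"
  have "(\<Sum>n\<in>C. frac (w n) * ell n x) - z = (t - of_int \<kappa> * \<delta>) + of_int q"
    using val j by (simp add: \<delta>_def q_def algebra_simps)
  then have "\<delta> \<le> (t - of_int \<kappa> * \<delta>) + of_int q" "(t - of_int \<kappa> * \<delta>) + of_int q \<le> 1 - \<delta>"
    using z by (simp_all add: \<delta>_def)
  then have "0 < real_of_int q" "real_of_int q < 1" using fl \<delta> by linarith+
  then have "0 < q" "q < 1" by simp_all
  then show False by linarith
qed

text \<open>\<open>admissible_integral\<close> with \<open>v = 0\<close> and \<open>t = 1\<close>
  shows that \<open>h = floor (1 / (1 - K))\<close> is a common denominator of the weights. Then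
  \<open>h * (1 - K)\<close> is an integer in \<open>(0, 1]\<close>, so it is 1.\<close>

lemma obtain_weights:
  obtains h :: int and w :: "real^3 \<Rightarrow> int" where "0 < h" "K = (of_int h - 1) / of_int h"
    "\<And>n. n \<in> C \<Longrightarrow> b n = of_int (w n) / of_int h"
proof -
  obtain x :: "real^3" where x: "x \<in> int_lattice" using int_lattice_0 by blast
  define h where "h = \<lfloor>1 / (1 - K)\<rfloor>"
  have hb: "of_int h * b n \<in> \<int>" if "n \<in> C" for n
    using admissible_integral[of "\<lambda>_. 0" x 1 n] x that by (simp add: admissible_def h_def)
  have "of_int h * K = (\<Sum>n\<in>C. (of_int h * b n) * ell n x)"
    using sum_b_ell[of x] by (simp add: sum_distrib_left[symmetric] mult.assoc)
  then have "of_int h * K \<in> \<int>" using sum_Ints_ell[OF x, of "\<lambda>n. of_int h * b n"] hb by simp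
  then have "of_int h - of_int h * K \<in> \<int>" by simp
  then obtain j where "of_int h - of_int h * K = of_int j" by (rule Ints_cases)
  then have j: "of_int h * (1 - K) = of_int j" by (simp add: right_diff_distrib)
  have "of_int h \<le> 1 / (1 - K)" "1 / (1 - K) < of_int h + 1" by (simp_all add: h_def)
  then have "of_int h * (1 - K) \<le> 1" "1 < (of_int h + 1) * (1 - K)"
    using K by (simp_all add: field_simps)
  then have "real_of_int j \<le> 1" "0 < real_of_int j" using j K by (simp_all add: algebra_simps)
  then have "j = 1" by simp
  then have h1: "of_int h * (1 - K) = 1" using j by simp
  have hpos: "0 < h"
  proof -
    have "0 < real_of_int h" using h1 K by (metis diff_gt_0_iff_gt zero_less_mult_pos2 zero_less_one)
    then show ?thesis by simp
  qed
  define w where "w n = \<lfloor>of_int h * b n\<rfloor>" for n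
  have "b n = of_int (w n) / of_int h" if "n \<in> C" for n
    using hb[OF that] hpos by (auto simp: w_def elim!: Ints_cases simp: field_simps)
  moreover have "K = (of_int h - 1) / of_int h" using h1 hpos by (simp add: field_simps)
  ultimately show ?thesis using that hpos by blast
qed

end

lemma distinct_four:
  assumes "finite C" "card C = 4"
  obtains a b c d where "C = {a, b, c, d}" "distinct [a, b, c, d]"
    "f a \<ge> (f b :: int)" "f b \<ge> f c" "f c \<ge> f d"
proof -
  obtain ys where ys: "set ys = C" "distinct ys" using finite_distinct_list[OF assms(1)] by auto
  define xs where "xs = sort_key (\<lambda>n. - f n) ys"
  have xs: "set xs = C" "distinct xs" "sorted (map (\<lambda>n. - f n) xs)" using ys by (auto simp: xs_def)
  then have "length xs = 4" using assms(2) distinct_card by metis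
  then obtain a b c d where "xs = [a, b, c, d]" by (auto simp: length_Suc_conv numeral_eq_Suc)
  then show ?thesis using that[of a b c d] xs by auto
qed

context sporadic_circuit
begin

text \<open>The residues divided by \<open>h\<close> are \<open>- j * b\<close> modulo 1, so
  \<open>admissible_cases\<close> applies. At lattice points the sum of \<open>m n * ell n x\<close>
  is congruent to \<open>- j * (h - 1)\<close>, that is to \<open>j\<close>, modulo
  \<open>h\<close>; the cases \<open>b\<close>, \<open>1 - b\<close>, \<open>2 * b\<close> would
  make it -1, 1, -2, which the range of \<open>j\<close> excludes. In the remaining case the sum
  lies between 1 and \<open>h - 1\<close>, so it equals \<open>j\<close>, and the distances
  \<open>ell n x\<close> are the required multipliers.\<close>

lemma weight_multiples:
  fixes h j :: int and w :: "real^3 \<Rightarrow> int"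
  assumes h: "0 < h" and Kh: "K = (of_int h - 1) / of_int h"
    and bw: "\<And>n. n \<in> C \<Longrightarrow> b n = of_int (w n) / of_int h"
    and j: "1 \<le> j" "j < h"
  defines "m \<equiv> \<lambda>n. (- j * w n) mod h"
  shows "n \<in> C \<Longrightarrow> 0 < m n"
    and "2 \<le> j \<Longrightarrow> j \<le> h - 3 \<Longrightarrow> sum m C = 2 * h \<and>
      (\<exists>e. (\<forall>n\<in>C. 0 \<le> e n) \<and> (\<Sum>n\<in>C. m n * e n) = (j::int))"
proof -
  define v where "v n = of_int (m n) / (of_int h :: real)" for n
  have m01: "0 \<le> m n" "m n < h" for n using h by (simp_all add: m_def)
  have v01: "0 \<le> v n" "v n < 1" for n using m01[of n] h by (simp_all add: v_def)
  have v_eq: "v n = - of_int ((- j * w n) div h) - of_int j * b n" if "n \<in> C" for n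
  proof -
    have "- j * w n = h * ((- j * w n) div h) + m n" by (simp add: m_def)
    then have "real_of_int (- j * w n) = of_int h * of_int ((- j * w n) div h) + of_int (m n)"
      by (metis of_int_add of_int_mult)
    then show ?thesis unfolding v_def bw[OF that] using h by (simp add: field_simps)
  qed
  have "admissible (\<lambda>n. of_int j * b n)"
    using b(2,3) by (simp add: admissible_def sum_distrib_left[symmetric] scaleR_scaleR[symmetric]
        scaleR_sum_right[symmetric] del: scaleR_scaleR)
  then have "admissible (\<lambda>n. - of_int ((- j * w n) div h) - of_int j * b n)"
    by (intro admissible_minus_Ints) auto
  moreover have "sum v C = sum (\<lambda>n. - of_int ((- j * w n) div h) - of_int j * b n) C"
    "(\<Sum>n\<in>C. v n *\<^sub>R n) = (\<Sum>n\<in>C. (- of_int ((- j * w n) div h) - of_int j * b n) *\<^sub>R n)"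
    using v_eq by simp_all
  ultimately have adm: "admissible v" by (simp add: admissible_def)
  have sum_we: "(\<Sum>n\<in>C. w n * \<lfloor>ell n x\<rfloor>) = h - 1" if "x \<in> int_lattice" for x
  proof -
    have "real_of_int (\<Sum>n\<in>C. w n * \<lfloor>ell n x\<rfloor>) = (\<Sum>n\<in>C. of_int h * (b n * ell n x))"
      unfolding of_int_sum
    proof (rule sum.cong)
      fix n assume n: "n \<in> C"
      have "of_int \<lfloor>ell n x\<rfloor> = ell n x" using ell_Ints[OF that n] by simp
      then show "real_of_int (w n * \<lfloor>ell n x\<rfloor>) = of_int h * (b n * ell n x)"
        using bw[OF n] h by simp
    qed simp
    also have "\<dots> = of_int h * K" using sum_b_ell[of x] by (simp add: sum_distrib_left[symmetric])
    also have "\<dots> = of_int (h - 1)" using Kh h by simp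
    finally show ?thesis by (simp only: of_int_eq_iff)
  qed
  have sum_me: "h dvd (\<Sum>n\<in>C. m n * \<lfloor>ell n x\<rfloor>) - j" if "x \<in> int_lattice" for x
  proof -
    have "(\<Sum>n\<in>C. m n * \<lfloor>ell n x\<rfloor>) = (\<Sum>n\<in>C. (- j * w n - h * ((- j * w n) div h)) * \<lfloor>ell n x\<rfloor>)"
      unfolding m_def by (simp add: minus_mult_div_eq_mod)
    also have "\<dots> = - j * (\<Sum>n\<in>C. w n * \<lfloor>ell n x\<rfloor>) - h * (\<Sum>n\<in>C. (- j * w n) div h * \<lfloor>ell n x\<rfloor>)"
      by (simp add: left_diff_distrib sum_subtractf sum_distrib_left mult.assoc sum_negf)
    also have "\<dots> - j = h * (- j - (\<Sum>n\<in>C. (- j * w n) div h * \<lfloor>ell n x\<rfloor>))"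
      by (simp add: sum_we[OF that] algebra_simps)
    finally show ?thesis by simp
  qed
  have not_dvd: "\<not> h dvd a" if "0 < a" "a < h" for a using that zdvd_not_zless by blast
  have x0: "0 \<in> (int_lattice :: (real^3) set)" by simp
  obtain k where k: "k \<in> C" "v k \<noteq> 0"
  proof (rule ccontr)
    assume "\<not> thesis"
    then have "\<forall>n\<in>C. v n = 0" using that by blast
    then have "m n = 0" if "n \<in> C" for n using that h by (auto simp: v_def)
    then have "h dvd - j" using sum_me[OF x0] by simp
    then show False using not_dvd[of j] j by simp
  qed
  show "0 < m n" if "n \<in> C"
    using admissible_full_support[OF adm v01 k that] h by (simp add: v_def zero_less_divide_iff)
  show "sum m C = 2 * h \<and> (\<exists>e. (\<forall>n\<in>C. 0 \<le> e n) \<and> (\<Sum>n\<in>C. m n * e n) = j)"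
    if j2: "2 \<le> j" "j \<le> h - 3"
  proof (rule admissible_cases[OF adm v01 k])
    assume vb: "\<And>n. n \<in> C \<Longrightarrow> v n = b n"
    have "m n = w n" if "n \<in> C" for n using vb[OF that] bw[OF that] h by (simp add: v_def)
    then have "(\<Sum>n\<in>C. m n * \<lfloor>ell n 0\<rfloor>) = h - 1" using sum_we[OF x0] by simp
    then show ?thesis using sum_me[OF x0] not_dvd[of "h - 1 - j"] j2 by simp
  next
    assume vb: "\<And>n. n \<in> C \<Longrightarrow> v n = 1 - b n"
    have "m n = h - w n" if "n \<in> C" for n
    proof -
      have "real_of_int (m n) = of_int (h - w n)" using vb[OF that] bw[OF that] h by (simp add: v_def field_simps)
      then show ?thesis by (simp only: of_int_eq_iff)
    qed
    then have "(\<Sum>n\<in>C. m n * \<lfloor>ell n 0\<rfloor>) = h * (\<Sum>n\<in>C. \<lfloor>ell n 0\<rfloor>) - (h - 1)"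
      using sum_we[OF x0] by (simp add: left_diff_distrib sum_subtractf sum_distrib_left)
    then have "(\<Sum>n\<in>C. m n * \<lfloor>ell n 0\<rfloor>) - j = h * ((\<Sum>n\<in>C. \<lfloor>ell n 0\<rfloor>) - 1) - (j - 1)"
      by (simp add: right_diff_distrib)
    then have "h dvd h * ((\<Sum>n\<in>C. \<lfloor>ell n 0\<rfloor>) - 1) - (j - 1)" using sum_me[OF x0] by (simp only:)
    then have "h dvd j - 1" by (metis dvd_diff_commute dvd_triv_left dvd_diffD1 dvd_diff_right_iff)
    then show ?thesis using not_dvd[of "j - 1"] j2 by simp
  next
    assume vb: "\<And>n. n \<in> C \<Longrightarrow> v n = 2 * b n"
    have "m n = 2 * w n" if "n \<in> C" for n
    proof -
      have "real_of_int (m n) = of_int (2 * w n)" using vb[OF that] bw[OF that] h by (simp add: v_def field_simps)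
      then show ?thesis by (simp only: of_int_eq_iff)
    qed
    then have "(\<Sum>n\<in>C. m n * \<lfloor>ell n 0\<rfloor>) = 2 * (h - 1)"
      using sum_we[OF x0] by (simp add: sum_distrib_left[symmetric] mult.assoc)
    then have "(\<Sum>n\<in>C. m n * \<lfloor>ell n 0\<rfloor>) - j = 2 * h - (j + 2)" by simp
    then have "h dvd 2 * h - (j + 2)" using sum_me[OF x0] by (simp only:)
    then have "h dvd j + 2" by (metis dvd_triv_right dvd_diff_right_iff)
    then show ?thesis using not_dvd[of "j + 2"] j2 by simp
  next
    fix x assume x: "sum v C = 2" "x \<in> P" "x \<in> int_lattice"
      "0 < (\<Sum>n\<in>C. v n * ell n x)" "(\<Sum>n\<in>C. v n * ell n x) \<le> K"
    define e where "e n = \<lfloor>ell n x\<rfloor>" for n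
    have e: "of_int (e n) = ell n x" if "n \<in> C" for n using ell_Ints[OF x(3) that] by (simp add: e_def)
    have val: "of_int (\<Sum>n\<in>C. m n * e n) = of_int h * (\<Sum>n\<in>C. v n * ell n x)"
      unfolding of_int_sum sum_distrib_left using e h by (intro sum.cong) (auto simp: v_def)
    have "0 < real_of_int (\<Sum>n\<in>C. m n * e n)" unfolding val using x(4) h by simp
    moreover have "real_of_int (\<Sum>n\<in>C. m n * e n) \<le> of_int (h - 1)"
    proof -
      have "of_int h * (\<Sum>n\<in>C. v n * ell n x) \<le> of_int h * K" using x(5) h by (intro mult_left_mono) auto
      also have "\<dots> = of_int (h - 1)" using Kh h by simp
      finally show ?thesis unfolding val .
    qed
    ultimately have S: "0 < (\<Sum>n\<in>C. m n * e n)" "(\<Sum>n\<in>C. m n * e n) \<le> h - 1"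
      by (simp_all only: of_int_0_less_iff of_int_le_iff)
    have d: "h dvd (\<Sum>n\<in>C. m n * e n) - j" using sum_me[OF x(3)] by (simp add: e_def)
    have "(\<Sum>n\<in>C. m n * e n) = j"
    proof (rule ccontr)
      assume ne: "(\<Sum>n\<in>C. m n * e n) \<noteq> j"
      have "h dvd j - (\<Sum>n\<in>C. m n * e n)" using d by (simp add: dvd_diff_commute)
      then show False
        using d ne S j not_dvd[of "(\<Sum>n\<in>C. m n * e n) - j"] not_dvd[of "j - (\<Sum>n\<in>C. m n * e n)"]
        by (cases "(\<Sum>n\<in>C. m n * e n) < j") auto
    qed
    moreover have "0 \<le> e n" if "n \<in> C" for n
      using ell_nonneg[OF x(2), of n] by (simp add: e_def)
    moreover have "sum m C = 2 * h"
    proof -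
      have "real_of_int (sum m C) = of_int h * sum v C"
        unfolding of_int_sum sum_distrib_left using h by (intro sum.cong) (auto simp: v_def)
      then have "real_of_int (sum m C) = of_int (2 * h)" using x(1) by simp
      then show ?thesis by (simp only: of_int_eq_iff)
    qed
    ultimately show ?thesis by blast
  qed
qed

text \<open>Affine coordinates of \<open>x\<close> become integral after adding a multiple of
  \<open>b\<close>, by \<open>admissible_integral\<close>; the combination does not change, since
  \<open>b\<close> combines to 0.\<close>

lemma lattice_generated:
  assumes x: "x \<in> int_lattice"
  obtains z :: "real^3 \<Rightarrow> int" where "x = (\<Sum>n\<in>C. of_int (z n) *\<^sub>R n)"
proof -
  have "aff_dim C = 3" using C(2,3) card_C by (simp add: affine_independent_iff_card)
  then have "affine hull C = UNIV" using aff_dim_eq_full[of C] by simp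
  then have "x \<in> affine hull C" by simp
  then obtain v where v: "sum v C = 1" "(\<Sum>n\<in>C. v n *\<^sub>R n) = x"
    using affine_hull_finite[OF C(2)] by auto
  have adm: "admissible v" using v x by (simp add: admissible_def)
  define k where "k = \<lfloor>(\<Sum>n\<in>C. v n * ell n 0) / (1 - K)\<rfloor>"
  have int: "v n + of_int k * b n \<in> \<int>" if "n \<in> C" for n
    using admissible_integral[OF adm int_lattice_0 _ that] by (simp add: k_def)
  have "(\<Sum>n\<in>C. of_int \<lfloor>v n + of_int k * b n\<rfloor> *\<^sub>R n) = (\<Sum>n\<in>C. (v n + of_int k * b n) *\<^sub>R n)"
    using int by (intro sum.cong) auto
  also have "\<dots> = (\<Sum>n\<in>C. v n *\<^sub>R n) + of_int k *\<^sub>R (\<Sum>n\<in>C. b n *\<^sub>R n)"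
    by (simp add: scaleR_add_left sum.distrib scaleR_sum_right)
  finally have "x = (\<Sum>n\<in>C. of_int \<lfloor>v n + of_int k * b n\<rfloor> *\<^sub>R n)" using v(2) b(3) by simp
  then show ?thesis by (rule that)
qed

lemma sporadic_normals:
  obtains n0 n1 n2 n3 :: "real^3" and w0 w1 w2 :: int
  where "(w0, w1, w2) \<in> {(1,1,1), (2,1,1), (3,2,1)}" "n0 \<in> C" "n1 \<in> C" "n2 \<in> C" "n3 \<in> C"
    "of_int w0 *\<^sub>R n0 + of_int w1 *\<^sub>R n1 + of_int w2 *\<^sub>R n2 + n3 = 0"
    "min_multiplier P = of_int (w0 + w1 + w2 + 1) / of_int (w0 + w1 + w2)"
    "of_int w0 * Min_on P n0 + of_int w1 * Min_on P n1 + of_int w2 * Min_on P n2 + Min_on P n3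
      = - of_int (w0 + w1 + w2)"
    "\<And>x. x \<in> int_lattice \<Longrightarrow> \<exists>z0 z1 z2 :: int. x = of_int z0 *\<^sub>R n0 + of_int z1 *\<^sub>R n1 + of_int z2 *\<^sub>R n2"
proof -
  obtain h :: int and w where hw: "0 < h" "K = (of_int h - 1) / of_int h"
    "\<And>n. n \<in> C \<Longrightarrow> b n = of_int (w n) / of_int h"
    using obtain_weights by metis
  obtain n0 n1 n2 n3 where n: "C = {n0, n1, n2, n3}" "distinct [n0, n1, n2, n3]"
    "w n0 \<ge> w n1" "w n1 \<ge> w n2" "w n2 \<ge> w n3"
    using distinct_four[OF C(2) card_C, of w] by metis
  have sumC: "sum f C = f n0 + f n1 + f n2 + f n3" for f :: "real^3 \<Rightarrow> 'b::comm_monoid_add"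
    using n(1,2) by (simp add: add.assoc)
  have wpos: "1 \<le> w k" if "k \<in> C" for k
    using b(1)[OF that] hw(1) hw(3)[OF that] by (simp add: zero_less_divide_iff)
  have "(\<Sum>n\<in>C. b n) = (\<Sum>n\<in>C. of_int (w n) / of_int h)" using hw(3) by simp
  then have "of_int (sum w C) / of_int h = (1::real)" using b(2) by (simp add: sum_divide_distrib)
  then have sw: "sum w C = h" using hw(1) by (simp add: field_simps flip: of_int_sum)
  have "2 * w n0 \<le> h - 1"
  proof -
    have "2 * of_int (w n0) / of_int h \<le> (of_int h - 1) / (of_int h :: real)"
      using two_b_le_K[of n0] hw n(1) by simp
    then have "2 * of_int (w n0) \<le> of_int h - (1::real)" using hw(1) by (simp add: divide_le_cancel)
    then show ?thesis by linarith
  qed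
  have "(w n0, w n1, w n2, w n3) \<in> {(1,1,1,1), (2,1,1,1), (3,2,1,1)}"
  proof (rule sporadic_weights[of _ _ _ _ h])
    show "w n0 + w n1 + w n2 + w n3 = h" using sw sumC[of w] by simp
    show "1 \<le> w n3" using wpos n(1) by simp
    show "0 < (- j * u) mod h" if "1 \<le> j" "j < h" "u \<in> {w n0, w n1, w n2, w n3}" for j u
      using weight_multiples(1)[OF hw that(1,2)] n(1) that(3) by auto
    show "(- j * w n0) mod h + (- j * w n1) mod h + (- j * w n2) mod h + (- j * w n3) mod h = 2 * h"
      if "2 \<le> j" "j \<le> h - 3" for j
      using weight_multiples(2)[OF hw, of j] that sumC[of "\<lambda>n. (- j * w n) mod h"] by simp
    show "\<exists>l0 l1 l2 l3 :: int. 0 \<le> l0 \<and> 0 \<le> l1 \<and> 0 \<le> l2 \<and> 0 \<le> l3 \<and>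
      (- j * w n0) mod h * l0 + (- j * w n1) mod h * l1 + (- j * w n2) mod h * l2 + (- j * w n3) mod h * l3 = j"
      if j: "2 \<le> j" "j \<le> h - 3" for j
    proof -
      obtain e where e: "\<forall>n\<in>C. 0 \<le> e n" "(\<Sum>n\<in>C. (- j * w n) mod h * e n) = j"
        using weight_multiples(2)[OF hw, of j] j by auto
      then show ?thesis
        using sumC[of "\<lambda>n. (- j * w n) mod h * e n"] n(1)
        by (intro exI[of _ "e n0"] exI[of _ "e n1"] exI[of _ "e n2"] exI[of _ "e n3"]) auto
    qed
  qed (use n \<open>2 * w n0 \<le> h - 1\<close> in auto)
  then have types: "(w n0, w n1, w n2) \<in> {(1,1,1), (2,1,1), (3,2,1)}" and w3: "w n3 = 1" by auto
  have h_eq: "h = w n0 + w n1 + w n2 + 1" using sw sumC[of w] w3 by simp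
  have rel: "of_int (w n0) *\<^sub>R n0 + of_int (w n1) *\<^sub>R n1 + of_int (w n2) *\<^sub>R n2 + n3 = 0"
  proof -
    have "(\<Sum>n\<in>C. of_int (w n) *\<^sub>R n) = of_int h *\<^sub>R (\<Sum>n\<in>C. b n *\<^sub>R n)"
      unfolding scaleR_sum_right using hw by (intro sum.cong) auto
    then show ?thesis using b(3) w3 sumC[of "\<lambda>n. of_int (w n) *\<^sub>R n"] by simp
  qed
  have mm: "min_multiplier P = of_int (w n0 + w n1 + w n2 + 1) / of_int (w n0 + w n1 + w n2)"
  proof -
    have "1 / min_multiplier P = (of_int h - 1) / of_int h" using hw(2) by (simp add: K_def)
    then have "min_multiplier P = of_int h / (of_int h - 1)" by (metis inverse_divide inverse_eq_divide inverse_inverse_eq)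
    then show ?thesis by (simp add: h_eq)
  qed
  have Min: "of_int (w n0) * Min_on P n0 + of_int (w n1) * Min_on P n1 + of_int (w n2) * Min_on P n2 + Min_on P n3
      = - of_int (w n0 + w n1 + w n2)"
  proof -
    have "(\<Sum>n\<in>C. of_int (w n) * Min_on P n) = of_int h * (\<Sum>n\<in>C. b n * Min_on P n)"
      unfolding sum_distrib_left using hw by (intro sum.cong) auto
    also have "\<dots> = - (of_int h - 1)" using sum_b_Min hw(1,2) by simp
    finally show ?thesis using sumC[of "\<lambda>n. of_int (w n) * Min_on P n"] w3 h_eq by simp
  qed
  have gen: "\<exists>z0 z1 z2 :: int. x = of_int z0 *\<^sub>R n0 + of_int z1 *\<^sub>R n1 + of_int z2 *\<^sub>R n2"
    if xL: "x \<in> int_lattice" for x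
  proof -
    obtain z :: "real^3 \<Rightarrow> int" where z: "x = (\<Sum>n\<in>C. of_int (z n) *\<^sub>R n)"
      using lattice_generated[OF xL] by blast
    have x: "x = of_int (z n0) *\<^sub>R n0 + of_int (z n1) *\<^sub>R n1 + of_int (z n2) *\<^sub>R n2 + of_int (z n3) *\<^sub>R n3"
      using z sumC[of "\<lambda>n. of_int (z n) *\<^sub>R n"] by simp
    \<comment> \<open>The smallest weight being 1, \<open>n3\<close> can be eliminated, and
      \<open>n0, n1, n2\<close> already generate the lattice.\<close>
    have n3: "n3 = - (of_int (w n0) *\<^sub>R n0 + of_int (w n1) *\<^sub>R n1 + of_int (w n2) *\<^sub>R n2)"
      using minus_unique[OF rel] by simp
    have "x = of_int (z n0 - z n3 * w n0) *\<^sub>R n0 + of_int (z n1 - z n3 * w n1) *\<^sub>R n1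
        + of_int (z n2 - z n3 * w n2) *\<^sub>R n2"
      by (subst x, subst n3) (simp add: algebra_simps)
    then show ?thesis by blast
  qed
  show ?thesis using that[OF types _ _ _ _ rel mm Min gen] n(1) by blast
qed

end

subsection \<open>Unimodular equivalence\<close>

lemma affine_unimodularE:
  fixes f :: "'a::euclidean_space \<Rightarrow> 'b::euclidean_space"
  assumes "affine_unimodular f"
  obtains A where "linear A" "\<And>x. f x = A x + f 0" "bij A" "f 0 \<in> int_lattice"
    "\<And>x. x \<in> int_lattice \<Longrightarrow> A x \<in> int_lattice"
proof -
  obtain A b where A: "linear A" "f = (\<lambda>x. A x + b)" and f: "bij f" "f ` int_lattice = int_lattice"
    using assms unfolding affine_unimodular_def by blast
  have f0: "f 0 = b" using A linear_0 by auto
  have bL: "b \<in> int_lattice" using f(2) f0 int_lattice_0 by (metis image_eqI)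
  have "A = (\<lambda>y. y - b) \<circ> f" using A(2) by (simp add: fun_eq_iff)
  moreover have "bij (\<lambda>y. y - b)" by (rule o_bij[of "\<lambda>y. y + b"]) auto
  ultimately have "bij A" using f(1) bij_comp by blast
  moreover have "A x \<in> int_lattice" if "x \<in> int_lattice" for x
  proof -
    have "f x \<in> int_lattice" using that f(2) by blast
    then have "f x - b \<in> int_lattice" using bL by (rule int_lattice_diff)
    then show ?thesis using A(2) by simp
  qed
  moreover have "f x = A x + f 0" for x unfolding f0 by (simp add: A(2))
  ultimately show ?thesis using that[of A] A(1) bL unfolding f0 by blast
qed

lemma affine_unimodular_comp:
  assumes "affine_unimodular f" "affine_unimodular g"
  shows "affine_unimodular (g \<circ> f)"
proof -
  obtain A a where A: "linear A" "f = (\<lambda>x. A x + a)" using assms(1) unfolding affine_unimodular_def by blast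
  obtain B b where B: "linear B" "g = (\<lambda>x. B x + b)" using assms(2) unfolding affine_unimodular_def by blast
  have "g \<circ> f = (\<lambda>x. (B \<circ> A) x + (B a + b))" using A B linear_add[OF B(1)] by (auto simp: fun_eq_iff)
  moreover have "linear (B \<circ> A)" using A(1) B(1) by (rule linear_compose)
  moreover have "bij f" "bij g" "f ` int_lattice = int_lattice" "g ` int_lattice = int_lattice"
    using assms by (auto simp: affine_unimodular_def)
  then have "bij (g \<circ> f)" "(g \<circ> f) ` int_lattice = int_lattice"
    by (blast intro: bij_comp, metis image_comp)
  ultimately show ?thesis unfolding affine_unimodular_def by blast
qed

lemma affine_unimodular_inv:
  fixes f :: "'a::euclidean_space \<Rightarrow> 'b::euclidean_space"
  assumes "affine_unimodular f"
  shows "affine_unimodular (inv f)"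
proof -
  obtain A where A: "linear A" "\<And>x. f x = A x + f 0" "bij A"
    using affine_unimodularE[OF assms] by metis
  have f: "bij f" "f ` int_lattice = int_lattice" using assms by (auto simp: affine_unimodular_def)
  have linv: "linear (inv A)"
  proof (rule linearI)
    note ii = bij_is_inj[OF A(3)] surj_f_inv_f[OF bij_is_surj[OF A(3)]]
    show "inv A (x + y) = inv A x + inv A y" for x y
      by (rule injD[OF ii(1)]) (simp add: linear_add[OF A(1)] ii(2))
    show "inv A (c *\<^sub>R x) = c *\<^sub>R inv A x" for c x
      by (rule injD[OF ii(1)]) (simp add: linear_cmul[OF A(1)] ii(2))
  qed
  have "inv f y = inv A y + inv A (- f 0)" for y
  proof -
    have "f (inv A y + inv A (- f 0)) = A (inv A y + inv A (- f 0)) + f 0" by (rule A(2))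
    also have "\<dots> = y"
      by (simp add: linear_add[OF A(1)] surj_f_inv_f[OF bij_is_surj[OF A(3)]])
    finally have "f (inv A y + inv A (- f 0)) = y" .
    then show ?thesis using f(1) by (metis bij_inv_eq_iff)
  qed
  then have "inv f = (\<lambda>y. inv A y + inv A (- f 0))" by (rule ext)
  moreover have "inv f ` int_lattice = int_lattice"
    using image_inv_f_f[OF bij_is_inj[OF f(1)], of int_lattice] f(2) by simp
  moreover have "bij (inv f)" using f(1) by (rule bij_imp_bij_inv)
  ultimately show ?thesis using linv unfolding affine_unimodular_def by blast
qed

lemma unimodular_equiv_refl: "(P, P) \<in> unimodular_equiv"
proof -
  have "affine_unimodular (\<lambda>x::'a. x)"
    by (rule affine_unimodular_linearI[of _ "\<lambda>x. x"]) (auto intro: linear_ident)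
  then show ?thesis unfolding unimodular_equiv_def by (auto intro!: exI[of _ "\<lambda>x. x"])
qed

lemma unimodular_equiv_sym: "(P, Q) \<in> unimodular_equiv \<Longrightarrow> (Q, P) \<in> unimodular_equiv"
proof -
  assume "(P, Q) \<in> unimodular_equiv"
  then obtain f where f: "affine_unimodular f" "f ` P = Q" by (auto simp: unimodular_equiv_def)
  then have "inv f ` Q = P" using image_inv_f_f[of f P] bij_is_inj affine_unimodular_def by metis
  then show ?thesis using affine_unimodular_inv[OF f(1)] by (auto simp: unimodular_equiv_def)
qed

lemma unimodular_equiv_trans:
  assumes "(P, Q) \<in> unimodular_equiv" "(Q, R) \<in> unimodular_equiv"
  shows "(P, R) \<in> unimodular_equiv"
proof -
  obtain f g where "affine_unimodular f" "f ` P = Q" "affine_unimodular g" "g ` Q = R"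
    using assms by (auto simp: unimodular_equiv_def)
  then have "affine_unimodular (g \<circ> f)" "(g \<circ> f) ` P = R"
    using affine_unimodular_comp by (auto simp: image_comp[symmetric])
  then show ?thesis unfolding unimodular_equiv_def by blast
qed

lemma equiv_unimodular_equiv: "equiv UNIV unimodular_equiv"
  by (intro equivI refl_onI symI transI)
    (auto intro: unimodular_equiv_refl unimodular_equiv_sym unimodular_equiv_trans)

text \<open>Normals are pulled back by the adjoint. Dilating the image of \<open>P\<close> by
  \<open>c\<close> multiplies the translation part as well, whence \<open>c\<close> times
  \<open>f 0\<close>.\<close>

lemma Fine_interior_affine_image:
  fixes f :: "'a::euclidean_space \<Rightarrow> 'b::euclidean_space"
  assumes f: "affine_unimodular f" and A: "linear A" "\<And>x. f x = A x + f 0"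
    and P: "compact P" "P \<noteq> {}" and c: "0 \<le> c" and x: "x \<in> Fine_interior ((*\<^sub>R) c ` P)"
  shows "A x + c *\<^sub>R f 0 \<in> Fine_interior ((*\<^sub>R) c ` f ` P)"
proof -
  obtain B where B: "linear B" "\<And>x. f x = B x + f 0" "bij B"
    "\<And>x. x \<in> int_lattice \<Longrightarrow> B x \<in> int_lattice"
    using affine_unimodularE[OF f] by metis
  have "A = B" using A(2) B(2) by (metis add_right_cancel ext)
  note adj = adjoint_works[OF A(1)]
  have cont: "continuous_on P f"
    using A by (subst A(2)[abs_def]) (intro continuous_intros linear_continuous_on, simp add: linear_conv_bounded_linear)
  have fP: "compact (f ` P)" "f ` P \<noteq> {}" using P compact_continuous_image[OF cont] by auto
  show ?thesis
    unfolding Fine_interior_scaleR_iff[OF fP c]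
  proof
    fix n :: 'b assume n: "n \<in> int_lattice - {0}"
    let ?m = "adjoint A n"
    have "?m \<in> int_lattice"
      unfolding int_lattice_def
    proof clarify
      fix b :: 'a assume "b \<in> Basis"
      then have "A b \<in> int_lattice" using B(4) \<open>A = B\<close> int_lattice_Basis by blast
      then have "A b \<bullet> n \<in> \<int>" using n by (intro int_lattice_inner) auto
      then show "?m \<bullet> b \<in> \<int>" using adj[of b n] by (simp add: inner_commute)
    qed
    moreover have "?m \<noteq> 0"
    proof
      assume m0: "?m = 0"
      obtain y where "A y = n" using B(3) \<open>A = B\<close> by (metis bij_pointE)
      then have "n \<bullet> n = y \<bullet> ?m" using adj[of y n] by simp
      then show False using m0 n by simp
    qed
    ultimately have 1: "c * Min_on P ?m + 1 \<le> x \<bullet> ?m"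
      using Fine_interior_scaleR_D[OF x P c] by blast
    obtain q where q: "q \<in> P" "Min_on P ?m = q \<bullet> ?m" using Min_on_attained[OF P] .
    have "Min_on (f ` P) n \<le> f q \<bullet> n" using Min_on_le[OF fP(1)] q by blast
    also have "\<dots> = Min_on P ?m + f 0 \<bullet> n" using q adj[of q n] A(2)[of q] by (simp add: inner_add_left)
    finally have "c * Min_on (f ` P) n \<le> c * (Min_on P ?m + f 0 \<bullet> n)" using c by (rule mult_left_mono)
    then show "c * Min_on (f ` P) n + 1 \<le> (A x + c *\<^sub>R f 0) \<bullet> n"
      using 1 adj[of x n] by (simp add: inner_add_left algebra_simps)
  qed
qed

lemma min_multiplier_unimodular:
  fixes f :: "'a::euclidean_space \<Rightarrow> 'b::euclidean_space"
  assumes f: "affine_unimodular f" and P: "compact P" "P \<noteq> {}"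
  shows "min_multiplier (f ` P) = min_multiplier P"
proof -
  \<comment> \<open>Stated for arbitrary spaces, since it is applied to \<open>f\<close> and to
    \<open>inv f\<close>.\<close>
  have fwd: "Fine_interior ((*\<^sub>R) c ` g ` Q) \<noteq> {}"
    if g: "affine_unimodular g" and Q: "compact Q" "Q \<noteq> {}" and c: "0 \<le> c"
      and ne: "Fine_interior ((*\<^sub>R) c ` Q) \<noteq> {}"
    for g :: "'c::euclidean_space \<Rightarrow> 'd::euclidean_space" and Q c
  proof -
    obtain A where A: "linear A" "\<And>x. g x = A x + g 0" using affine_unimodularE[OF g] by metis
    then show ?thesis using Fine_interior_affine_image[OF g A Q c] ne by blast
  qed
  obtain A where A: "linear A" "\<And>x. f x = A x + f 0" using affine_unimodularE[OF f] by metis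
  have cont: "continuous_on P f"
    using A by (subst A(2)[abs_def]) (intro continuous_intros linear_continuous_on, simp add: linear_conv_bounded_linear)
  have fP: "compact (f ` P)" "f ` P \<noteq> {}" using P compact_continuous_image[OF cont] by auto
  have inv: "inv f ` f ` P = P"
    using f by (intro image_inv_f_f) (auto simp: affine_unimodular_def bij_is_inj)
  have "Fine_interior ((*\<^sub>R) c ` f ` P) \<noteq> {} \<longleftrightarrow> Fine_interior ((*\<^sub>R) c ` P) \<noteq> {}" if "0 \<le> c" for c
    using fwd[OF f P that] fwd[OF affine_unimodular_inv[OF f] fP that] unfolding inv by blast
  then have "(\<lambda>c. 0 \<le> c \<and> Fine_interior ((*\<^sub>R) c ` f ` P) \<noteq> {}) = (\<lambda>c. 0 \<le> c \<and> Fine_interior ((*\<^sub>R) c ` P) \<noteq> {})"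
    by (intro ext conj_cong refl) auto
  then show ?thesis unfolding min_multiplier_def by simp
qed

lemma lattice_polytope_unimodular:
  fixes f :: "'a::euclidean_space \<Rightarrow> 'a"
  assumes f: "affine_unimodular f" and P: "lattice_polytope P"
  shows "lattice_polytope (f ` P)"
proof -
  obtain A where A: "linear A" "\<And>x. f x = A x + f 0" "bij A" "f 0 \<in> int_lattice"
    "\<And>x. x \<in> int_lattice \<Longrightarrow> A x \<in> int_lattice"
    using affine_unimodularE[OF f] by metis
  have AP: "lattice_polytope (A ` P)"
    using A(1,3,5) by (intro lattice_polytope_linear_image[OF P]) (auto simp: bij_is_surj)
  have fP: "f ` P = (+) (f 0) ` (A ` P)" by (subst A(2)[abs_def]) (auto simp: image_image add.commute)
  show ?thesis
    unfolding lattice_polytope_def fP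
  proof (intro conjI allI impI)
    show "polytope ((+) (f 0) ` (A ` P))" using AP polytope_translation_eq lattice_polytope_def by metis
    show "aff_dim ((+) (f 0) ` (A ` P)) = int DIM('a)"
      using AP by (simp add: lattice_polytope_def aff_dim_translation_eq)
    fix v assume "v extreme_point_of (+) (f 0) ` (A ` P)"
    then have "v - f 0 extreme_point_of (A ` P)"
      using extreme_point_of_translation_eq[of "f 0" "v - f 0" "A ` P"] by simp
    then have "v - f 0 \<in> int_lattice" using AP by (simp add: lattice_polytope_def)
    then have "v - f 0 + f 0 \<in> int_lattice" using A(4) by (rule int_lattice_add)
    then show "v \<in> int_lattice" by simp
  qed
qed

subsection \<open>The three maximal simplices\<close>

text \<open>Integer triples stand for lattice vectors wherever something is evaluated;
  \<open>pt\<close> leads back to the space.\<close>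

definition pt :: "int \<times> int \<times> int \<Rightarrow> real^3" where
  "pt t = (case t of (x, y, z) \<Rightarrow> vector [of_int x, of_int y, of_int z])"

definition dot :: "int \<times> int \<times> int \<Rightarrow> int \<times> int \<times> int \<Rightarrow> int" where
  "dot s t = (case s of (a, b, c) \<Rightarrow> case t of (x, y, z) \<Rightarrow> a * x + b * y + c * z)"

text \<open>The simplex with barycentric-like coordinates \<open>x\<^sub>1, x\<^sub>2, x\<^sub>3\<close> and
  \<open>w\<^sub>0 + w\<^sub>1 + w\<^sub>2 - w\<cdot>x\<close>, whose weights are \<open>w\<^sub>0, w\<^sub>1, w\<^sub>2\<close> and 1.\<close>

definition weighted_simplex :: "int \<times> int \<times> int \<Rightarrow> (real^3) set" where
  "weighted_simplex w = {x. 0 \<le> x $ 1 \<and> 0 \<le> x $ 2 \<and> 0 \<le> x $ 3 \<and> pt w \<bullet> x \<le> of_int (dot w (1, 1, 1))}"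

definition weight_types :: "(int \<times> int \<times> int) set" where
  "weight_types = {(1, 1, 1), (2, 1, 1), (3, 2, 1)}"

definition lattice_points :: "(real^3) set \<Rightarrow> (int \<times> int \<times> int) set" where
  "lattice_points Q = {t. pt t \<in> Q}"

lemma inner3: "x \<bullet> y = x $ 1 * y $ 1 + x $ 2 * y $ 2 + x $ 3 * y $ 3" for x y :: "real^3"
  by (simp add: inner_vec_def sum_3)

lemma pt_nth [simp]: "pt (x, y, z) $ 1 = of_int x" "pt (x, y, z) $ 2 = of_int y" "pt (x, y, z) $ 3 = of_int z"
  by (simp_all add: pt_def)

lemma pt_inner: "pt s \<bullet> pt t = of_int (dot s t)"
  by (cases s; cases t) (simp add: inner3 dot_def)

lemma dot_commute: "dot s t = dot t s"
  by (cases s; cases t) (simp add: dot_def)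

lemma pt_lattice [simp]: "pt t \<in> int_lattice"
  by (cases t) (simp add: int_lattice_real3)

lemma int_lattice_ptE:
  assumes "x \<in> int_lattice"
  obtains t where "x = pt t"
proof -
  obtain a b c where "x $ 1 = of_int a" "x $ 2 = of_int b" "x $ 3 = of_int c"
    using assms by (auto simp: int_lattice_real3 elim!: Ints_cases)
  then have "x = pt (a, b, c)" by (simp add: vec_eq_iff forall_3)
  then show ?thesis by (rule that)
qed

lemma pt_eq_iff: "pt s = pt t \<longleftrightarrow> s = t"
  by (cases s; cases t) (simp add: vec_eq_iff forall_3)

lemma pt_eq_0_iff: "pt t = 0 \<longleftrightarrow> t = (0, 0, 0)"
  by (cases t) (simp add: vec_eq_iff forall_3)

lemma convex_weighted_simplex: "convex (weighted_simplex w)"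
proof -
  have "weighted_simplex w = {x. 0 \<le> axis 1 1 \<bullet> x} \<inter> {x. 0 \<le> axis 2 1 \<bullet> x} \<inter> {x. 0 \<le> axis 3 1 \<bullet> x} \<inter>
      {x. pt w \<bullet> x \<le> of_int (dot w (1, 1, 1))}"
    by (auto simp: weighted_simplex_def inner_axis')
  moreover have "convex \<dots>"
    by (intro convex_Int convex_halfspace_le convex_halfspace_ge[of 0, simplified])
  ultimately show ?thesis by simp
qed

lemma Delta_eq:
  assumes k: "0 < k1" "0 < k2" "0 < k3"
  shows "Delta k1 k2 k3 = {x. 0 \<le> x $ 1 \<and> 0 \<le> x $ 2 \<and> 0 \<le> x $ 3 \<and> x $ 1 / k1 + x $ 2 / k2 + x $ 3 / k3 \<le> 1}"
    (is "_ = ?S")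
proof
  have "?S = {x. 0 \<le> axis 1 1 \<bullet> x} \<inter> {x. 0 \<le> axis 2 1 \<bullet> x} \<inter> {x. 0 \<le> axis 3 1 \<bullet> x} \<inter>
      {x. vector [1 / k1, 1 / k2, 1 / k3] \<bullet> x \<le> 1}"
    by (auto simp: inner3 axis_def)
  moreover have "convex \<dots>" 
    by (intro convex_Int convex_halfspace_le convex_halfspace_ge[of 0, simplified])
  ultimately have "convex ?S" by simp
  moreover have "{0, axis 1 (real k1), axis 2 (real k2), axis 3 (real k3)} \<subseteq> ?S"
    using k by (auto simp: axis_def)
  ultimately show "Delta k1 k2 k3 \<subseteq> ?S" unfolding Delta_def by (intro hull_minimal)
  show "?S \<subseteq> Delta k1 k2 k3"
  proof
    fix x assume x: "x \<in> ?S"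
    let ?a = "\<lambda>i::nat. if i = 0 then 1 - (x $ 1 / k1 + x $ 2 / k2 + x $ 3 / k3)
      else if i = 1 then x $ 1 / k1 else if i = 2 then x $ 2 / k2 else x $ 3 / k3"
    let ?y = "\<lambda>i::nat. if i = 0 then 0 else if i = 1 then axis 1 (real k1)
      else if i = 2 then axis 2 (real k2) else axis 3 (real k3) :: real^3"
    have "(\<Sum>i\<in>{0,1,2,3}. ?a i *\<^sub>R ?y i) \<in> Delta k1 k2 k3"
      unfolding Delta_def using x k by (intro convex_sum) (auto intro: hull_inc)
    moreover have "(\<Sum>i\<in>{0,1,2,3}. ?a i *\<^sub>R ?y i) = x"
      using k by (simp add: vec_eq_iff forall_3 axis_def)
    ultimately show "x \<in> Delta k1 k2 k3" by simp
  qed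
qed

lemma Delta_weighted_simplex:
  "Delta 3 3 3 = weighted_simplex (1, 1, 1)" "Delta 2 4 4 = weighted_simplex (2, 1, 1)"
  "Delta 2 3 6 = weighted_simplex (3, 2, 1)"
  by (auto simp: Delta_eq weighted_simplex_def inner3 dot_def field_simps)

lemma sporadic_in_simplex:
  assumes P: "sporadic_F_hollow P"
  obtains w Q where "w \<in> weight_types" "(P, Q) \<in> unimodular_equiv" "lattice_polytope Q"
    "Q \<subseteq> weighted_simplex w" "min_multiplier P = (of_int (dot w (1, 1, 1)) + 1) / of_int (dot w (1, 1, 1))"
    "min_multiplier Q = min_multiplier P"
proof -
  have lp: "lattice_polytope P"
    using P by (simp add: sporadic_F_hollow_def weakly_sporadic_F_hollow_def F_hollow_def)
  note Pp = lattice_polytope_props[OF lp]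
  obtain p where p: "p \<in> Fine_interior ((*\<^sub>R) (min_multiplier P) ` P)"
    using min_multiplier_attained(2)[OF Pp(1,2,5)] by blast
  obtain C b where C: "C \<subseteq> support P p" "finite C" "\<not> affine_dependent C"
    "int_lattice \<inter> convex hull C \<subseteq> insert 0 C"
    "\<And>n. n \<in> C \<Longrightarrow> 0 < b n" "sum b C = 1" "(\<Sum>n\<in>C. b n *\<^sub>R n) = 0"
    using irreducible_circuit[OF lp p] by blast
  interpret sporadic_circuit P p C b by (unfold_locales) (use P p C in auto)
  obtain n0 n1 n2 n3 w0 w1 w2 where n:
    "(w0, w1, w2) \<in> {(1,1,1), (2,1,1), (3,2,1::int)}" "n0 \<in> C" "n1 \<in> C" "n2 \<in> C" "n3 \<in> C"
    "of_int w0 *\<^sub>R n0 + of_int w1 *\<^sub>R n1 + of_int w2 *\<^sub>R n2 + n3 = 0"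
    "min_multiplier P = of_int (w0 + w1 + w2 + 1) / of_int (w0 + w1 + w2)"
    "of_int w0 * Min_on P n0 + of_int w1 * Min_on P n1 + of_int w2 * Min_on P n2 + Min_on P n3
      = - of_int (w0 + w1 + w2)"
    "\<And>x. x \<in> int_lattice \<Longrightarrow> \<exists>z0 z1 z2 :: int. x = of_int z0 *\<^sub>R n0 + of_int z1 *\<^sub>R n1 + of_int z2 *\<^sub>R n2"
    using sporadic_normals by metis
  define A :: "real^3 \<Rightarrow> real^3" where "A x = vector [x \<bullet> n0, x \<bullet> n1, x \<bullet> n2]" for x
  have linA: "linear A"
    by (rule linearI) (simp_all add: A_def vec_eq_iff forall_3 inner_add_left)
  have "\<exists>z :: int \<times> int \<times> int. axis i 1 = of_int (fst z) *\<^sub>R n0 + of_int (fst (snd z)) *\<^sub>R n1 + of_int (snd (snd z)) *\<^sub>R n2"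
    for i :: 3
  proof -
    have "axis i 1 \<in> (int_lattice :: (real^3) set)" by (rule int_lattice_Basis) (simp add: axis_in_Basis_iff)
    then obtain z0 z1 z2 :: int where "axis i 1 = of_int z0 *\<^sub>R n0 + of_int z1 *\<^sub>R n1 + of_int z2 *\<^sub>R n2"
      using n(9) by blast
    then show ?thesis by (intro exI[of _ "(z0, z1, z2)"]) simp
  qed
  then obtain z :: "3 \<Rightarrow> int \<times> int \<times> int" where
    z: "\<And>i. axis i 1 = of_int (fst (z i)) *\<^sub>R n0 + of_int (fst (snd (z i))) *\<^sub>R n1 + of_int (snd (snd (z i))) *\<^sub>R n2"
    by metis
  \<comment> \<open>Row \<open>i\<close> holds the coefficients of the \<open>i\<close>-th unit
    vector in terms of \<open>n0, n1, n2\<close>, so the inverse of \<open>A\<close> is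
    integral.\<close>
  define B :: "real^3 \<Rightarrow> real^3" where "B y = (\<chi> i. pt (z i) \<bullet> y)" for y
  have linB: "linear B" by (rule linearI) (simp_all add: B_def vec_eq_iff inner_add_right)
  have BA: "B (A x) = x" for x
  proof -
    have "B (A x) $ i = x \<bullet> axis i 1" for i
      unfolding z by (cases "z i") (simp add: B_def A_def inner3[of "pt _"] inner_add_right)
    then show ?thesis by (simp add: vec_eq_iff inner_axis)
  qed
  have "inj A" using BA by (metis injI)
  then have "surj A" by (rule linear_inj_imp_surj[OF linA])
  then have AB: "A (B y) = y" for y using BA by (metis surj_def)
  have AL: "A x \<in> int_lattice" if "x \<in> int_lattice" for x
    using that C_lattice(1) n(2-4) by (simp add: A_def int_lattice_real3 int_lattice_inner)
  have BL: "B y \<in> int_lattice" if "y \<in> int_lattice" for y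
    using int_lattice_inner[OF pt_lattice that] by (simp add: B_def int_lattice_real3)
  \<comment> \<open>This translation makes the coordinates of \<open>f x\<close> the distances
    \<open>ell n0 x\<close>, \<open>ell n1 x\<close>, \<open>ell n2 x\<close>. The weighted sum of
    all four distances being constant, \<open>ell n3 x >= 0\<close> becomes the fourth
    inequality.\<close>
  define c :: "real^3" where "c = vector [- Min_on P n0, - Min_on P n1, - Min_on P n2]"
  have cL: "c \<in> int_lattice"
    using lattice_polytope_Min_on_Ints[OF lp C_lattice(1)] n(2-4) by (simp add: c_def int_lattice_real3)
  define f where "f x = A x + c" for x
  have f: "affine_unimodular f"
    unfolding affine_unimodular_def
  proof (intro conjI exI)
    show "linear A" "f = (\<lambda>x. A x + c)" by (fact linA, simp add: f_def[abs_def])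
    have gf: "B (f x - c) = x" "f (B (y - c)) = y" for x y by (simp_all add: f_def AB BA)
    show "bij f" by (rule o_bij[of "\<lambda>y. B (y - c)"]) (auto simp: gf)
    show "f ` int_lattice = int_lattice"
    proof
      show "f ` int_lattice \<subseteq> int_lattice" using AL cL int_lattice_add by (auto simp: f_def)
      show "int_lattice \<subseteq> f ` int_lattice"
      proof
        fix y :: "real^3" assume "y \<in> int_lattice"
        then have "B (y - c) \<in> int_lattice" using BL cL int_lattice_diff by blast
        then show "y \<in> f ` int_lattice" using gf(2) by (metis imageI)
      qed
    qed
  qed
  have sub: "f ` P \<subseteq> weighted_simplex (w0, w1, w2)"
  proof clarify
    fix x assume x: "x \<in> P"
    have f_nth: "f x $ 1 = ell n0 x" "f x $ 2 = ell n1 x" "f x $ 3 = ell n2 x"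
      by (simp_all add: f_def A_def c_def ell_def)
    have "of_int w0 * ell n0 x + of_int w1 * ell n1 x + of_int w2 * ell n2 x + ell n3 x
      = x \<bullet> (of_int w0 *\<^sub>R n0 + of_int w1 *\<^sub>R n1 + of_int w2 *\<^sub>R n2 + n3) -
        (of_int w0 * Min_on P n0 + of_int w1 * Min_on P n1 + of_int w2 * Min_on P n2 + Min_on P n3)"
      by (simp add: ell_def inner_add_right algebra_simps)
    also have "\<dots> = of_int (w0 + w1 + w2)" using n(6,8) by simp
    finally have "of_int w0 * ell n0 x + of_int w1 * ell n1 x + of_int w2 * ell n2 x \<le> of_int (w0 + w1 + w2)"
      using ell_nonneg[OF x, of n3] by linarith
    then show "f x \<in> weighted_simplex (w0, w1, w2)"
      using ell_nonneg[OF x] by (simp add: weighted_simplex_def f_nth inner3 dot_def)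
  qed
  show ?thesis
  proof (rule that)
    show "(w0, w1, w2) \<in> weight_types" using n(1) by (simp add: weight_types_def)
    show "(P, f ` P) \<in> unimodular_equiv" using f by (auto simp: unimodular_equiv_def)
    show "lattice_polytope (f ` P)" using lattice_polytope_unimodular[OF f lp] .
    show "min_multiplier P = (of_int (dot (w0, w1, w2) (1, 1, 1)) + 1) / of_int (dot (w0, w1, w2) (1, 1, 1))"
      using n(7) by (simp add: dot_def)
    show "min_multiplier (f ` P) = min_multiplier P" using min_multiplier_unimodular[OF f Pp(1,3)] .
  qed (fact sub)
qed

text \<open>With \<open>k = w\<^sub>0 + w\<^sub>1 + w\<^sub>2\<close> this says that \<open>(1, 1, 1)\<close> lies in the Fine
  interior of \<open>(k + 1) / k\<close> times the convex hull of \<open>V\<close>.\<close>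

definition fine_ineq :: "int \<times> int \<times> int \<Rightarrow> (int \<times> int \<times> int) set \<Rightarrow> bool" where
  "fine_ineq w V \<longleftrightarrow> (\<forall>n. n \<noteq> (0, 0, 0) \<longrightarrow>
     (\<exists>t\<in>V. (dot w (1, 1, 1) + 1) * dot n t \<le> dot w (1, 1, 1) * (dot n (1, 1, 1) - 1)))"

definition mult_of :: "int \<times> int \<times> int \<Rightarrow> real" where
  "mult_of w = (of_int (dot w (1, 1, 1)) + 1) / of_int (dot w (1, 1, 1))"

lemma weight_types_bounds:
  assumes "w \<in> weight_types"
  shows "3 \<le> dot w (1, 1, 1)" "1 < mult_of w"
    and "fst w \<ge> 1" "fst (snd w) \<ge> 1" "snd (snd w) \<ge> 1"
  using assms by (auto simp: weight_types_def dot_def mult_of_def)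

section \<open>Equivalence of the integral inequalities with sporadicity inside a simplex\<close>

lemma weighted_simplex_Min_on:
  assumes Q: "compact Q" "Q \<noteq> {}" "Q \<subseteq> weighted_simplex w"
  shows "0 \<le> Min_on Q (pt (1, 0, 0))" "0 \<le> Min_on Q (pt (0, 1, 0))" "0 \<le> Min_on Q (pt (0, 0, 1))"
    "- of_int (dot w (1, 1, 1)) \<le> Min_on Q (- pt w)"
proof -
  have "0 \<le> x \<bullet> pt (1, 0, 0) \<and> 0 \<le> x \<bullet> pt (0, 1, 0) \<and> 0 \<le> x \<bullet> pt (0, 0, 1) \<and>
      - of_int (dot w (1, 1, 1)) \<le> x \<bullet> (- pt w)" if "x \<in> Q" for x
  proof -
    have "x \<in> weighted_simplex w" using that Q(3) by blast
    then show ?thesis by (simp add: weighted_simplex_def inner3[of x] inner_commute[of "pt w"] mult.commute)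
  qed
  then show "0 \<le> Min_on Q (pt (1, 0, 0))" "0 \<le> Min_on Q (pt (0, 1, 0))" "0 \<le> Min_on Q (pt (0, 0, 1))"
    "- of_int (dot w (1, 1, 1)) \<le> Min_on Q (- pt w)"
    by (auto intro!: Min_on_greatest[OF Q(2)])
qed

text \<open>With \<open>k = dot w (1, 1, 1)\<close>, the unit normals give coordinates at least 1,
  and \<open>- pt w\<close> gives \<open>w . x <= c * k - 1\<close>. Together
  \<open>k + 1 <= c * k\<close>, and equality leaves only \<open>(1, 1, 1)\<close>.\<close>

lemma weighted_simplex_Fine_interior:
  assumes Q: "compact Q" "Q \<noteq> {}" "Q \<subseteq> weighted_simplex w" and w: "w \<in> weight_types"
    and c: "0 \<le> c" and x: "x \<in> Fine_interior ((*\<^sub>R) c ` Q)"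
  shows "mult_of w \<le> c" "c = mult_of w \<Longrightarrow> x = pt (1, 1, 1)"
proof -
  define k where "k = real_of_int (dot w (1, 1, 1))"
  have k: "k > 0" using weight_types_bounds(1)[OF w] by (simp add: k_def)
  obtain w0 w1 w2 where w_eq: "w = (w0, w1, w2)" by (cases w)
  have wpos: "1 \<le> w0" "1 \<le> w1" "1 \<le> w2" using weight_types_bounds(3-5)[OF w] w_eq by auto
  have D: "c * Min_on Q (pt n) + 1 \<le> x \<bullet> pt n" if "n \<noteq> (0, 0, 0)" for n
    using Fine_interior_scaleR_D[OF x Q(1,2) c pt_lattice] that by (simp add: pt_eq_0_iff)
  have Dm: "c * Min_on Q (- pt w) + 1 \<le> x \<bullet> (- pt w)"
    using Fine_interior_scaleR_D[OF x Q(1,2) c int_lattice_minus[OF pt_lattice]] wpos w_eq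
    by (simp add: pt_eq_0_iff)
  note M = weighted_simplex_Min_on[OF Q]
  have "0 \<le> c * Min_on Q (pt (1, 0, 0))" "0 \<le> c * Min_on Q (pt (0, 1, 0))" "0 \<le> c * Min_on Q (pt (0, 0, 1))"
    using M c by simp_all
  then have x1: "1 \<le> x $ 1" "1 \<le> x $ 2" "1 \<le> x $ 3"
    using D[of "(1, 0, 0)"] D[of "(0, 1, 0)"] D[of "(0, 0, 1)"] by (simp_all add: inner3)
  have "c * (- k) \<le> c * Min_on Q (- pt w)" using M(4) c by (intro mult_left_mono) (simp_all add: k_def)
  then have x2: "of_int w0 * x $ 1 + of_int w1 * x $ 2 + of_int w2 * x $ 3 \<le> c * k - 1"
    using Dm by (simp add: inner3 w_eq algebra_simps)
  have ge: "of_int w0 * (x $ 1 - 1) \<ge> 0" "of_int w1 * (x $ 2 - 1) \<ge> 0" "of_int w2 * (x $ 3 - 1) \<ge> 0"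
    using x1 wpos by simp_all
  have k_eq: "k = of_int w0 + of_int w1 + of_int w2" by (simp add: k_def w_eq dot_def)
  have "k + 1 \<le> c * k" using ge x2 k_eq by (simp add: algebra_simps)
  then show "mult_of w \<le> c" using k by (simp add: mult_of_def k_def[symmetric] field_simps)
  assume "c = mult_of w"
  then have "c * k = k + 1" using k by (simp add: mult_of_def k_def[symmetric])
  then have "of_int w0 * (x $ 1 - 1) + of_int w1 * (x $ 2 - 1) + of_int w2 * (x $ 3 - 1) \<le> 0"
    using x2 k_eq by (simp add: algebra_simps)
  then have "of_int w0 * (x $ 1 - 1) = 0" "of_int w1 * (x $ 2 - 1) = 0" "of_int w2 * (x $ 3 - 1) = 0"
    using ge by linarith+
  then show "x = pt (1, 1, 1)" using wpos by (simp add: vec_eq_iff forall_3)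
qed

text \<open>A lattice polytope attains each minimum at a lattice point, so the inequality for
  \<open>Min_on\<close> becomes, after clearing the denominator \<open>k\<close>, an integral one
  for some point of the set.\<close>

lemma fine_ineq_lattice_points:
  assumes Q: "lattice_polytope Q" "Q \<subseteq> weighted_simplex w" and w: "w \<in> weight_types"
    and mu: "min_multiplier Q = mult_of w"
  shows "fine_ineq w (lattice_points Q)"
  unfolding fine_ineq_def
proof (intro allI impI)
  fix n :: "int \<times> int \<times> int" assume n: "n \<noteq> (0, 0, 0)"
  note Qp = lattice_polytope_props[OF Q(1)]
  have m: "0 \<le> mult_of w" using weight_types_bounds(2)[OF w] by simp
  obtain x where x: "x \<in> Fine_interior ((*\<^sub>R) (mult_of w) ` Q)"
    using min_multiplier_attained(2)[OF Qp(1,2,5)] mu by auto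
  have "x = pt (1, 1, 1)" by (rule weighted_simplex_Fine_interior(2)[OF Qp(1,3) Q(2) w m x refl])
  then have le: "mult_of w * Min_on Q (pt n) + 1 \<le> of_int (dot n (1, 1, 1))"
    using Fine_interior_scaleR_D[OF x Qp(1,3) m pt_lattice] n by (simp add: pt_eq_0_iff pt_inner dot_commute)
  obtain v where v: "v \<in> Q" "v \<in> int_lattice" "Min_on Q (pt n) = v \<bullet> pt n"
    using lattice_polytope_Min_on[OF Q(1)] by metis
  obtain t where t: "v = pt t" using int_lattice_ptE[OF v(2)] .
  define k where "k = dot w (1, 1, 1)"
  have k: "k > 0" using weight_types_bounds(1)[OF w] by (simp add: k_def)
  have "(of_int k + 1) / of_int k * of_int (dot n t) + 1 \<le> real_of_int (dot n (1, 1, 1))"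
    using le v t by (simp add: mult_of_def k_def[symmetric] pt_inner dot_commute)
  then have "real_of_int ((k + 1) * dot n t) \<le> of_int (k * (dot n (1, 1, 1) - 1))"
    using k by (simp add: field_simps)
  then have "(k + 1) * dot n t \<le> k * (dot n (1, 1, 1) - 1)" by (simp only: of_int_le_iff)
  moreover have "t \<in> lattice_points Q" using v t by (simp add: lattice_points_def)
  ultimately show "\<exists>t\<in>lattice_points Q. (dot w (1, 1, 1) + 1) * dot n t \<le> dot w (1, 1, 1) * (dot n (1, 1, 1) - 1)"
    by (auto simp: k_def)
qed

text \<open>An irreducible circuit of a hollow polytope of dimension at most 2 consists of 2 or 3
  vectors with sum 0. Pulled back to dimension 3 it contradicts \<^const>\<open>fine_ineq\<close>, by
  rounding down each of the 2 or 3 inequalities.\<close>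

lemma fine_ineq_not_in_cylinder:
  fixes P' :: "'b::euclidean_space set"
  assumes V: "V \<noteq> {}" "fine_ineq w V" "pt ` V \<subseteq> Q" "compact Q" and w: "w \<in> weight_types" and dim: "DIM('b) \<le> 2"
    and P': "F_hollow P'" "in_cylinder_over Q P' TYPE('c::euclidean_space)"
  shows False
proof -
  obtain f :: "real^3 \<Rightarrow> 'b \<times> 'c" where f: "affine_unimodular f" "f ` Q \<subseteq> P' \<times> UNIV"
    using P'(2) unfolding in_cylinder_over_def by blast
  obtain A where A: "linear A" "\<And>x. f x = A x + f 0" "bij A" "f 0 \<in> int_lattice"
    "\<And>x. x \<in> int_lattice \<Longrightarrow> A x \<in> int_lattice"
    using affine_unimodularE[OF f(1)] by metis
  define g where "g x = fst (A x)" for x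
  have lg: "linear g" using linear_compose[OF A(1) linear_fst] by (simp add: g_def[abs_def] o_def)
  have surj_g: "\<exists>x. g x = y" for y
  proof -
    obtain x where "A x = (y, 0)" using A(3) by (metis bij_pointE)
    then show ?thesis by (auto simp: g_def intro!: exI[of _ x])
  qed
  have gL: "g x \<in> int_lattice" if "x \<in> int_lattice" for x
    using A(5)[OF that] by (metis g_def int_lattice_Times prod.collapse)
  have lp: "lattice_polytope P'" and mu: "min_multiplier P' > 1" using P'(1) by (auto simp: F_hollow_def)
  note Pp = lattice_polytope_props[OF lp]
  obtain p where p: "p \<in> Fine_interior ((*\<^sub>R) (min_multiplier P') ` P')"
    using min_multiplier_attained(2)[OF Pp(1,2,5)] by blast
  obtain C b where C: "C \<subseteq> support P' p" "finite C" "\<not> affine_dependent C"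
    "int_lattice \<inter> convex hull C \<subseteq> insert 0 C"
    "\<And>n. n \<in> C \<Longrightarrow> 0 < b n" "sum b C = 1" "(\<Sum>n\<in>C. b n *\<^sub>R n) = 0"
    using irreducible_circuit[OF lp p] by blast
  have CL: "C \<subseteq> int_lattice" "0 \<notin> C" using C(1) by (auto simp: support_def)
  define q where "q = card C"
  have "int (card C) \<le> int DIM('b) + 1"
    using C(3) aff_dim_le_DIM[of C] by (simp add: affine_independent_iff_card)
  then have q3: "q \<le> 3" using dim by (simp add: q_def)
  have b: "b n = 1 / q" if "n \<in> C" for n
    unfolding q_def using small_circuit_weights[OF CL(1) C(2,3) CL(2) C(4,5,6,7) _ that] q3 by (simp add: q_def)
  have q0: "q > 0" using C(2,6) by (auto simp: q_def card_gt_0_iff)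
  have sumC: "\<Sum>C = 0"
  proof -
    have "(\<Sum>n\<in>C. b n *\<^sub>R n) = (1 / q) *\<^sub>R \<Sum>C" using b by (simp add: scaleR_sum_right)
    then show ?thesis using C(7) q0 by simp
  qed
  \<comment> \<open>All weights are \<open>1 / q\<close>, so \<open>circuit_Min_on\<close> and a
    multiplier above 1 bound the plain sum of the minima.\<close>
  have MinC: "- real q < (\<Sum>n\<in>C. Min_on P' n)"
  proof -
    have "(\<Sum>n\<in>C. b n * Min_on P' n) = (1 / q) * (\<Sum>n\<in>C. Min_on P' n)" using b by (simp add: sum_distrib_left)
    then have "(1 / q) * (\<Sum>n\<in>C. Min_on P' n) = - 1 / min_multiplier P'"
      using circuit_Min_on[OF lp C(1,2,6,7)] by simp
    moreover have "- 1 < - 1 / min_multiplier P'" using mu by (simp add: field_simps)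
    ultimately have "- 1 < (1 / q) * (\<Sum>n\<in>C. Min_on P' n)" by simp
    then show ?thesis using q0 by (simp add: field_simps)
  qed
  define m where "m n = adjoint g n" for n
  have adj: "x \<bullet> m n = g x \<bullet> n" for x n unfolding m_def by (rule adjoint_works[OF lg])
  have mL: "m n \<in> int_lattice" if "n \<in> C" for n
    unfolding int_lattice_def
  proof clarify
    fix e :: "real^3" assume "e \<in> Basis"
    then have "g e \<in> int_lattice" by (intro gL int_lattice_Basis)
    then have "g e \<bullet> n \<in> \<int>" using that CL(1) by (intro int_lattice_inner) auto
    then show "m n \<bullet> e \<in> \<int>" using adj[of e n] by (simp add: inner_commute)
  qed
  have m0: "m n \<noteq> 0" if n: "n \<in> C" for n
  proof
    assume "m n = 0"
    moreover obtain x where "g x = n" using surj_g by blast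
    ultimately have "n \<bullet> n = 0" using adj[of x n] by simp
    then show False using n CL(2) by auto
  qed
  have "\<exists>t. m n = pt t" if "n \<in> C" for n using int_lattice_ptE[OF mL[OF that]] by metis
  then obtain t where t: "\<And>n. n \<in> C \<Longrightarrow> m n = pt (t n)" by metis
  define k where "k = dot w (1, 1, 1)"
  have k: "k \<ge> 3" using weight_types_bounds(1)[OF w] by (simp add: k_def)
  have "\<exists>v\<in>V. (k + 1) * dot (t n) v \<le> k * (dot (t n) (1, 1, 1) - 1)" if "n \<in> C" for n
  proof -
    have "t n \<noteq> (0, 0, 0)" using m0[OF that] t[OF that] by (simp add: pt_eq_0_iff)
    then show ?thesis using V(2) unfolding fine_ineq_def k_def by blast
  qed
  then obtain v where v: "\<And>n. n \<in> C \<Longrightarrow> v n \<in> V"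
    "\<And>n. n \<in> C \<Longrightarrow> (k + 1) * dot (t n) (v n) \<le> k * (dot (t n) (1, 1, 1) - 1)" by metis
  have sum_s: "(\<Sum>n\<in>C. dot (t n) (1, 1, 1)) = 0"
  proof -
    have "real_of_int (\<Sum>n\<in>C. dot (t n) (1, 1, 1)) = (\<Sum>n\<in>C. pt (1, 1, 1) \<bullet> m n)"
      using t by (simp add: pt_inner dot_commute)
    also have "\<dots> = g (pt (1, 1, 1)) \<bullet> \<Sum>C" by (simp add: adj inner_sum_right)
    finally have "real_of_int (\<Sum>n\<in>C. dot (t n) (1, 1, 1)) = of_int 0"
      using sumC by (simp del: of_int_sum)
    then show ?thesis by (simp only: of_int_eq_iff)
  qed
  \<comment> \<open>With \<open>s\<close> the product of the normal with \<open>(1, 1, 1)\<close>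
    and \<open>y\<close> that with the chosen point, each inequality reads
    \<open>(k + 1) * (y - s + 1) <= 1 - s\<close>, and the \<open>s\<close> sum to 0. So the sum of
    the \<open>y\<close> plus \<open>q\<close> is at most \<open>q / (k + 1)\<close>, less than 1
    because \<open>q <= 3 <= k\<close>; as an integer it is at most 0.\<close>
  have "(\<Sum>n\<in>C. (k + 1) * (dot (t n) (v n) - dot (t n) (1, 1, 1) + 1)) \<le> (\<Sum>n\<in>C. 1 - dot (t n) (1, 1, 1))"
    using v(2) by (intro sum_mono) (simp add: algebra_simps)
  then have "(k + 1) * ((\<Sum>n\<in>C. dot (t n) (v n)) + int q) \<le> int q"
    using sum_s by (simp add: sum_distrib_left[symmetric] sum.distrib sum_subtractf q_def)
  moreover have "int q < k + 1" using q3 k by simp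
  ultimately have "(k + 1) * ((\<Sum>n\<in>C. dot (t n) (v n)) + int q) < (k + 1) * 1" by simp
  then have le: "(\<Sum>n\<in>C. dot (t n) (v n)) + int q \<le> 0" using k by (simp only: mult_less_cancel_left) auto
  have "(\<Sum>n\<in>C. Min_on P' n) \<le> (\<Sum>n\<in>C. of_int (dot (t n) (v n)) + fst (f 0) \<bullet> n)"
  proof (rule sum_mono)
    fix n assume n: "n \<in> C"
    have "f (pt (v n)) \<in> P' \<times> UNIV" using f(2) V(3) v(1)[OF n] by blast
    then have "fst (f (pt (v n))) \<in> P'" by auto
    then have "Min_on P' n \<le> fst (f (pt (v n))) \<bullet> n" using Min_on_le[OF Pp(1)] by blast
    also have "f (pt (v n)) = A (pt (v n)) + f 0" by (rule A(2))
    also have "fst \<dots> \<bullet> n = pt (v n) \<bullet> m n + fst (f 0) \<bullet> n"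
      by (simp add: adj inner_add_left g_def)
    also have "pt (v n) \<bullet> m n = of_int (dot (t n) (v n))"
      using t[OF n] by (simp add: pt_inner dot_commute)
    finally show "Min_on P' n \<le> of_int (dot (t n) (v n)) + fst (f 0) \<bullet> n" .
  qed
  also have "\<dots> = of_int (\<Sum>n\<in>C. dot (t n) (v n)) + fst (f 0) \<bullet> \<Sum>C"
    by (simp add: sum.distrib inner_sum_right)
  finally have "- real q < of_int (\<Sum>n\<in>C. dot (t n) (v n))" using MinC sumC by simp
  then have "- int q < (\<Sum>n\<in>C. dot (t n) (v n))" by linarith
  then show False using le by linarith
qed

text \<open>\<open>fine_ineq\<close> puts \<open>(1, 1, 1)\<close> into the Fine interior of the
  dilate, which bounds the multiplier from above; containment in the simplex bounds it from below
  and makes the point unique.\<close>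

lemma fine_ineq_sporadic:
  assumes V: "finite V" "fine_ineq w V" "pt ` V \<subseteq> weighted_simplex w" and w: "w \<in> weight_types"
  defines "Q \<equiv> convex hull (pt ` V)"
  shows "lattice_polytope Q" "sporadic_F_hollow Q" "min_multiplier Q = mult_of w" "Q \<subseteq> weighted_simplex w"
proof -
  have "V \<noteq> {}" using V(2)[unfolded fine_ineq_def, rule_format, of "(1, 0, 0)"] by auto
  have cQ: "compact Q" "convex Q" "Q \<noteq> {}"
    using V(1) \<open>V \<noteq> {}\<close> by (auto simp: Q_def finite_imp_compact_convex_hull)
  show QD: "Q \<subseteq> weighted_simplex w" unfolding Q_def using V(3) convex_weighted_simplex by (rule hull_minimal)
  have m: "0 < mult_of w" "1 < mult_of w" using weight_types_bounds(2)[OF w] by auto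
  define k where "k = dot w (1, 1, 1)"
  have k: "k > 0" using weight_types_bounds(1)[OF w] by (simp add: k_def)
  have mk: "mult_of w = (of_int k + 1) / of_int k" by (simp add: mult_of_def k_def)
  have F: "pt (1, 1, 1) \<in> Fine_interior ((*\<^sub>R) (mult_of w) ` Q)"
    unfolding Fine_interior_scaleR_iff[OF cQ(1,3) less_imp_le[OF m(1)]]
  proof
    fix x :: "real^3" assume x: "x \<in> int_lattice - {0}"
    then obtain n where n: "x = pt n" using int_lattice_ptE by blast
    then have "n \<noteq> (0, 0, 0)" using x by (simp add: pt_eq_0_iff)
    then obtain t where t: "t \<in> V" "(k + 1) * dot n t \<le> k * (dot n (1, 1, 1) - 1)"
      using V(2) unfolding fine_ineq_def k_def by blast
    have "Min_on Q x \<le> pt t \<bullet> x" using t(1) cQ(1) by (intro Min_on_le) (auto simp: Q_def hull_inc)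
    also have "\<dots> = of_int (dot n t)" by (simp add: n pt_inner dot_commute)
    finally have "mult_of w * Min_on Q x \<le> mult_of w * of_int (dot n t)" using m by (intro mult_left_mono) auto
    also have "\<dots> \<le> of_int (dot n (1, 1, 1)) - 1"
    proof -
      have "real_of_int ((k + 1) * dot n t) \<le> of_int (k * (dot n (1, 1, 1) - 1))"
        using t(2) by (simp only: of_int_le_iff)
      then show ?thesis using k by (simp add: mk field_simps)
    qed
    finally show "mult_of w * Min_on Q x + 1 \<le> pt (1, 1, 1) \<bullet> x" by (simp add: n pt_inner dot_commute)
  qed
  \<comment> \<open>Full dimension comes from here: the point of the Fine interior is an interior
    point of the dilate, so \<open>Q\<close> has interior points too.\<close>
  have "pt (1, 1, 1) \<in> interior ((*\<^sub>R) (mult_of w) ` Q)"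
    using Fine_interior_subset_interior[of "(*\<^sub>R) (mult_of w) ` Q"] F cQ
    by (auto simp: compact_scaling convex_scaling)
  also have "\<dots> = (*\<^sub>R) (mult_of w) ` interior Q"
    using m by (intro interior_injective_linear_image) (auto simp: inj_on_def intro!: linearI scaleR_add_right)
  finally have intQ: "interior Q \<noteq> {}" by auto
  have "aff_dim Q = DIM(real^3)" using intQ by (rule aff_dim_nonempty_interior)
  moreover have "polytope Q" using V(1) by (auto simp: Q_def polytope_def)
  moreover have "v \<in> int_lattice" if "v extreme_point_of Q" for v
    using that extreme_point_of_convex_hull[of v "pt ` V"] by (auto simp: Q_def)
  ultimately show lp: "lattice_polytope Q" by (simp add: lattice_polytope_def)
  note mm = min_multiplier_attained[OF cQ(1,2) intQ]
  have "mult_of w \<le> min_multiplier Q"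
    using mm(1,2) weighted_simplex_Fine_interior(1)[OF cQ(1,3) QD w] by (meson all_not_in_conv less_imp_le)
  moreover have "min_multiplier Q \<le> mult_of w" using mm(3)[of "mult_of w"] F m by auto
  ultimately show mu: "min_multiplier Q = mult_of w" by simp
  have "Fine_interior ((*\<^sub>R) (mult_of w) ` Q) = {pt (1, 1, 1)}"
    using F weighted_simplex_Fine_interior(2)[OF cQ(1,3) QD w less_imp_le[OF m(1)] _ refl] by blast
  then have "weakly_sporadic_F_hollow Q"
    using lp mu m by (simp add: weakly_sporadic_F_hollow_def F_hollow_def)
  moreover have VQ: "pt ` V \<subseteq> Q" by (auto simp: Q_def hull_inc)
  have "\<not> (\<exists>P'::(real^1) set. F_hollow P' \<and> in_cylinder_over Q P' TYPE(real^2))"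
    using fine_ineq_not_in_cylinder[OF \<open>V \<noteq> {}\<close> V(2) VQ cQ(1) w, where 'b = "real^1" and 'c = "real^2"] by auto
  moreover have "\<not> (\<exists>P'::(real^2) set. F_hollow P' \<and> in_cylinder_over Q P' TYPE(real^1))"
    using fine_ineq_not_in_cylinder[OF \<open>V \<noteq> {}\<close> V(2) VQ cQ(1) w, where 'b = "real^2" and 'c = "real^1"] by auto
  ultimately show "sporadic_F_hollow Q"
    unfolding sporadic_F_hollow_def by blast
qed

subsection \<open>Lattice points of the three simplices\<close>

text \<open>The order of the points keeps the search trees of the model counts below small.\<close>

definition points :: "int \<times> int \<times> int \<Rightarrow> (int \<times> int \<times> int) list" where
  "points w = (if w = (1, 1, 1) then
    [(0, 0, 2), (0, 0, 0), (0, 0, 3), (0, 0, 1), (0, 1, 0), (0, 2, 0), (0, 3, 0), (0, 1, 1), (0,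
    2, 1), (0, 1, 2), (1, 0, 2), (2, 0, 1), (3, 0, 0), (1, 0, 1), (1, 0, 0), (2, 0, 0), (1, 1,
    0), (2, 1, 0), (1, 2, 0), (1, 1, 1)]
   else if w = (2, 1, 1) then
    [(2, 0, 0), (0, 0, 0), (0, 0, 3), (0, 0, 2), (0, 0, 1), (0, 0, 4), (0, 3, 0), (0, 2, 1), (0,
    1, 2), (0, 4, 0), (0, 2, 0), (0, 1, 0), (0, 1, 1), (0, 2, 2), (0, 3, 1), (0, 1, 3), (1, 2,
    0), (1, 1, 1), (1, 0, 2), (1, 0, 1), (1, 1, 0), (1, 0, 0)]
   else
    [(0, 3, 0), (2, 0, 0), (0, 0, 5), (0, 0, 3), (0, 0, 6), (0, 0, 4), (0, 0, 2), (0, 0, 1), (0,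
    0, 0), (0, 2, 1), (0, 1, 2), (0, 2, 0), (0, 1, 0), (1, 1, 0), (1, 0, 0), (1, 0, 1), (1, 0,
    2), (1, 0, 3), (0, 1, 4), (0, 2, 2), (1, 1, 1), (0, 1, 3), (0, 1, 1)])"

text \<open>\<open>(n, m)\<close> stands for the condition that some point \<open>t\<close> has \<open>n \<cdot> t \<le> m\<close>.
  The bound \<open>m\<close> is the one of \<^const>\<open>fine_ineq\<close> for \<open>n\<close>, rounded down.\<close>

definition hit_list :: "int \<times> int \<times> int \<Rightarrow> ((int \<times> int \<times> int) \<times> int) list" where
  "hit_list w = (if w = (1, 1, 1) then
    [((1, 1, 0), 0), ((1, 0, 1), 0), ((0, 1, 1), 0), ((0, -1, -1), -3), ((-1, 0, -1), -3), ((-1,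
    -1, 0), -3), ((-1, 0, 0), -2), ((0, -1, 0), -2), ((0, 0, -1), -2), ((1, 1, 1), 1)]
   else if w = (2, 1, 1) then
    [((-1, 0, 0), -2), ((1, 1, 0), 0), ((1, 0, 1), 0), ((-1, -1, -1), -4), ((-1, -1, 0), -3),
    ((-1, 0, -1), -3), ((1, 1, 1), 1)]
   else
    [((-1, 0, 0), -2), ((-1, -1, 0), -3), ((1, 1, 0), 0), ((-2, -1, -1), -5), ((1, 1, 1), 1)])"

definition hit_sets :: "int \<times> int \<times> int \<Rightarrow> (int \<times> int \<times> int) list list" where
  "hit_sets w = map (\<lambda>(n, m). filter (\<lambda>t. dot n t \<le> m) (points w)) (hit_list w)"

definition hits :: "int \<times> int \<times> int \<Rightarrow> (int \<times> int \<times> int) set \<Rightarrow> bool" where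
  "hits w V \<longleftrightarrow> (\<forall>L\<in>set (hit_sets w). \<exists>t\<in>set L. t \<in> V)"

lemma points_iff:
  assumes "w \<in> weight_types"
  shows "t \<in> set (points w) \<longleftrightarrow>
    0 \<le> fst t \<and> 0 \<le> fst (snd t) \<and> 0 \<le> snd (snd t) \<and> dot w t \<le> dot w (1, 1, 1)"
proof -
  have 1: "\<forall>w\<in>set [(1,1,1), (2,1,1), (3,2,1)]. \<forall>t\<in>set (points w).
      0 \<le> fst t \<and> 0 \<le> fst (snd t) \<and> 0 \<le> snd (snd t) \<and> dot w t \<le> dot w (1, 1, 1)"
    by code_simp
  have 2: "\<forall>w\<in>set [(1,1,1), (2,1,1), (3,2,1)]. \<forall>x\<in>set [0..3]. \<forall>y\<in>set [0..4]. \<forall>z\<in>set [0..6].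
      (if dot w (x, y, z) \<le> dot w (1, 1, 1) then (x, y, z) \<in> set (points w) else True)"
    by code_simp
  have w: "w \<in> set [(1,1,1), (2,1,1), (3,2,1)]" using assms by (auto simp: weight_types_def)
  obtain x y z where t: "t = (x, y, z)" by (cases t)
  show ?thesis
  proof
    assume r: "0 \<le> fst t \<and> 0 \<le> fst (snd t) \<and> 0 \<le> snd (snd t) \<and> dot w t \<le> dot w (1, 1, 1)"
    have "x \<in> set [0..3]" "y \<in> set [0..4]" "z \<in> set [0..6]"
      unfolding set_upto using r assms t by (auto simp: weight_types_def dot_def)
    then show "t \<in> set (points w)" using 2 w r t by fastforce
  qed (use 1 w in blast)
qed

lemma pt_weighted_simplex_iff:
  assumes "w \<in> weight_types"
  shows "pt t \<in> weighted_simplex w \<longleftrightarrow> t \<in> set (points w)"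
  by (cases t) (simp add: points_iff[OF assms] weighted_simplex_def pt_inner)

lemma fine_ineq_hits:
  assumes w: "w \<in> weight_types" and V: "V \<subseteq> set (points w)" "fine_ineq w V"
  shows "hits w V"
  unfolding hits_def hit_sets_def
proof clarsimp
  fix a b c m assume n: "((a, b, c), m) \<in> set (hit_list w)"
  have chk: "\<forall>w\<in>set [(1,1,1), (2,1,1), (3,2,1)]. \<forall>(n, m)\<in>set (hit_list w).
      n \<noteq> (0, 0, 0) \<and> (dot w (1, 1, 1) * (dot n (1, 1, 1) - 1)) div (dot w (1, 1, 1) + 1) = m"
    by code_simp
  have w': "w \<in> set [(1,1,1), (2,1,1), (3,2,1)]" using w by (auto simp: weight_types_def)
  have *: "(a, b, c) \<noteq> (0, 0, 0)"
    "(dot w (1, 1, 1) * (dot (a, b, c) (1, 1, 1) - 1)) div (dot w (1, 1, 1) + 1) = m"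
    using chk w' n by fastforce+
  then obtain t where t: "t \<in> V"
    "(dot w (1, 1, 1) + 1) * dot (a, b, c) t \<le> dot w (1, 1, 1) * (dot (a, b, c) (1, 1, 1) - 1)"
    using V(2) unfolding fine_ineq_def by blast
  have "dot w (1, 1, 1) + 1 > 0" using weight_types_bounds(1)[OF w] by simp
  then have "dot (a, b, c) t \<le> m"
    using t(2) *(2) by (metis mult.commute zdiv_mono1 nonzero_mult_div_cancel_right less_irrefl)
  then show "\<exists>x xa xb. (x, xa, xb) \<in> set (points w) \<and> dot (a, b, c) (x, xa, xb) \<le> m \<and> (x, xa, xb) \<in> V"
    using t(1) V(1) by (metis prod_cases3 subsetD)
qed

text \<open>A set that meets every hit set but violates \<open>fine_ineq\<close> at
  \<open>(a, b, c)\<close> supplies in each hit set a point violating the inequality. Whichever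
  points these are, the resulting finite system of linear inequalities over the integers has only
  the zero solution.\<close>

lemma hits_ineq:
  fixes a b c :: int
  assumes "w \<in> weight_types"
    and "\<forall>L\<in>set (hit_sets w). \<exists>t\<in>set L.
      dot w (1, 1, 1) * (dot (a, b, c) (1, 1, 1) - 1) < (dot w (1, 1, 1) + 1) * dot (a, b, c) t"
  shows "a = 0 \<and> b = 0 \<and> c = 0"
proof -
  consider "w = (1, 1, 1)" | "w = (2, 1, 1)" | "w = (3, 2, 1)" using assms(1) by (auto simp: weight_types_def)
  then show ?thesis
  proof cases
    case 1
    show ?thesis
      using assms(2) unfolding 1 hit_sets_def hit_list_def points_def dot_def
      by simp (smt (z3))
  next
    case 2
    show ?thesis
      using assms(2) unfolding 2 hit_sets_def hit_list_def points_def dot_def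
      by simp (smt (z3))
  next
    case 3
    show ?thesis
      using assms(2) unfolding 3 hit_sets_def hit_list_def points_def dot_def
      by simp (smt (z3))
  qed
qed

lemma hits_fine_ineq:
  assumes w: "w \<in> weight_types" and V: "hits w V"
  shows "fine_ineq w V"
  unfolding fine_ineq_def
proof (intro allI impI)
  fix n :: "int \<times> int \<times> int" assume n: "n \<noteq> (0, 0, 0)"
  show "\<exists>t\<in>V. (dot w (1, 1, 1) + 1) * dot n t \<le> dot w (1, 1, 1) * (dot n (1, 1, 1) - 1)"
  proof (rule ccontr)
    assume neg: "\<not> ?thesis"
    obtain a b c where abc: "n = (a, b, c)" by (cases n)
    have "a = 0 \<and> b = 0 \<and> c = 0"
      using V neg abc by (intro hits_ineq[OF w]) (force simp: hits_def not_le)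
    then show False using n abc by simp
  qed
qed

text \<open>Affine integral functionals are written as combinations of the four coordinates
  \<open>co w 0, \<dots>, co w 3\<close> of the simplex.\<close>

definition co :: "int \<times> int \<times> int \<Rightarrow> nat \<Rightarrow> int \<times> int \<times> int \<Rightarrow> int" where
  "co w i t = (if i = 0 then fst t else if i = 1 then fst (snd t) else if i = 2 then snd (snd t)
     else dot w (1, 1, 1) - dot w t)"

definition functional :: "int \<times> int \<times> int \<Rightarrow> int \<times> int \<times> int \<times> int \<Rightarrow> int \<times> int \<times> int \<Rightarrow> int" where
  "functional w c t = (case c of (c0, c1, c2, c3) \<Rightarrow>
     c0 * co w 0 t + c1 * co w 1 t + c2 * co w 2 t + c3 * co w 3 t)"

text \<open>Candidates for tight normals. The coefficient sum, 1 for all of them, is the value at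
  \<open>(1, 1, 1)\<close> once the simplex is dilated by \<open>mult_of w\<close>: there all four
  coordinates of that point are 1.\<close>

definition normals :: "int \<times> int \<times> int \<Rightarrow> (int \<times> int \<times> int \<times> int) list" where
  "normals w = [(1,0,0,0), (0,1,0,0), (0,0,1,0), (0,0,0,1)] @
     (if w = (1, 1, 1) then
       [(2,-1,0,0), (2,0,-1,0), (2,0,0,-1), (-1,2,0,0), (0,2,-1,0), (0,2,0,-1),
        (-1,0,2,0), (0,-1,2,0), (0,0,2,-1), (-1,0,0,2), (0,-1,0,2), (0,0,-1,2)]
     else if w = (2, 1, 1) then [(2,-1,0,0), (2,0,-1,0), (2,0,0,-1)] else [])"

text \<open>Meant for functionals that are nonnegative on a set meeting every hit set. Given the
  coefficient sum, one such point in each hit set already confines the four coefficients to the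
  list.\<close>

lemma hits_normals:
  fixes c0 c1 c2 c3 :: int
  assumes "w \<in> weight_types" "c0 + c1 + c2 + c3 = 1"
    and "\<forall>L\<in>set (hit_sets w). \<exists>t\<in>set L. 0 \<le> functional w (c0, c1, c2, c3) t"
  shows "(c0, c1, c2, c3) \<in> set (normals w)"
proof -
  consider "w = (1, 1, 1)" | "w = (2, 1, 1)" | "w = (3, 2, 1)" using assms(1) by (auto simp: weight_types_def)
  then show ?thesis
  proof cases
    case 1
    show ?thesis
      using assms(2,3) unfolding 1 hit_sets_def hit_list_def points_def dot_def normals_def functional_def co_def
      by simp (smt (z3))
  next
    case 2
    show ?thesis
      using assms(2,3) unfolding 2 hit_sets_def hit_list_def points_def dot_def normals_def functional_def co_def
      by simp (smt (z3))
  next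
    case 3
    show ?thesis
      using assms(2,3) unfolding 3 hit_sets_def hit_list_def points_def dot_def normals_def functional_def co_def
      by simp (smt (z3))
  qed
qed

subsection \<open>Automorphisms of the three simplices\<close>

text \<open>Permutations of the four coordinates that respect the weights, each recorded by the
  images of 0, 1, 2.\<close>

definition autos :: "int \<times> int \<times> int \<Rightarrow> (nat \<times> nat \<times> nat) list" where
  "autos w = (if w = (1, 1, 1) then
     [(i, j, l). i \<leftarrow> [0,1,2,3], j \<leftarrow> [0,1,2,3], l \<leftarrow> [0,1,2,3], i \<noteq> j \<and> i \<noteq> l \<and> j \<noteq> l]
   else if w = (2, 1, 1) then [(0, j, l). j \<leftarrow> [1,2,3], l \<leftarrow> [1,2,3], j \<noteq> l]
   else [(0, 1, 2), (0, 1, 3)])"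

definition act :: "int \<times> int \<times> int \<Rightarrow> nat \<times> nat \<times> nat \<Rightarrow> int \<times> int \<times> int \<Rightarrow> int \<times> int \<times> int" where
  "act w g t = (case g of (i, j, l) \<Rightarrow> (co w i t, co w j t, co w l t))"

text \<open>The four indices sum to 6, so the last value is the index left over.\<close>

definition perm :: "nat \<times> nat \<times> nat \<Rightarrow> nat \<Rightarrow> nat" where
  "perm g m = (case g of (i, j, l) \<Rightarrow>
     if m = 0 then i else if m = 1 then j else if m = 2 then l else 6 - i - j - l)"

definition unit4 :: "nat \<Rightarrow> int \<times> int \<times> int \<times> int" where
  "unit4 i = (if i = 0 then (1,0,0,0) else if i = 1 then (0,1,0,0) else if i = 2 then (0,0,1,0) else (0,0,0,1))"

definition mult_autos :: "nat \<times> nat \<times> nat \<Rightarrow> nat \<times> nat \<times> nat \<Rightarrow> nat \<times> nat \<times> nat" where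
  "mult_autos g h = (case g of (i, j, l) \<Rightarrow> (perm h i, perm h j, perm h l))"

text \<open>\<open>rco\<close> and \<open>ract\<close> extend \<open>co\<close> and
  \<open>act\<close> from lattice points to the whole space, as hulls have to be mapped.\<close>

definition rco :: "int \<times> int \<times> int \<Rightarrow> nat \<Rightarrow> real^3 \<Rightarrow> real" where
  "rco w i x = (if i = 0 then x $ 1 else if i = 1 then x $ 2 else if i = 2 then x $ 3
     else of_int (dot w (1, 1, 1)) - pt w \<bullet> x)"

definition ract :: "int \<times> int \<times> int \<Rightarrow> nat \<times> nat \<times> nat \<Rightarrow> real^3 \<Rightarrow> real^3" where
  "ract w g x = (case g of (i, j, l) \<Rightarrow> vector [rco w i x, rco w j x, rco w l x])"

lemma weight_types_list: "w \<in> weight_types \<longleftrightarrow> w \<in> set [(1,1,1), (2,1,1), (3,2,1)]"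
  by (auto simp: weight_types_def)

lemma autos_bounds:
  assumes "w \<in> weight_types" "(i, j, l) \<in> set (autos w)"
  shows "i < 4" "j < 4" "l < 4"
  using assms by (auto simp: weight_types_def autos_def)

lemma autos_eq:
  "autos (1, 1, 1) = [(0,1,2), (0,1,3), (0,2,1), (0,2,3), (0,3,1), (0,3,2), (1,0,2), (1,0,3), (1,2,0), (1,2,3), (1,3,0), (1,3,2), (2,0,1), (2,0,3), (2,1,0), (2,1,3), (2,3,0), (2,3,1), (3,0,1), (3,0,2), (3,1,0), (3,1,2), (3,2,0), (3,2,1)]"
  "autos (2, 1, 1) = [(0,1,2), (0,1,3), (0,2,1), (0,2,3), (0,3,1), (0,3,2)]"
  "autos (3, 2, 1) = [(0,1,2), (0,1,3)]"
  by code_simp+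

text \<open>Only \<open>m = 3\<close> has content: the fourth coordinate of the image is computed
  from the other three, and the invariance of the weights makes it the coordinate left over.\<close>

lemma co_act:
  assumes "w \<in> weight_types" "g \<in> set (autos w)" "m < 4"
  shows "co w m (act w g t) = co w (perm g m) t"
proof -
  have "\<forall>g\<in>set (autos w). co w 3 (act w g t) = co w (perm g 3) t"
    using assms(1) unfolding weight_types_def insert_iff empty_iff
    by (elim disjE FalseE; hypsubst; unfold autos_eq list.set ball_simps; cases t)
      (simp_all add: act_def perm_def co_def dot_def)
  moreover have "m < 3 \<Longrightarrow> co w m (act w g t) = co w (perm g m) t"
    by (cases g) (auto simp: act_def perm_def co_def less_Suc_eq numeral_eq_Suc)
  moreover have "m < 3 \<or> m = 3" using assms(3) by auto
  ultimately show ?thesis using assms(2) by blast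
qed

lemma rco_ract:
  assumes "w \<in> weight_types" "g \<in> set (autos w)" "m < 4"
  shows "rco w m (ract w g x) = rco w (perm g m) x"
proof -
  have "\<forall>g\<in>set (autos w). rco w 3 (ract w g x) = rco w (perm g 3) x"
    using assms(1) unfolding weight_types_def insert_iff empty_iff
    by (elim disjE FalseE; hypsubst; unfold autos_eq list.set ball_simps)
      (simp_all add: ract_def perm_def rco_def dot_def inner3)
  moreover have "m < 3 \<Longrightarrow> rco w m (ract w g x) = rco w (perm g m) x"
    by (cases g) (auto simp: ract_def perm_def rco_def less_Suc_eq numeral_eq_Suc)
  moreover have "m < 3 \<or> m = 3" using assms(3) by auto
  ultimately show ?thesis using assms(2) by blast
qed

lemma act_mult:
  assumes "w \<in> weight_types" "g \<in> set (autos w)" "h \<in> set (autos w)"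
  shows "act w g (act w h t) = act w (mult_autos g h) t" "ract w g (ract w h x) = ract w (mult_autos g h) x"
proof -
  obtain i j l where g: "g = (i, j, l)" by (cases g)
  note b = autos_bounds[OF assms(1) assms(2)[unfolded g]]
  show "act w g (act w h t) = act w (mult_autos g h) t"
    unfolding g act_def[of w "(i, j, l)"] using co_act[OF assms(1,3)] b by (simp add: mult_autos_def act_def)
  show "ract w g (ract w h x) = ract w (mult_autos g h) x"
    unfolding g ract_def[of w "(i, j, l)"] using rco_ract[OF assms(1,3)] b by (simp add: mult_autos_def ract_def)
qed

lemma act_id: "act w (0, 1, 2) t = t" "ract w (0, 1, 2) x = x"
  by (cases t) (simp_all add: act_def co_def ract_def rco_def vec_eq_iff forall_3)

lemma autos_group:
  assumes "w \<in> weight_types"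
  shows "(0, 1, 2) \<in> set (autos w)"
    and "g \<in> set (autos w) \<Longrightarrow> h \<in> set (autos w) \<Longrightarrow> mult_autos g h \<in> set (autos w)"
    and "g \<in> set (autos w) \<Longrightarrow> \<exists>h\<in>set (autos w). mult_autos g h = (0, 1, 2) \<and> mult_autos h g = (0, 1, 2)"
proof -
  have 1: "\<forall>w\<in>set [(1,1,1), (2,1,1), (3,2,1)]. (0, 1, 2) \<in> set (autos w)"
    by code_simp
  have 2: "\<forall>w\<in>set [(1,1,1), (2,1,1), (3,2,1)].
      \<forall>g\<in>set (autos w). \<forall>h\<in>set (autos w). mult_autos g h \<in> set (autos w)"
    by code_simp
  have 3: "\<forall>w\<in>set [(1,1,1), (2,1,1), (3,2,1)].
      \<forall>g\<in>set (autos w). \<exists>h\<in>set (autos w). mult_autos g h = (0, 1, 2) \<and> mult_autos h g = (0, 1, 2)"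
    by code_simp
  note w = assms[unfolded weight_types_list]
  show "(0, 1, 2) \<in> set (autos w)" using 1 w by blast
  show "mult_autos g h \<in> set (autos w)" if "g \<in> set (autos w)" "h \<in> set (autos w)" using 2 w that by blast
  show "\<exists>h\<in>set (autos w). mult_autos g h = (0, 1, 2) \<and> mult_autos h g = (0, 1, 2)" if "g \<in> set (autos w)"
    using 3 w that by blast
qed

lemma ract_pt: "ract w g (pt t) = pt (act w g t)"
  by (cases g; cases t) (simp add: ract_def act_def vec_eq_iff forall_3 rco_def co_def pt_inner)

lemma ract_affine:
  obtains A where "linear A" "\<And>x. ract w g x = A x + ract w g 0"
proof -
  obtain i j l where g: "g = (i, j, l)" by (cases g)
  have "linear (\<lambda>x. ract w g x - ract w g 0)"
    by (rule linearI) (simp_all add: g ract_def vec_eq_iff forall_3 rco_def inner_add_right algebra_simps)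
  then show ?thesis by (intro that[of "\<lambda>x. ract w g x - ract w g 0"]) simp_all
qed

lemma affine_unimodular_ract:
  assumes w: "w \<in> weight_types" and g: "g \<in> set (autos w)"
  shows "affine_unimodular (ract w g)"
proof -
  obtain h where h: "h \<in> set (autos w)" "mult_autos g h = (0, 1, 2)" "mult_autos h g = (0, 1, 2)"
    using autos_group(3)[OF w g] by blast
  have inv: "ract w g (ract w h x) = x" "ract w h (ract w g x) = x" for x
    using act_mult(2)[OF w g h(1)] act_mult(2)[OF w h(1) g] h act_id by simp_all
  have L: "ract w g x \<in> int_lattice" if "x \<in> int_lattice" for g x
    using int_lattice_ptE[OF that] by (metis ract_pt pt_lattice)
  obtain A where A: "linear A" "\<And>x. ract w g x = A x + ract w g 0" using ract_affine by blast
  show ?thesis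
    unfolding affine_unimodular_def
  proof (intro conjI exI)
    show "linear A" by fact
    show "ract w g = (\<lambda>x. A x + ract w g 0)" using A(2) by (rule ext)
    show "bij (ract w g)" by (rule o_bij[of "ract w h"]) (auto simp: inv)
    show "ract w g ` int_lattice = int_lattice"
      using L inv by (metis (no_types, lifting) image_subset_iff rev_image_eqI subsetI subset_antisym)
  qed
qed

lemma act_unimodular_equiv:
  assumes "w \<in> weight_types" "g \<in> set (autos w)"
  shows "(convex hull (pt ` V), convex hull (pt ` act w g ` V)) \<in> unimodular_equiv"
proof -
  obtain A where A: "linear A" "\<And>x. ract w g x = A x + ract w g 0" using ract_affine by blast
  have im: "ract w g ` S = (+) (ract w g 0) ` A ` S" for S
    by (subst A(2)[abs_def]) (auto simp: image_image add.commute)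
  have "ract w g ` (convex hull (pt ` V)) = convex hull (ract w g ` pt ` V)"
    unfolding im by (simp add: convex_hull_linear_image[OF A(1)] convex_hull_translation)
  also have "ract w g ` pt ` V = pt ` act w g ` V" by (simp add: image_image ract_pt)
  finally show ?thesis using affine_unimodular_ract[OF assms] by (auto simp: unimodular_equiv_def)
qed

text \<open>Eliminating the fourth coordinate, a functional with coefficients \<open>a\<close> has
  linear part \<open>(a0 - a3 * w0, a1 - a3 * w1, a2 - a3 * w2)\<close>. The value is the
  determinant of three such rows.\<close>

definition det_normals :: "int \<times> int \<times> int \<Rightarrow> int \<times> int \<times> int \<times> int \<Rightarrow> int \<times> int \<times> int \<times> int \<Rightarrow>
    int \<times> int \<times> int \<times> int \<Rightarrow> int" where
  "det_normals w a b c = (case (w, a, b, c) of ((w0, w1, w2), (a0, a1, a2, a3), (b0, b1, b2, b3), (c0, c1, c2, c3)) \<Rightarrow>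
     let x0 = a0 - a3 * w0; x1 = a1 - a3 * w1; x2 = a2 - a3 * w2;
         y0 = b0 - b3 * w0; y1 = b1 - b3 * w1; y2 = b2 - b3 * w2;
         z0 = c0 - c3 * w0; z1 = c1 - c3 * w1; z2 = c2 - c3 * w2
     in x0 * (y1 * z2 - y2 * z1) - x1 * (y0 * z2 - y2 * z0) + x2 * (y0 * z1 - y1 * z0))"

text \<open>The pullback of the fourth coordinate along the map with components
  \<open>a, b, c\<close>. The constant \<open>w0 + w1 + w2\<close> has coefficients
  \<open>(w0, w1, w2, 1)\<close>, whence the leading terms.\<close>

definition last_normal :: "int \<times> int \<times> int \<Rightarrow> int \<times> int \<times> int \<times> int \<Rightarrow> int \<times> int \<times> int \<times> int \<Rightarrow>
    int \<times> int \<times> int \<times> int \<Rightarrow> int \<times> int \<times> int \<times> int" where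
  "last_normal w a b c = (case (w, a, b, c) of ((w0, w1, w2), (a0, a1, a2, a3), (b0, b1, b2, b3), (c0, c1, c2, c3)) \<Rightarrow>
     (w0 - w0 * a0 - w1 * b0 - w2 * c0, w1 - w0 * a1 - w1 * b1 - w2 * c1,
      w2 - w0 * a2 - w1 * b2 - w2 * c2, 1 - w0 * a3 - w1 * b3 - w2 * c3))"

text \<open>The finite core of \<open>unique_embedding\<close>, where \<open>a, b, c\<close> and the
  last normal are the pullbacks of the four coordinates along a unimodular map.\<close>

lemma normals_autos:
  "\<forall>w\<in>set [(1,1,1), (2,1,1), (3,2,1)]. \<forall>a\<in>set (normals w). \<forall>b\<in>set (normals w). \<forall>c\<in>set (normals w).
     (if last_normal w a b c \<in> set (normals w) then
        if \<bar>det_normals w a b c\<bar> = 1 then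
          (a, b, c) \<in> set (map (\<lambda>(i, j, l). (unit4 i, unit4 j, unit4 l)) (autos w))
        else True
      else True)"
  by code_simp

section \<open>Uniqueness of the embedding up to automorphisms\<close>

lemma adjoint_int_lattice:
  fixes A :: "'a::euclidean_space \<Rightarrow> 'b::euclidean_space"
  assumes "linear A" "\<And>x. x \<in> int_lattice \<Longrightarrow> A x \<in> int_lattice" "n \<in> int_lattice"
  shows "adjoint A n \<in> int_lattice"
  unfolding int_lattice_def
proof clarify
  fix e :: 'a assume "e \<in> Basis"
  then have "A e \<bullet> n \<in> \<int>" using assms(2,3) int_lattice_Basis int_lattice_inner by blast
  then show "adjoint A n \<bullet> e \<in> \<int>" using adjoint_works[OF assms(1), of e n] by (simp add: inner_commute)
qed

lemma affine_unimodular_det: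
  fixes f A :: "real^3 \<Rightarrow> real^3"
  assumes f: "affine_unimodular f" and A: "linear A" "\<And>x. f x = A x + f 0"
    "\<And>x. x \<in> int_lattice \<Longrightarrow> A x \<in> int_lattice"
  shows "\<bar>det (matrix A)\<bar> = 1"
proof -
  have det_int: "det (matrix B) \<in> \<int>" if "\<And>x. x \<in> int_lattice \<Longrightarrow> B x \<in> int_lattice" for B :: "real^3 \<Rightarrow> real^3"
  proof -
    have "B (axis j 1) $ i \<in> \<int>" for i j
    proof -
      have "axis j 1 \<in> (int_lattice :: (real^3) set)" by (rule int_lattice_Basis) (simp add: axis_in_Basis_iff)
      then have "B (axis j 1) \<bullet> axis i 1 \<in> \<int>"
        by (intro int_lattice_inner_Basis that) (simp_all add: axis_in_Basis_iff)
      then show ?thesis by (simp add: inner_axis)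
    qed
    then show ?thesis by (simp add: det_3 matrix_def)
  qed
  obtain B where B: "linear B" "\<And>x. inv f x = B x + inv f 0" "\<And>x. x \<in> int_lattice \<Longrightarrow> B x \<in> int_lattice"
    using affine_unimodularE[OF affine_unimodular_inv[OF f]] by metis
  have bij: "bij f" using f by (simp add: affine_unimodular_def)
  have "A (B x) + (A (inv f 0) + f 0) = x" for x
  proof -
    have "x = f (inv f x)" using bij by (simp add: bij_is_surj surj_f_inv_f)
    also have "\<dots> = A (inv f x) + f 0" by (rule A(2))
    also have "inv f x = B x + inv f 0" by (rule B(2))
    finally show ?thesis by (simp add: linear_add[OF A(1)] add.assoc)
  qed
  from this[of 0] this have "A (B x) = x" for x by (simp add: linear_0[OF A(1)] linear_0[OF B(1)])
  then have "A \<circ> B = id" by auto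
  then have "matrix A ** matrix B = mat 1" using matrix_compose[OF B(1) A(1)] matrix_id_mat_1 by metis
  then have 1: "det (matrix A) * det (matrix B) = 1" by (metis det_I det_mul)
  obtain a b where ab: "det (matrix A) = of_int a" "det (matrix B) = of_int b"
    using det_int A(3) B(3) by (metis Ints_cases)
  then have "real_of_int (a * b) = of_int 1" using 1 by simp
  then have "a * b = 1" by (simp only: of_int_eq_iff)
  then have "\<bar>a\<bar> = 1" by (metis abs_zmult_eq_1 abs_1)
  then show ?thesis using ab by simp
qed

lemma functional_unit4: "i < 4 \<Longrightarrow> functional w (unit4 i) t = co w i t"
  by (auto simp: functional_def unit4_def numeral_eq_Suc less_Suc_eq)

lemma functional_last_normal:
  "functional w (last_normal w a b c) t =
     dot w (1, 1, 1) - dot w (functional w a t, functional w b t, functional w c t)"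
  by (cases w; cases a; cases b; cases c; cases t)
    (simp add: functional_def last_normal_def dot_def co_def algebra_simps)

lemma closed_finite_hull:
  assumes w: "w \<in> weight_types" and V: "V \<subseteq> set (points w)" "hits w V"
  shows "lattice_polytope (convex hull (pt ` V))" "sporadic_F_hollow (convex hull (pt ` V))"
    "min_multiplier (convex hull (pt ` V)) = mult_of w" "convex hull (pt ` V) \<subseteq> weighted_simplex w"
proof -
  have "finite V" using V(1) finite_subset by blast
  moreover have "pt ` V \<subseteq> weighted_simplex w" using V(1) pt_weighted_simplex_iff[OF w] by auto
  ultimately show "lattice_polytope (convex hull (pt ` V))" "sporadic_F_hollow (convex hull (pt ` V))"
    "min_multiplier (convex hull (pt ` V)) = mult_of w" "convex hull (pt ` V) \<subseteq> weighted_simplex w"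
    using fine_ineq_sporadic[OF _ hits_fine_ineq[OF w V(2)] _ w] by blast+
qed

text \<open>The only point of the Fine interior, \<open>(1, 1, 1)\<close> for both polytopes, must
  be preserved, which ties the translation of the map to its linear part. The pullbacks of the four
  coordinates are then functionals of coefficient sum 1 that are nonnegative on \<open>V\<close>, so
  they belong to \<open>normals\<close>, and determinant 1 or -1 leaves the permutations.\<close>

lemma unique_embedding:
  assumes w: "w \<in> weight_types"
    and V: "V \<subseteq> set (points w)" "hits w V" "lattice_points (convex hull (pt ` V)) = V"
    and V': "V' \<subseteq> set (points w)" "hits w V'" "lattice_points (convex hull (pt ` V')) = V'"
    and eq: "(convex hull (pt ` V), convex hull (pt ` V')) \<in> unimodular_equiv"
  shows "\<exists>g\<in>set (autos w). V' = act w g ` V"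
proof -
  define Q where "Q = convex hull (pt ` V)"
  define Q' where "Q' = convex hull (pt ` V')"
  note Qp = closed_finite_hull[OF w V(1,2), folded Q_def]
  note Q'p = closed_finite_hull[OF w V'(1,2), folded Q'_def]
  note Qc = lattice_polytope_props[OF Qp(1)]
  note Q'c = lattice_polytope_props[OF Q'p(1)]
  obtain f where f: "affine_unimodular f" "f ` Q = Q'"
    using eq by (auto simp: unimodular_equiv_def Q_def Q'_def)
  obtain A where A: "linear A" "\<And>x. f x = A x + f 0" "bij A" "f 0 \<in> int_lattice"
    "\<And>x. x \<in> int_lattice \<Longrightarrow> A x \<in> int_lattice"
    using affine_unimodularE[OF f(1)] by metis
  have m: "0 \<le> mult_of w" using weight_types_bounds(2)[OF w] by simp
  obtain w0 w1 w2 where w_eq: "w = (w0, w1, w2)" by (cases w)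
  define k where "k = dot w (1, 1, 1)"
  have k: "k > 0" using weight_types_bounds(1)[OF w] by (simp add: k_def)
  obtain x where x: "x \<in> Fine_interior ((*\<^sub>R) (mult_of w) ` Q)"
    using min_multiplier_attained(2)[OF Qc(1,2,5)] Qp(3) by auto
  have x1: "x = pt (1, 1, 1)" by (rule weighted_simplex_Fine_interior(2)[OF Qc(1,3) Qp(4) w m x refl])
  have "A x + mult_of w *\<^sub>R f 0 \<in> Fine_interior ((*\<^sub>R) (mult_of w) ` Q')"
    using Fine_interior_affine_image[OF f(1) A(1,2) Qc(1,3) m x] f(2) by simp
  then have center: "A (pt (1, 1, 1)) + mult_of w *\<^sub>R f 0 = pt (1, 1, 1)"
    unfolding x1 using weighted_simplex_Fine_interior(2)[OF Q'c(1,3) Q'p(4) w m _ refl] by blast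
  have "\<exists>n. adjoint A (axis i 1) = pt n" for i
  proof -
    have "adjoint A (axis i 1) \<in> int_lattice"
      by (rule adjoint_int_lattice[OF A(1,5)], assumption, rule int_lattice_Basis) (simp add: axis_in_Basis_iff)
    then show ?thesis using int_lattice_ptE by metis
  qed
  then obtain n where n: "\<And>i. adjoint A (axis i 1) = pt (n i)" by metis
  have A_nth: "A y $ i = pt (n i) \<bullet> y" for y i
    using adjoint_works[OF A(1), of y "axis i 1"] n by (simp add: inner_axis inner_commute)
  have "f 0 $ i \<in> \<int>" for i using int_lattice_inner_Basis[OF A(4), of "axis i 1"] by (simp add: axis_in_Basis_iff inner_axis)
  then have "\<exists>\<beta>. f 0 $ i = of_int \<beta>" for i by (meson Ints_cases)
  then obtain \<beta> where \<beta>: "\<And>i. f 0 $ i = of_int (\<beta> i)" by metis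
  define s where "s i = dot (n i) (1, 1, 1)" for i
  define e where "e i = 1 - s i - \<beta> i" for i
  \<comment> \<open>The preserved point gives \<open>k * s i + (k + 1) * \<beta> i = k\<close>, so
    \<open>\<beta> i\<close> is divisible by \<open>k\<close>. Multiples of \<open>k\<close> are the
    constants that are integral combinations of the four coordinates.\<close>
  have \<beta>e: "\<beta> i = k * e i" for i
  proof -
    have one: "pt (1, 1, 1) $ i = 1"
    proof -
      have "\<forall>i. pt (1, 1, 1) $ i = 1" by (simp add: forall_3)
      then show ?thesis ..
    qed
    have "(A (pt (1, 1, 1)) + mult_of w *\<^sub>R f 0) $ i = 1" using center one by simp
    then have "of_int (s i) + (of_int k + 1) / of_int k * of_int (\<beta> i) = (1::real)"
      by (simp add: A_nth pt_inner s_def \<beta> mult_of_def k_def)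
    then have "real_of_int (k * s i + (k + 1) * \<beta> i) = of_int k" using k by (simp add: field_simps)
    then have "k * s i + (k + 1) * \<beta> i = k" by (simp only: of_int_eq_iff)
    then show ?thesis by (simp add: e_def algebra_simps)
  qed
  define c where "c i = (case n i of (a, b, d) \<Rightarrow> (a + e i * w0, b + e i * w1, d + e i * w2, e i))" for i
  have fun_c: "functional w (c i) t = dot (n i) t + \<beta> i" for i t
    unfolding \<beta>e k_def by (cases "n i"; cases t) (simp add: c_def functional_def co_def dot_def w_eq algebra_simps)
  have f_nth: "f (pt t) $ i = of_int (functional w (c i) t)" for i t
    by (subst A(2)) (simp add: A_nth \<beta> fun_c pt_inner)
  have f_pt: "f (pt t) = pt (functional w (c 1) t, functional w (c 2) t, functional w (c 3) t)" for t
    by (simp add: vec_eq_iff forall_3 f_nth)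
  have fV: "(functional w (c 1) t, functional w (c 2) t, functional w (c 3) t) \<in> set (points w)" if "t \<in> V" for t
  proof -
    have "f (pt t) \<in> Q'" using that f(2) by (auto simp: Q_def hull_inc)
    then show ?thesis using Q'p(4) f_pt pt_weighted_simplex_iff[OF w] by (metis subsetD)
  qed
  have normalI: "d \<in> set (normals w)"
    if d: "\<And>t. t \<in> V \<Longrightarrow> 0 \<le> functional w d t" "fst d + fst (snd d) + fst (snd (snd d)) + snd (snd (snd d)) = 1" for d
  proof -
    obtain d0 d1 d2 d3 where dd: "d = (d0, d1, d2, d3)" by (cases d)
    show ?thesis unfolding dd
    proof (rule hits_normals[OF w])
      show "d0 + d1 + d2 + d3 = 1" using d(2) by (simp add: dd)
      show "\<forall>L\<in>set (hit_sets w). \<exists>t\<in>set L. 0 \<le> functional w (d0, d1, d2, d3) t"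
        using d(1)[unfolded dd] V(2)[unfolded hits_def] by blast
    qed
  qed
  have sum_c: "fst (c i) + fst (snd (c i)) + fst (snd (snd (c i))) + snd (snd (snd (c i))) = 1" for i
  proof -
    have "s i + k * e i + e i = 1" using \<beta>e[of i] e_def[of i] by simp
    then show ?thesis
      by (cases "n i") (simp add: c_def s_def dot_def k_def w_eq algebra_simps)
  qed
  have nonneg: "0 \<le> functional w (c 1) t" "0 \<le> functional w (c 2) t" "0 \<le> functional w (c 3) t"
    "0 \<le> functional w (last_normal w (c 1) (c 2) (c 3)) t" if "t \<in> V" for t
    using fV[OF that] unfolding points_iff[OF w] functional_last_normal by simp_all
  have c_normals: "c 1 \<in> set (normals w)" "c 2 \<in> set (normals w)" "c 3 \<in> set (normals w)"
    using nonneg sum_c by (auto intro!: normalI)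
  have "last_normal w (c 1) (c 2) (c 3) \<in> set (normals w)"
  proof (rule normalI)
    define l where "l = last_normal w (c 1) (c 2) (c 3)"
    define S where "S d = fst d + fst (snd d) + fst (snd (snd d)) + snd (snd (snd d))" for d :: "int \<times> int \<times> int \<times> int"
    have "S l = w0 + w1 + w2 + 1 - w0 * S (c 1) - w1 * S (c 2) - w2 * S (c 3)"
      by (cases "c 1"; cases "c 2"; cases "c 3") (simp add: S_def l_def last_normal_def w_eq algebra_simps)
    then show "fst l + fst (snd l) + fst (snd (snd l)) + snd (snd (snd l)) = 1"
      using sum_c by (simp add: S_def)
  qed (use nonneg in auto)
  moreover have "\<bar>det_normals w (c 1) (c 2) (c 3)\<bar> = 1"
  proof -
    have "matrix A $ i $ j = pt (n i) $ j" for i j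
      by (simp add: matrix_def A_nth inner_axis)
    then have "det (matrix A) = of_int (det_normals w (c 1) (c 2) (c 3))"
      by (cases "n 1"; cases "n 2"; cases "n 3") (simp add: det_3 det_normals_def c_def w_eq algebra_simps)
    then have "real_of_int \<bar>det_normals w (c 1) (c 2) (c 3)\<bar> = of_int 1"
      using affine_unimodular_det[OF f(1) A(1,2,5)] by simp
    then show ?thesis by (simp only: of_int_eq_iff)
  qed
  ultimately have "(c 1, c 2, c 3) \<in> set (map (\<lambda>(i, j, l). (unit4 i, unit4 j, unit4 l)) (autos w))"
    using normals_autos w c_normals unfolding weight_types_list by (metis (no_types, lifting))
  then obtain i j l where g: "(i, j, l) \<in> set (autos w)" "c 1 = unit4 i" "c 2 = unit4 j" "c 3 = unit4 l" by auto
  note b = autos_bounds[OF w g(1)]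
  have f_act: "f (pt t) = pt (act w (i, j, l) t)" for t
    by (simp add: f_pt g functional_unit4 b act_def)
  have "V' = act w (i, j, l) ` V"
  proof
    show "act w (i, j, l) ` V \<subseteq> V'"
    proof (rule image_subsetI)
      fix t assume t: "t \<in> V"
      have "f (pt t) \<in> Q'" using t f(2) by (auto simp: Q_def hull_inc)
      then show "act w (i, j, l) t \<in> V'"
        using V'(3) unfolding f_act by (auto simp: lattice_points_def Q'_def)
    qed
    \<comment> \<open>As \<open>f\<close> is bijective on the lattice, a lattice point of
      \<open>Q'\<close> comes from one of \<open>Q\<close>, which lies in \<open>V\<close> by
      lattice-convexity.\<close>
    show "V' \<subseteq> act w (i, j, l) ` V"
    proof
      fix t assume "t \<in> V'"
      then have "pt t \<in> f ` Q" using f(2) by (auto simp: Q'_def hull_inc)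
      then obtain y where y: "y \<in> Q" "f y = pt t" by auto
      have "pt t \<in> f ` int_lattice" using f(1) by (simp add: affine_unimodular_def)
      then obtain z where z: "z \<in> int_lattice" "f z = pt t" by (metis imageE)
      have "inj f" using f(1) by (simp add: affine_unimodular_def bij_is_inj)
      then have "y = z" using y z by (metis injD)
      then obtain u where u: "y = pt u" using z int_lattice_ptE by metis
      then have "u \<in> V" using y V(3) by (auto simp: lattice_points_def Q_def)
      moreover have "t = act w (i, j, l) u" using y u f_act pt_eq_iff by metis
      ultimately show "t \<in> act w (i, j, l) ` V" by blast
    qed
  qed
  then show ?thesis using g(1) by blast
qed

subsection \<open>Counting models of clause sets\<close>

text \<open>A trie of clauses over the variables 0, 1, ...: \<open>Branch p q r\<close> collects the clauses containing
  the first variable positively, negatively or not at all; \<open>Contra\<close> contains the empty clause.\<close>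

datatype trie = Empty | Contra | Branch trie trie trie

fun merge :: "trie \<Rightarrow> trie \<Rightarrow> trie" where
  "merge Empty b = b"
| "merge a Empty = a"
| "merge Contra b = Contra"
| "merge a Contra = Contra"
| "merge (Branch p q r) (Branch p' q' r') = Branch (merge p p') (merge q q') (merge r r')"

text \<open>Branching on the first variable: true leaves the shortened clauses of \<open>q\<close>,
  false those of \<open>p\<close>, both together with \<open>r\<close>. A variable in no clause
  gives a factor 2 without a merge. A \<open>Branch\<close> with no variable left counts as
  satisfied, in agreement with \<open>sat\<close>.\<close>

fun models :: "nat \<Rightarrow> trie \<Rightarrow> int" where
  "models n Empty = 2 ^ n"
| "models n Contra = 0"
| "models 0 (Branch p q r) = 1"
| "models (Suc n) (Branch Empty Empty r) = 2 * models n r"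
| "models (Suc n) (Branch p q r) = models n (merge q r) + models n (merge p r)"

fun sat :: "trie \<Rightarrow> bool list \<Rightarrow> bool" where
  "sat Empty bs = True"
| "sat Contra bs = False"
| "sat (Branch p q r) [] = True"
| "sat (Branch p q r) (x # bs) = (sat (if x then q else p) bs \<and> sat r bs)"

lemma sat_merge: "sat (merge a b) bs \<longleftrightarrow> sat a bs \<and> sat b bs"
proof (induction a b arbitrary: bs rule: merge.induct)
  case (5 p q r p' q' r')
  then show ?case by (cases bs) auto
qed auto

lemma card_bool_lists: "card {bs :: bool list. length bs = n} = 2 ^ n"
  using card_lists_length_eq[of "UNIV :: bool set" n] by simp

lemma finite_bool_lists: "finite {bs :: bool list. length bs = n \<and> P bs}"
  using finite_lists_length_eq[of "UNIV :: bool set" n] by (rule rev_finite_subset) auto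

lemma card_bool_lists_Suc:
  "card {bs. length bs = Suc n \<and> P bs} =
     card {bs. length bs = n \<and> P (True # bs)} + card {bs. length bs = n \<and> P (False # bs)}"
proof -
  have "{bs. length bs = Suc n \<and> P bs} =
      (#) True ` {bs. length bs = n \<and> P (True # bs)} \<union> (#) False ` {bs. length bs = n \<and> P (False # bs)}"
    (is "_ = ?A \<union> ?B")
  proof (intro equalityI subsetI)
    fix bs assume "bs \<in> {bs. length bs = Suc n \<and> P bs}"
    then obtain x cs where "bs = x # cs" "length cs = n" "P (x # cs)" by (cases bs) auto
    then show "bs \<in> ?A \<union> ?B" by (cases x) auto
  qed auto
  moreover have "?A \<inter> ?B = {}" by auto
  moreover have "card ?A = card {bs. length bs = n \<and> P (True # bs)}" "card ?B = card {bs. length bs = n \<and> P (False # bs)}"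
    by (intro card_image; simp add: inj_on_def)+
  ultimately show ?thesis by (simp add: card_Un_disjoint finite_bool_lists)
qed

lemma models_eq: "models n a = int (card {bs. length bs = n \<and> sat a bs})"
proof (induction n a rule: models.induct)
  case (1 n)
  then show ?case by (simp add: card_bool_lists)
next
  case (3 p q r)
  have "{bs. length bs = 0 \<and> sat (Branch p q r) bs} = {[]}" by auto
  then show ?case by simp
qed (simp_all add: card_bool_lists_Suc sat_merge)

fun insert_clause :: "bool option list \<Rightarrow> trie \<Rightarrow> trie" where
  "insert_clause c Contra = Contra"
| "insert_clause [] Empty = Contra"
| "insert_clause [] (Branch p q r) = Contra"
| "insert_clause (None # c) Empty = Branch Empty Empty (insert_clause c Empty)"
| "insert_clause (Some True # c) Empty = Branch (insert_clause c Empty) Empty Empty"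
| "insert_clause (Some False # c) Empty = Branch Empty (insert_clause c Empty) Empty"
| "insert_clause (None # c) (Branch p q r) = Branch p q (insert_clause c r)"
| "insert_clause (Some True # c) (Branch p q r) = Branch (insert_clause c p) q r"
| "insert_clause (Some False # c) (Branch p q r) = Branch p (insert_clause c q) r"

fun clause_sat :: "bool option list \<Rightarrow> bool list \<Rightarrow> bool" where
  "clause_sat [] bs = False"
| "clause_sat (l # c) [] = False"
| "clause_sat (l # c) (x # bs) = (l = Some x \<or> clause_sat c bs)"

lemma sat_insert_clause:
  "length c \<le> length bs \<Longrightarrow> sat (insert_clause c a) bs \<longleftrightarrow> clause_sat c bs \<and> sat a bs"
proof (induction c arbitrary: a bs)
  case Nil
  then show ?case by (cases a) auto
next
  case (Cons l c)
  obtain x xs where bs: "bs = x # xs" using Cons.prems by (cases bs) auto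
  have len: "length c \<le> length xs" using Cons.prems bs by simp
  consider "l = None" | "l = Some True" | "l = Some False" by (cases l) auto
  then show ?case
    by cases (cases a; cases x; auto simp: bs Cons.IH[OF len])+
qed

text \<open>\<open>(N, M)\<close> is the clause ``some element of \<open>N\<close> is missing or some element of \<open>M\<close> is
  present''.\<close>

definition holds :: "'a set \<Rightarrow> 'a list \<times> 'a list \<Rightarrow> bool" where
  "holds V cl \<longleftrightarrow> (\<exists>t\<in>set (fst cl). t \<notin> V) \<or> (\<exists>t\<in>set (snd cl). t \<in> V)"

fun memb :: "'a \<Rightarrow> 'a list \<Rightarrow> bool" where
  "memb x [] = False"
| "memb x (y # ys) = (if x = y then True else memb x ys)"

lemma memb_iff: "memb x ys \<longleftrightarrow> x \<in> set ys"
  by (induction ys) auto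

fun all_memb :: "'a list \<Rightarrow> 'a list \<Rightarrow> bool" where
  "all_memb [] ys = True"
| "all_memb (x # xs) ys = (if memb x ys then all_memb xs ys else False)"

lemma all_memb_iff: "all_memb xs ys \<longleftrightarrow> set xs \<subseteq> set ys"
  by (induction xs) (auto simp: memb_iff)

text \<open>Trailing \<open>None\<close> entries are dropped, so that \<^const>\<open>models\<close> detects a violated clause as soon
  as its last variable is assigned.\<close>

fun add_literal :: "bool option \<Rightarrow> bool option list \<Rightarrow> bool option list" where
  "add_literal None [] = []"
| "add_literal None (l # c) = None # l # c"
| "add_literal (Some b) c = Some b # c"

fun to_clause :: "'a list \<Rightarrow> 'a list \<Rightarrow> 'a list \<Rightarrow> bool option list" where
  "to_clause N M [] = []"
| "to_clause N M (t # ts) =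
     add_literal (if memb t N then Some False else if memb t M then Some True else None) (to_clause N M ts)"

fun trie_of :: "'a list \<Rightarrow> ('a list \<times> 'a list) list \<Rightarrow> trie \<Rightarrow> trie" where
  "trie_of ts [] a = a"
| "trie_of ts (cl # cls) a = trie_of ts cls (insert_clause (to_clause (fst cl) (snd cl) ts) a)"

definition chi :: "'a list \<Rightarrow> 'a set \<Rightarrow> bool list" where
  "chi ts V = map (\<lambda>t. t \<in> V) ts"

lemma clause_sat_chi:
  assumes "set N \<inter> set M = {}"
  shows "clause_sat (to_clause N M ts) (chi ts V) \<longleftrightarrow>
    (\<exists>t\<in>set N \<inter> set ts. t \<notin> V) \<or> (\<exists>t\<in>set M \<inter> set ts. t \<in> V)"
proof (induction ts)
  case (Cons t ts)
  have "clause_sat (add_literal l c) (x # bs) \<longleftrightarrow> l = Some x \<or> clause_sat c bs" for l c x bs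
    by (cases l; cases c) auto
  then show ?case using Cons assms by (auto simp: chi_def memb_iff)
qed simp

lemma length_to_clause: "length (to_clause N M ts) \<le> length ts"
proof (induction ts)
  case (Cons t ts)
  have "length (add_literal l c) \<le> Suc (length c)" for l c
    by (cases l; cases c) auto
  then show ?case using Cons order_trans by fastforce
qed simp

lemma sat_trie_of:
  assumes "\<And>cl. cl \<in> set cls \<Longrightarrow> set (fst cl) \<subseteq> set ts \<and> set (snd cl) \<subseteq> set ts \<and> set (fst cl) \<inter> set (snd cl) = {}"
  shows "sat (trie_of ts cls a) (chi ts V) \<longleftrightarrow> (\<forall>cl\<in>set cls. holds V cl) \<and> sat a (chi ts V)"
  using assms
proof (induction cls arbitrary: a)
  case (Cons cl cls)
  have "length (to_clause (fst cl) (snd cl) ts) \<le> length (chi ts V)"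
    by (simp add: chi_def length_to_clause)
  moreover have "clause_sat (to_clause (fst cl) (snd cl) ts) (chi ts V) \<longleftrightarrow> holds V cl"
    using Cons.prems[of cl] by (subst clause_sat_chi) (auto simp: holds_def)
  ultimately show ?case using Cons by (auto simp: sat_insert_clause)
qed simp

text \<open>Allows the trie of the clauses common to all automorphisms to be built once and merged
  with the small trie of each.\<close>

lemma sat_trie_of_append:
  "length bs = length ts \<Longrightarrow>
    sat (trie_of ts (cls @ cls') Empty) bs \<longleftrightarrow> sat (trie_of ts cls Empty) bs \<and> sat (trie_of ts cls' Empty) bs"
proof -
  assume len: "length bs = length ts"
  have *: "sat (trie_of ts cls a) bs \<longleftrightarrow> sat (trie_of ts cls Empty) bs \<and> sat a bs" for cls a
  proof (induction cls arbitrary: a)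
    case (Cons cl cls)
    let ?c = "to_clause (fst cl) (snd cl) ts"
    have "sat (trie_of ts (cl # cls) a) bs \<longleftrightarrow> sat (trie_of ts cls Empty) bs \<and> sat (insert_clause ?c a) bs" for a
      using Cons.IH[of "insert_clause ?c a"] by simp
    then show ?case using len by (auto simp: sat_insert_clause length_to_clause)
  qed simp
  have "trie_of ts (cls @ cls') a = trie_of ts cls' (trie_of ts cls a)" for a
    by (induction cls arbitrary: a) auto
  then show ?thesis using * by metis
qed

lemma card_models:
  assumes "distinct ts"
    and "\<And>cl. cl \<in> set cls \<Longrightarrow> set (fst cl) \<subseteq> set ts \<and> set (snd cl) \<subseteq> set ts \<and> set (fst cl) \<inter> set (snd cl) = {}"
  shows "int (card {V. V \<subseteq> set ts \<and> (\<forall>cl\<in>set cls. holds V cl)}) = models (length ts) (trie_of ts cls Empty)"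
proof -
  have "bij_betw (chi ts) {V. V \<subseteq> set ts \<and> (\<forall>cl\<in>set cls. holds V cl)}
      {bs. length bs = length ts \<and> sat (trie_of ts cls Empty) bs}"
  proof (rule bij_betwI')
    fix V V' assume "V \<in> {V. V \<subseteq> set ts \<and> (\<forall>cl\<in>set cls. holds V cl)}" "V' \<in> {V. V \<subseteq> set ts \<and> (\<forall>cl\<in>set cls. holds V cl)}"
    then show "chi ts V = chi ts V' \<longleftrightarrow> V = V'" by (auto simp: chi_def)
  next
    fix V assume "V \<in> {V. V \<subseteq> set ts \<and> (\<forall>cl\<in>set cls. holds V cl)}"
    then have "\<forall>cl\<in>set cls. holds V cl" by simp
    then have "sat (trie_of ts cls Empty) (chi ts V)" using sat_trie_of[OF assms(2)] by simp
    then show "chi ts V \<in> {bs. length bs = length ts \<and> sat (trie_of ts cls Empty) bs}"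
      by (simp add: chi_def)
  next
    fix bs assume bs: "bs \<in> {bs. length bs = length ts \<and> sat (trie_of ts cls Empty) bs}"
    define V where "V = {ts ! i |i. i < length ts \<and> bs ! i}"
    have "chi ts V = bs"
    proof (rule nth_equalityI)
      show "length (chi ts V) = length bs" using bs by (simp add: chi_def)
      fix i assume "i < length (chi ts V)"
      then have i: "i < length ts" by (simp add: chi_def)
      have "ts ! i \<in> V \<longleftrightarrow> bs ! i"
        using i nth_eq_iff_index_eq[OF assms(1)] by (auto simp: V_def)
      then show "chi ts V ! i = bs ! i" using i by (simp add: chi_def)
    qed
    moreover have "V \<subseteq> set ts" by (auto simp: V_def)
    moreover have "sat (trie_of ts cls Empty) bs" using bs by simp
    ultimately have "\<forall>cl\<in>set cls. holds V cl" using sat_trie_of[OF assms(2), where V = V] by fastforce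
    then show "\<exists>V\<in>{V. V \<subseteq> set ts \<and> (\<forall>cl\<in>set cls. holds V cl)}. bs = chi ts V"
      using \<open>chi ts V = bs\<close> \<open>V \<subseteq> set ts\<close> by blast
  qed
  then show ?thesis by (simp add: bij_betw_same_card models_eq)
qed

subsection \<open>Lattice-convex sets as models\<close>

text \<open>A rule \<open>(ps, v)\<close> states that \<open>v\<close> is a convex combination, with the given weights, of the
  points in \<open>ps\<close>.\<close>

definition hull_rules :: "int \<times> int \<times> int \<Rightarrow> ((int \<times> int \<times> int \<times> int) list \<times> int \<times> int \<times> int) list" where
  "hull_rules w = (if w = (1, 1, 1) then
    [([(1, (0,0,1)), (1, (0,0,2)), (1, (0,3,0))], (0,1,1)), ([(1, (0,0,3)), (1, (0,1,0)), (1,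
    (0,2,0))], (0,1,1)), ([(1, (0,0,0)), (1, (0,1,2)), (1, (0,2,1))], (0,1,1)), ([(1, (0,0,0)),
    (1, (1,0,2)), (1, (2,0,1))], (1,0,1)), ([(1, (0,0,1)), (1, (0,0,2)), (1, (3,0,0))],
    (1,0,1)), ([(1, (0,0,3)), (1, (1,0,0)), (1, (2,0,0))], (1,0,1)), ([(1, (0,0,0)), (1,
    (1,2,0)), (1, (2,1,0))], (1,1,0)), ([(1, (0,1,0)), (1, (0,2,0)), (1, (3,0,0))], (1,1,0)),
    ([(1, (0,3,0)), (1, (1,0,0)), (1, (2,0,0))], (1,1,0)), ([(1, (0,3,0)), (1, (1,0,2)), (1,
    (2,0,1))], (1,1,1)), ([(1, (0,0,3)), (1, (1,2,0)), (1, (2,1,0))], (1,1,1)), ([(1, (0,1,2)),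
    (1, (0,2,1)), (1, (3,0,0))], (1,1,1)), ([(1, (0,0,2)), (1, (0,1,0)), (1, (0,2,1))],
    (0,1,1)), ([(1, (0,0,1)), (1, (0,1,2)), (1, (0,2,0))], (0,1,1)), ([(1, (0,0,1)), (1,
    (1,0,2)), (1, (2,0,0))], (1,0,1)), ([(1, (0,0,2)), (1, (1,0,0)), (1, (2,0,1))], (1,0,1)),
    ([(1, (0,1,0)), (1, (1,2,0)), (1, (2,0,0))], (1,1,0)), ([(1, (0,2,0)), (1, (1,0,0)), (1,
    (2,1,0))], (1,1,0)), ([(1, (0,2,1)), (1, (1,0,2)), (1, (2,1,0))], (1,1,1)), ([(1, (0,1,2)),
    (1, (1,2,0)), (1, (2,0,1))], (1,1,1)), ([(1, (0,0,0)), (2, (0,0,3))], (0,0,2)), ([(1,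
    (0,0,0)), (2, (0,3,0))], (0,2,0)), ([(1, (0,0,3)), (2, (0,3,0))], (0,2,1)), ([(1, (0,0,0)),
    (2, (3,0,0))], (2,0,0)), ([(1, (0,0,3)), (2, (3,0,0))], (2,0,1)), ([(1, (0,3,0)), (2,
    (3,0,0))], (2,1,0)), ([(1, (0,0,0)), (1, (0,0,2))], (0,0,1)), ([(1, (0,0,1)), (1, (0,0,3))],
    (0,0,2)), ([(1, (0,0,0)), (1, (0,2,0))], (0,1,0)), ([(1, (0,0,1)), (1, (0,2,1))], (0,1,1)),
    ([(1, (0,0,2)), (1, (0,2,0))], (0,1,1)), ([(1, (0,1,0)), (1, (0,1,2))], (0,1,1)), ([(1,
    (0,0,3)), (1, (0,2,1))], (0,1,2)), ([(1, (0,1,0)), (1, (0,3,0))], (0,2,0)), ([(1, (0,1,2)),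
    (1, (0,3,0))], (0,2,1)), ([(1, (0,0,0)), (1, (2,0,0))], (1,0,0)), ([(1, (1,0,0)), (1,
    (1,0,2))], (1,0,1)), ([(1, (0,0,1)), (1, (2,0,1))], (1,0,1)), ([(1, (0,0,2)), (1, (2,0,0))],
    (1,0,1)), ([(1, (0,0,3)), (1, (2,0,1))], (1,0,2)), ([(1, (1,0,0)), (1, (1,2,0))], (1,1,0)),
    ([(1, (0,2,0)), (1, (2,0,0))], (1,1,0)), ([(1, (0,1,0)), (1, (2,1,0))], (1,1,0)), ([(1,
    (0,2,1)), (1, (2,0,1))], (1,1,1)), ([(1, (1,0,2)), (1, (1,2,0))], (1,1,1)), ([(1, (0,1,2)),
    (1, (2,1,0))], (1,1,1)), ([(1, (0,3,0)), (1, (2,1,0))], (1,2,0)), ([(1, (1,0,0)), (1,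
    (3,0,0))], (2,0,0)), ([(1, (1,0,2)), (1, (3,0,0))], (2,0,1)), ([(1, (1,2,0)), (1, (3,0,0))],
    (2,1,0))]
   else if w = (2, 1, 1) then
    [([(2, (0,0,0)), (2, (0,1,2)), (1, (0,3,1))], (0,1,1)), ([(2, (0,0,0)), (1, (0,1,3)), (2,
    (0,2,1))], (0,1,1)), ([(2, (0,0,4)), (1, (0,1,0)), (2, (0,2,1))], (0,1,2)), ([(2, (0,0,4)),
    (2, (0,1,1)), (1, (0,3,0))], (0,1,2)), ([(1, (0,0,1)), (2, (0,1,2)), (2, (0,4,0))],
    (0,2,1)), ([(1, (0,0,1)), (2, (0,1,3)), (4, (0,3,0))], (0,2,1)), ([(1, (0,0,3)), (2,
    (0,1,0)), (4, (0,3,1))], (0,2,1)), ([(1, (0,0,3)), (2, (0,1,1)), (2, (0,4,0))], (0,2,1)),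
    ([(2, (0,0,1)), (1, (0,1,3)), (2, (0,2,0))], (0,1,1)), ([(2, (0,0,2)), (2, (0,1,0)), (1,
    (0,3,1))], (0,1,1)), ([(2, (0,0,2)), (2, (0,1,3)), (1, (0,3,0))], (0,1,2)), ([(2, (0,0,3)),
    (1, (0,1,0)), (2, (0,2,2))], (0,1,2)), ([(1, (0,0,3)), (2, (0,2,0)), (2, (0,3,1))],
    (0,2,1)), ([(1, (0,0,1)), (2, (0,2,2)), (2, (0,3,0))], (0,2,1)), ([(1, (0,0,1)), (1,
    (0,0,2)), (1, (0,3,0))], (0,1,1)), ([(1, (0,0,1)), (1, (0,1,0)), (1, (0,2,2))], (0,1,1)),
    ([(1, (0,0,0)), (1, (0,1,2)), (1, (0,2,1))], (0,1,1)), ([(1, (0,0,3)), (1, (0,1,0)), (1,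
    (0,2,0))], (0,1,1)), ([(1, (0,0,2)), (1, (0,0,3)), (1, (0,3,1))], (0,1,2)), ([(1, (0,0,3)),
    (1, (0,1,3)), (1, (0,2,0))], (0,1,2)), ([(1, (0,0,4)), (1, (0,1,1)), (1, (0,2,1))],
    (0,1,2)), ([(1, (0,0,1)), (1, (0,1,3)), (1, (0,2,2))], (0,1,2)), ([(1, (0,0,2)), (1,
    (0,3,0)), (1, (0,3,1))], (0,2,1)), ([(1, (0,1,3)), (1, (0,2,0)), (1, (0,3,0))], (0,2,1)),
    ([(1, (0,1,0)), (1, (0,2,2)), (1, (0,3,1))], (0,2,1)), ([(1, (0,1,1)), (1, (0,1,2)), (1,
    (0,4,0))], (0,2,1)), ([(1, (0,0,1)), (1, (1,0,2)), (1, (2,0,0))], (1,0,1)), ([(1, (0,0,3)),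
    (1, (1,0,0)), (1, (2,0,0))], (1,0,1)), ([(1, (0,1,0)), (1, (1,2,0)), (1, (2,0,0))],
    (1,1,0)), ([(1, (0,3,0)), (1, (1,0,0)), (1, (2,0,0))], (1,1,0)), ([(1, (0,1,3)), (1,
    (1,2,0)), (1, (2,0,0))], (1,1,1)), ([(1, (0,3,1)), (1, (1,0,2)), (1, (2,0,0))], (1,1,1)),
    ([(1, (0,0,1)), (1, (0,1,2)), (1, (0,2,0))], (0,1,1)), ([(1, (0,0,2)), (1, (0,1,0)), (1,
    (0,2,1))], (0,1,1)), ([(1, (0,0,2)), (1, (0,1,3)), (1, (0,2,1))], (0,1,2)), ([(1, (0,0,3)),
    (1, (0,1,1)), (1, (0,2,2))], (0,1,2)), ([(1, (0,1,2)), (1, (0,2,0)), (1, (0,3,1))],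
    (0,2,1)), ([(1, (0,1,1)), (1, (0,2,2)), (1, (0,3,0))], (0,2,1)), ([(1, (0,0,0)), (1,
    (0,0,4))], (0,0,2)), ([(1, (0,0,0)), (1, (0,4,0))], (0,2,0)), ([(1, (0,0,4)), (1, (0,4,0))],
    (0,2,2)), ([(1, (0,0,0)), (1, (0,2,2))], (0,1,1)), ([(1, (0,0,4)), (1, (0,2,0))], (0,1,2)),
    ([(1, (0,0,2)), (1, (0,4,0))], (0,2,1)), ([(1, (0,0,0)), (2, (0,0,3))], (0,0,2)), ([(1,
    (0,0,1)), (2, (0,0,4))], (0,0,3)), ([(1, (0,1,0)), (2, (0,1,3))], (0,1,2)), ([(1, (0,0,0)),
    (2, (0,3,0))], (0,2,0)), ([(1, (0,0,1)), (2, (0,3,1))], (0,2,1)), ([(1, (0,0,3)), (2,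
    (0,3,0))], (0,2,1)), ([(1, (0,0,4)), (2, (0,3,1))], (0,2,2)), ([(1, (0,1,0)), (2, (0,4,0))],
    (0,3,0)), ([(1, (0,1,3)), (2, (0,4,0))], (0,3,1)), ([(1, (0,0,0)), (1, (2,0,0))], (1,0,0)),
    ([(1, (0,0,4)), (1, (2,0,0))], (1,0,2)), ([(1, (0,4,0)), (1, (2,0,0))], (1,2,0)), ([(1,
    (0,0,2)), (1, (2,0,0))], (1,0,1)), ([(1, (0,2,0)), (1, (2,0,0))], (1,1,0)), ([(1, (0,2,2)),
    (1, (2,0,0))], (1,1,1)), ([(1, (0,0,0)), (1, (0,0,2))], (0,0,1)), ([(1, (0,0,1)), (1,
    (0,0,3))], (0,0,2)), ([(1, (0,0,2)), (1, (0,0,4))], (0,0,3)), ([(1, (0,0,0)), (1, (0,2,0))],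
    (0,1,0)), ([(1, (0,0,1)), (1, (0,2,1))], (0,1,1)), ([(1, (0,0,2)), (1, (0,2,0))], (0,1,1)),
    ([(1, (0,1,0)), (1, (0,1,2))], (0,1,1)), ([(1, (0,0,2)), (1, (0,2,2))], (0,1,2)), ([(1,
    (0,0,3)), (1, (0,2,1))], (0,1,2)), ([(1, (0,1,1)), (1, (0,1,3))], (0,1,2)), ([(1, (0,0,4)),
    (1, (0,2,2))], (0,1,3)), ([(1, (0,1,0)), (1, (0,3,0))], (0,2,0)), ([(1, (0,1,2)), (1,
    (0,3,0))], (0,2,1)), ([(1, (0,2,0)), (1, (0,2,2))], (0,2,1)), ([(1, (0,1,1)), (1, (0,3,1))],
    (0,2,1)), ([(1, (0,1,3)), (1, (0,3,1))], (0,2,2)), ([(1, (0,2,0)), (1, (0,4,0))], (0,3,0)),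
    ([(1, (0,2,2)), (1, (0,4,0))], (0,3,1)), ([(1, (1,0,0)), (1, (1,0,2))], (1,0,1)), ([(1,
    (1,0,0)), (1, (1,2,0))], (1,1,0)), ([(1, (1,0,2)), (1, (1,2,0))], (1,1,1))]
   else
    [([(2, (0,0,6)), (3, (0,1,0)), (2, (0,2,1))], (0,1,2)), ([(2, (0,0,0)), (3, (0,1,4)), (2,
    (0,2,1))], (0,1,2)), ([(2, (0,0,1)), (4, (0,1,3)), (1, (0,3,0))], (0,1,2)), ([(2, (0,0,5)),
    (4, (0,1,1)), (1, (0,3,0))], (0,1,2)), ([(1, (0,0,1)), (2, (0,2,2)), (2, (0,3,0))],
    (0,2,1)), ([(1, (0,0,5)), (2, (0,2,0)), (2, (0,3,0))], (0,2,1)), ([(2, (0,0,0)), (1,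
    (0,1,3)), (2, (0,2,1))], (0,1,1)), ([(2, (0,0,1)), (1, (0,1,4)), (2, (0,2,2))], (0,1,2)),
    ([(2, (0,0,5)), (1, (0,1,0)), (2, (0,2,0))], (0,1,2)), ([(2, (0,0,5)), (3, (0,1,0)), (2,
    (0,2,2))], (0,1,2)), ([(2, (0,0,1)), (3, (0,1,4)), (2, (0,2,0))], (0,1,2)), ([(2, (0,0,6)),
    (1, (0,1,1)), (2, (0,2,1))], (0,1,3)), ([(2, (0,0,1)), (1, (1,0,3)), (2, (2,0,0))],
    (1,0,1)), ([(2, (0,0,5)), (1, (1,0,0)), (2, (2,0,0))], (1,0,2)), ([(1, (0,0,1)), (1,
    (0,0,2)), (1, (0,3,0))], (0,1,1)), ([(1, (0,0,4)), (1, (0,0,5)), (1, (0,3,0))], (0,1,3)),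
    ([(2, (0,0,2)), (2, (0,1,3)), (1, (0,3,0))], (0,1,2)), ([(2, (0,0,4)), (2, (0,1,1)), (1,
    (0,3,0))], (0,1,2)), ([(1, (0,0,1)), (1, (0,1,0)), (1, (0,2,2))], (0,1,1)), ([(1, (0,0,0)),
    (1, (0,1,2)), (1, (0,2,1))], (0,1,1)), ([(1, (0,0,1)), (1, (0,1,3)), (1, (0,2,2))],
    (0,1,2)), ([(1, (0,0,5)), (1, (0,1,1)), (1, (0,2,0))], (0,1,2)), ([(1, (0,0,6)), (1,
    (0,1,2)), (1, (0,2,1))], (0,1,3)), ([(1, (0,0,5)), (1, (0,1,4)), (1, (0,2,0))], (0,1,3)),
    ([(1, (0,0,1)), (1, (1,0,2)), (1, (2,0,0))], (1,0,1)), ([(1, (0,0,5)), (1, (1,0,1)), (1,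
    (2,0,0))], (1,0,2)), ([(2, (0,0,1)), (1, (0,1,3)), (2, (0,2,0))], (0,1,1)), ([(2, (0,0,3)),
    (1, (0,1,4)), (2, (0,2,0))], (0,1,2)), ([(2, (0,0,3)), (1, (0,1,0)), (2, (0,2,2))],
    (0,1,2)), ([(2, (0,0,4)), (1, (0,1,0)), (2, (0,2,1))], (0,1,2)), ([(2, (0,0,2)), (1,
    (0,1,4)), (2, (0,2,1))], (0,1,2)), ([(2, (0,0,5)), (1, (0,1,1)), (2, (0,2,2))], (0,1,3)),
    ([(1, (0,0,3)), (1, (1,0,0)), (1, (2,0,0))], (1,0,1)), ([(1, (0,0,3)), (1, (1,0,3)), (1,
    (2,0,0))], (1,0,2)), ([(1, (0,3,0)), (1, (1,0,0)), (1, (2,0,0))], (1,1,0)), ([(1, (0,3,0)),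
    (1, (1,0,3)), (1, (2,0,0))], (1,1,1)), ([(1, (0,0,2)), (1, (0,1,0)), (1, (0,2,1))],
    (0,1,1)), ([(1, (0,0,1)), (1, (0,1,2)), (1, (0,2,0))], (0,1,1)), ([(1, (0,0,3)), (1,
    (0,1,0)), (1, (0,2,0))], (0,1,1)), ([(1, (0,0,2)), (1, (0,1,3)), (1, (0,2,1))], (0,1,2)),
    ([(1, (0,0,3)), (1, (0,1,3)), (1, (0,2,0))], (0,1,2)), ([(1, (0,0,3)), (1, (0,1,1)), (1,
    (0,2,2))], (0,1,2)), ([(1, (0,0,4)), (1, (0,1,1)), (1, (0,2,1))], (0,1,2)), ([(1, (0,0,3)),
    (1, (0,1,4)), (1, (0,2,2))], (0,1,3)), ([(1, (0,0,4)), (1, (0,1,4)), (1, (0,2,1))],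
    (0,1,3)), ([(1, (0,0,5)), (1, (0,1,2)), (1, (0,2,2))], (0,1,3)), ([(1, (0,1,1)), (1,
    (0,2,2)), (1, (0,3,0))], (0,2,1)), ([(1, (0,1,3)), (1, (0,2,0)), (1, (0,3,0))], (0,2,1)),
    ([(1, (0,0,0)), (1, (0,0,6))], (0,0,3)), ([(2, (0,0,0)), (3, (0,0,5))], (0,0,3)), ([(2,
    (0,0,1)), (3, (0,0,6))], (0,0,4)), ([(1, (0,0,0)), (2, (0,3,0))], (0,2,0)), ([(1, (0,0,6)),
    (2, (0,3,0))], (0,2,2)), ([(1, (0,0,0)), (1, (0,2,2))], (0,1,1)), ([(1, (0,0,6)), (1,
    (0,2,0))], (0,1,3)), ([(1, (0,0,0)), (1, (2,0,0))], (1,0,0)), ([(1, (0,0,6)), (1, (2,0,0))],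
    (1,0,3)), ([(1, (0,0,0)), (1, (0,0,4))], (0,0,2)), ([(1, (0,0,1)), (1, (0,0,5))], (0,0,3)),
    ([(1, (0,0,2)), (1, (0,0,6))], (0,0,4)), ([(1, (0,1,0)), (1, (0,1,4))], (0,1,2)), ([(1,
    (0,0,3)), (2, (0,3,0))], (0,2,1)), ([(1, (0,0,2)), (1, (2,0,0))], (1,0,1)), ([(1, (0,0,4)),
    (1, (2,0,0))], (1,0,2)), ([(1, (0,0,0)), (2, (0,0,3))], (0,0,2)), ([(1, (0,0,1)), (2,
    (0,0,4))], (0,0,3)), ([(1, (0,0,2)), (2, (0,0,5))], (0,0,4)), ([(1, (0,0,3)), (2, (0,0,6))],
    (0,0,5)), ([(1, (0,0,0)), (1, (0,2,0))], (0,1,0)), ([(1, (0,0,1)), (1, (0,2,1))], (0,1,1)),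
    ([(1, (0,0,2)), (1, (0,2,2))], (0,1,2)), ([(1, (0,0,4)), (1, (0,2,0))], (0,1,2)), ([(1,
    (0,1,0)), (2, (0,1,3))], (0,1,2)), ([(1, (0,1,1)), (2, (0,1,4))], (0,1,3)), ([(1, (0,0,5)),
    (1, (0,2,1))], (0,1,3)), ([(1, (0,0,6)), (1, (0,2,2))], (0,1,4)), ([(1, (0,1,0)), (1,
    (0,3,0))], (0,2,0)), ([(1, (0,1,4)), (1, (0,3,0))], (0,2,2)), ([(1, (1,0,0)), (2, (1,0,3))],
    (1,0,2)), ([(1, (0,0,2)), (1, (0,2,0))], (0,1,1)), ([(1, (0,0,3)), (1, (0,2,1))], (0,1,2)),
    ([(1, (0,0,4)), (1, (0,2,2))], (0,1,3)), ([(1, (0,1,2)), (1, (0,3,0))], (0,2,1)), ([(1,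
    (0,2,0)), (1, (2,0,0))], (1,1,0)), ([(1, (0,2,2)), (1, (2,0,0))], (1,1,1)), ([(1, (0,0,0)),
    (1, (0,0,2))], (0,0,1)), ([(1, (0,0,1)), (1, (0,0,3))], (0,0,2)), ([(1, (0,0,2)), (1,
    (0,0,4))], (0,0,3)), ([(1, (0,0,3)), (1, (0,0,5))], (0,0,4)), ([(1, (0,0,4)), (1, (0,0,6))],
    (0,0,5)), ([(1, (0,1,0)), (1, (0,1,2))], (0,1,1)), ([(1, (0,1,1)), (1, (0,1,3))], (0,1,2)),
    ([(1, (0,1,2)), (1, (0,1,4))], (0,1,3)), ([(1, (0,2,0)), (1, (0,2,2))], (0,2,1)), ([(1,
    (1,0,0)), (1, (1,0,2))], (1,0,1)), ([(1, (1,0,1)), (1, (1,0,3))], (1,0,2))])"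

text \<open>For every point \<open>v\<close>, functionals such that every set violating no rule and not containing
  \<open>v\<close> is separated from \<open>v\<close> by one of them.\<close>

definition separators :: "int \<times> int \<times> int \<Rightarrow> ((int \<times> int \<times> int) \<times> (int \<times> int \<times> int) list) list" where
  "separators w = (if w = (1, 1, 1) then
    [((0,0,2), [(1,1,-1), (3,3,1)]), ((0,0,0), [(1,1,1)]), ((0,0,3), [(0,0,-1)]), ((0,0,1),
    [(2,2,1), (2,2,-1)]), ((0,1,0), [(2,1,2), (2,-1,2)]), ((0,2,0), [(1,-1,1), (3,1,3)]),
    ((0,3,0), [(0,-1,0)]), ((0,1,1), [(3,-3,-1), (4,-2,1), (3,-1,-3), (6,2,3), (4,1,-2),
    (6,3,2)]), ((0,2,1), [(0,-2,-1), (0,-2,-3)]), ((0,1,2), [(0,-1,-2), (0,-3,-2)]), ((1,0,2),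
    [(-1,0,-2), (-3,0,-2)]), ((2,0,1), [(-2,0,-1), (-2,0,-3)]), ((3,0,0), [(-1,0,0)]), ((1,0,1),
    [(-3,3,-1), (-2,4,1), (-1,3,-3), (2,6,3), (1,4,-2), (3,6,2)]), ((1,0,0), [(1,2,2),
    (-1,2,2)]), ((2,0,0), [(-1,1,1), (1,3,3)]), ((1,1,0), [(-3,-1,3), (-2,1,4), (-1,-3,3),
    (2,3,6), (1,-2,4), (3,2,6)]), ((2,1,0), [(-2,-1,0), (-2,-3,0)]), ((1,2,0), [(-1,-2,0),
    (-3,-2,0)]), ((1,1,1), [(-6,-4,-3), (-6,-3,-4), (-4,-6,-3), (-4,-3,-6), (-3,-6,-4),
    (-3,-4,-6)])]
   else if w = (2, 1, 1) then
    [((2,0,0), [(-1,0,0)]), ((0,0,0), [(2,1,1)]), ((0,0,3), [(0,1,-1), (4,4,1)]), ((0,0,2),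
    [(2,2,-1), (4,3,1)]), ((0,0,1), [(2,2,1), (2,3,-1)]), ((0,0,4), [(0,0,-1)]), ((0,3,0),
    [(0,-1,1), (4,1,4)]), ((0,2,1), [(0,-3,-1), (2,-2,1), (0,-2,-3), (6,1,3), (2,-1,-3),
    (8,2,3), (6,1,-3), (12,4,3)]), ((0,1,2), [(0,-1,-3), (2,1,-2), (0,-3,-2), (2,-3,-1),
    (6,3,1), (8,3,2), (6,-3,1), (12,3,4)]), ((0,4,0), [(0,-1,0)]), ((0,2,0), [(2,-1,2),
    (4,1,3)]), ((0,1,0), [(2,1,2), (2,-1,3)]), ((0,1,1), [(6,2,3), (6,3,2), (4,-1,2), (4,-2,1),
    (4,2,-1), (4,1,-2), (4,-4,-1), (4,-1,-4)]), ((0,2,2), [(-2,-3,-2), (-2,-2,-3)]), ((0,3,1),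
    [(-2,-2,-1), (-4,-3,-4)]), ((0,1,3), [(-2,-1,-2), (-4,-4,-3)]), ((1,2,0), [(-3,-2,0),
    (-3,-1,0)]), ((1,1,1), [(-6,-2,-1), (-6,-1,-2), (-9,-6,-4), (-9,-4,-6)]), ((1,0,2),
    [(-3,0,-2), (-3,0,-1)]), ((1,0,1), [(-4,1,-1), (-2,2,1), (-1,4,-2), (3,6,2)]), ((1,1,0),
    [(-4,-1,1), (-2,1,2), (-1,-2,4), (3,2,6)]), ((1,0,0), [(-1,1,1), (1,2,2)])]
   else
    [((0,3,0), [(0,-1,0)]), ((2,0,0), [(-1,0,0)]), ((0,0,5), [(0,0,-1), (9,6,1)]), ((0,0,3),
    [(3,2,-1), (6,4,1)]), ((0,0,6), [(0,0,-1)]), ((0,0,4), [(0,1,-1), (6,5,1)]), ((0,0,2),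
    [(3,3,1), (3,3,-1)]), ((0,0,1), [(3,2,1), (6,4,-1)]), ((0,0,0), [(3,2,1)]), ((0,2,1),
    [(-3,-4,-1), (0,-2,1), (3,-2,-3), (12,4,3)]), ((0,1,2), [(0,-5,-1), (3,-3,1), (2,-1,-2),
    (8,3,2), (4,1,-2), (10,5,2), (0,-3,-2), (6,1,2)]), ((0,2,0), [(0,-1,1), (3,1,3)]), ((0,1,0),
    [(3,1,2), (1,-1,2)]), ((1,1,0), [(-3,-1,1), (-1,-2,2), (3,2,21)]), ((1,0,0), [(-1,1,1),
    (1,2,2)]), ((1,0,1), [(-2,2,1), (-6,1,-1), (3,6,2), (-1,20,-2)]), ((1,0,2), [(-5,0,-1),
    (-3,3,1), (-3,2,-2), (5,24,2)]), ((1,0,3), [(-5,-2,-2), (-4,-1,-1)]), ((0,1,4), [(-3,-3,-2),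
    (-5,-5,-2)]), ((0,2,2), [(-3,-3,-1), (-6,-5,-3)]), ((1,1,1), [(-6,-3,-1), (-7,-6,-2),
    (-60,-40,-21)]), ((0,1,3), [(-3,-4,-3), (0,-1,-2), (0,-4,-1), (-3,-5,-2), (4,-4,1),
    (29,5,3), (8,4,1), (12,5,2)]), ((0,1,1), [(6,2,3), (6,3,2), (3,-2,1), (3,-1,2), (1,-6,-1),
    (20,-1,-3), (5,2,-1), (6,1,-2)])])"

text \<open>The points of the smallest face of the simplex that contains \<open>v\<close>. A convex
  combination equal to \<open>v\<close> uses no others, so the search can be confined to
  them.\<close>

definition face :: "int \<times> int \<times> int \<Rightarrow> int \<times> int \<times> int \<Rightarrow> (int \<times> int \<times> int) list" where
  "face w v = filter (\<lambda>u. list_all (\<lambda>i. if co w i v = 0 then co w i u = 0 else True) [0, 1, 2, 3]) (points w)"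

definition rule_clause :: "(int \<times> int \<times> int \<times> int) list \<times> int \<times> int \<times> int \<Rightarrow> (int \<times> int \<times> int) list \<times> (int \<times> int \<times> int) list" where
  "rule_clause r = (map snd (fst r), [snd r])"

text \<open>A model would be a set obeying the rules within the face, missing \<open>v\<close>, and
  meeting the closed half-space of every separator at \<open>v\<close>. That none exists means that
  one of the separators always works.\<close>

definition separation_clauses :: "int \<times> int \<times> int \<Rightarrow> int \<times> int \<times> int \<Rightarrow> (int \<times> int \<times> int) list \<Rightarrow>
    (int \<times> int \<times> int) list \<Rightarrow> ((int \<times> int \<times> int) list \<times> (int \<times> int \<times> int) list) list" where
  "separation_clauses w v F ds = ([v], []) # map (\<lambda>d. ([], filter (\<lambda>u. dot d u \<le> dot d v \<and> u \<noteq> v) F)) ds @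
     filter (\<lambda>cl. all_memb (snd cl @ fst cl) F) (map rule_clause (hull_rules w))"

lemma hull_rules_ok:
  "\<forall>w\<in>set [(1,1,1), (2,1,1), (3,2,1)]. \<forall>r\<in>set (hull_rules w).
     list_all (\<lambda>p. 0 < fst p) (fst r) \<and> fst r \<noteq> [] \<and>
     list_all (\<lambda>t. memb t (points w)) (map snd (fst r)) \<and> memb (snd r) (points w) \<and> \<not> memb (snd r) (map snd (fst r)) \<and>
     sum_list (map (\<lambda>p. fst p * fst (snd p)) (fst r)) = sum_list (map fst (fst r)) * fst (snd r) \<and>
     sum_list (map (\<lambda>p. fst p * fst (snd (snd p))) (fst r)) = sum_list (map fst (fst r)) * fst (snd (snd r)) \<and>
     sum_list (map (\<lambda>p. fst p * snd (snd (snd p))) (fst r)) = sum_list (map fst (fst r)) * snd (snd (snd r))"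
  by code_simp

text \<open>Off the face every separator exceeds its value at \<open>v\<close> anyway, so the
  clauses need to control points of the face only.\<close>

lemma separators_ok:
  "\<forall>w\<in>set [(1,1,1), (2,1,1), (3,2,1)]. map fst (separators w) = points w \<and>
    (\<forall>(v, ds)\<in>set (separators w). \<forall>d\<in>set ds. \<forall>u\<in>set (points w). memb u (face w v) \<or> dot d v < dot d u)"
  by code_simp

fun separation_check :: "int \<times> int \<times> int \<Rightarrow> (int \<times> int \<times> int) \<times> (int \<times> int \<times> int) list \<Rightarrow>
    (int \<times> int \<times> int) list \<Rightarrow> bool" where
  "separation_check w (v, ds) F = (models (length F) (trie_of F (separation_clauses w v F ds) Empty) = 0)"

lemma separation_333: "\<forall>s\<in>set (separators (1, 1, 1)). separation_check (1, 1, 1) s (face (1, 1, 1) (fst s))"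
  by code_simp

lemma separation_244: "\<forall>s\<in>set (separators (2, 1, 1)). separation_check (2, 1, 1) s (face (2, 1, 1) (fst s))"
  by code_simp

lemma separation_236: "\<forall>s\<in>set (separators (3, 2, 1)). separation_check (3, 2, 1) s (face (3, 2, 1) (fst s))"
  by code_simp

lemma points_distinct: "\<forall>w\<in>set [(1,1,1), (2,1,1), (3,2,1)]. distinct (points w)"
  by code_simp

lemma hull_rule_sound:
  assumes w: "w \<in> weight_types" and r: "r \<in> set (hull_rules w)" and V: "set (map snd (fst r)) \<subseteq> V"
  shows "pt (snd r) \<in> convex hull (pt ` V)"
proof -
  define ps where "ps = fst r"
  define L where "L = sum_list (map fst ps)"
  have ok: "list_all (\<lambda>p. 0 < fst p) ps" "ps \<noteq> []"
     "sum_list (map (\<lambda>p. fst p * fst (snd p)) ps) = L * fst (snd r)"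
     "sum_list (map (\<lambda>p. fst p * fst (snd (snd p))) ps) = L * fst (snd (snd r))"
     "sum_list (map (\<lambda>p. fst p * snd (snd (snd p))) ps) = L * snd (snd (snd r))"
    using hull_rules_ok w r unfolding weight_types_list ps_def L_def by blast+
  have L: "L > 0"
  proof -
    obtain q qs where q: "ps = q # qs" using ok(2) by (cases ps) auto
    then have "0 < fst q" "list_all (\<lambda>p. 0 < fst p) qs" using ok(1) by auto
    moreover have "list_all (\<lambda>p. 0 < fst p) qs \<Longrightarrow> 0 \<le> sum_list (map fst qs)" for qs :: "(int \<times> int \<times> int \<times> int) list"
      by (induction qs) auto
    ultimately show ?thesis using q by (auto simp: L_def add_pos_nonneg)
  qed
  let ?I = "{0..<length ps}"
  let ?a = "\<lambda>i. of_int (fst (ps ! i)) / (of_int L :: real)"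
  have suma: "(\<Sum>i\<in>?I. ?a i) = 1"
  proof -
    have "(\<Sum>i\<in>?I. ?a i) = of_int (\<Sum>i\<in>?I. fst (ps ! i)) / of_int L" by (simp add: sum_divide_distrib)
    also have "(\<Sum>i\<in>?I. fst (ps ! i)) = L" by (simp add: L_def sum_list_sum_nth)
    finally show ?thesis using L by simp
  qed
  have "(\<Sum>i\<in>?I. ?a i *\<^sub>R pt (snd (ps ! i))) \<in> convex hull (pt ` V)"
  proof (rule convex_sum)
    show "0 \<le> ?a i" if "i \<in> ?I" for i using ok(1) that L by (auto simp: list_all_length less_imp_le)
    show "pt (snd (ps ! i)) \<in> convex hull (pt ` V)" if "i \<in> ?I" for i
    proof -
      have "snd (ps ! i) \<in> V" using that V by (auto simp: ps_def)
      then show ?thesis by (simp add: hull_inc)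
    qed
  qed (use suma in auto)
  moreover have "(\<Sum>i\<in>?I. ?a i *\<^sub>R pt (snd (ps ! i))) = pt (snd r)"
  proof -
    have comp: "(\<Sum>i\<in>?I. ?a i * of_int (h (snd (ps ! i)))) = of_int c"
      if "sum_list (map (\<lambda>p. fst p * h (snd p)) ps) = L * c" for h :: "int \<times> int \<times> int \<Rightarrow> int" and c
    proof -
      have "(\<Sum>i\<in>?I. ?a i * of_int (h (snd (ps ! i)))) = of_int (\<Sum>i\<in>?I. fst (ps ! i) * h (snd (ps ! i))) / of_int L"
        by (simp add: sum_divide_distrib)
      also have "(\<Sum>i\<in>?I. fst (ps ! i) * h (snd (ps ! i))) = L * c"
        using that by (simp add: sum_list_sum_nth)
      finally show ?thesis using L by simp
    qed
    have pt_nth': "pt t $ 1 = of_int (fst t)" "pt t $ 2 = of_int (fst (snd t))" "pt t $ 3 = of_int (snd (snd t))" for t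
      by (cases t; simp)+
    show ?thesis
      unfolding vec_eq_iff forall_3
      using comp[OF ok(3)] comp[where h = "\<lambda>t. fst (snd t)", OF ok(4)] comp[where h = "\<lambda>t. snd (snd t)", OF ok(5)]
      by (simp add: pt_nth' del: times_divide_eq_left)
  qed
  ultimately show ?thesis by simp
qed

text \<open>One direction is the soundness of the rules. Conversely, let \<open>V\<close> obey the
  rules and miss a lattice point \<open>v\<close> of its hull. The clauses of \<open>v\<close> have
  no model, and on the part of \<open>V\<close> in the face only a separator clause can fail; that
  separator exceeds its value at \<open>v\<close> on all of \<open>V\<close>, so \<open>v\<close> is
  not in the hull.\<close>

lemma lattice_convex_iff:
  assumes w: "w \<in> weight_types" and V: "V \<subseteq> set (points w)"
  shows "lattice_points (convex hull (pt ` V)) = V \<longleftrightarrow> (\<forall>cl\<in>set (map rule_clause (hull_rules w)). holds V cl)"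
proof
  assume closed: "lattice_points (convex hull (pt ` V)) = V"
  show "\<forall>cl\<in>set (map rule_clause (hull_rules w)). holds V cl"
  proof
    fix cl assume "cl \<in> set (map rule_clause (hull_rules w))"
    then obtain r where r: "r \<in> set (hull_rules w)" "cl = rule_clause r" by auto
    show "holds V cl"
    proof (cases "set (map snd (fst r)) \<subseteq> V")
      case True
      then have "snd r \<in> V" using hull_rule_sound[OF w r(1)] closed by (auto simp: lattice_points_def)
      then show ?thesis by (simp add: holds_def r(2) rule_clause_def)
    next
      case False
      then show ?thesis unfolding holds_def r(2) rule_clause_def fst_conv by blast
    qed
  qed
next
  assume rules: "\<forall>cl\<in>set (map rule_clause (hull_rules w)). holds V cl"
  have "v \<in> V" if v: "pt v \<in> convex hull (pt ` V)" for v
  proof (rule ccontr)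
    assume vV: "v \<notin> V"
    have "pt ` V \<subseteq> weighted_simplex w" using V pt_weighted_simplex_iff[OF w] by auto
    then have "convex hull (pt ` V) \<subseteq> weighted_simplex w"
      using convex_weighted_simplex by (rule hull_minimal)
    then have vP: "v \<in> set (points w)" using v pt_weighted_simplex_iff[OF w] by blast
    moreover have "map fst (separators w) = points w"
      using separators_ok w unfolding weight_types_list by blast
    ultimately have "v \<in> fst ` set (separators w)" by (metis list.set_map)
    then obtain ds where ds: "(v, ds) \<in> set (separators w)" by auto
    define F where "F = face w v"
    define cls where "cls = separation_clauses w v F ds"
    have vF: "v \<in> set F"
      using vP by (simp add: F_def face_def)
    have "int (card {U. U \<subseteq> set F \<and> (\<forall>cl\<in>set cls. holds U cl)}) = models (length F) (trie_of F cls Empty)"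
    proof (rule card_models)
      show "distinct F" using points_distinct w unfolding weight_types_list by (auto simp: F_def face_def)
      fix cl assume "cl \<in> set cls"
      then consider "cl = ([v], [])" | d where "cl = ([], filter (\<lambda>u. dot d u \<le> dot d v \<and> u \<noteq> v) F)"
        | r where "r \<in> set (hull_rules w)" "cl = rule_clause r" "set (snd cl @ fst cl) \<subseteq> set F"
        by (auto simp: cls_def separation_clauses_def all_memb_iff)
      then show "set (fst cl) \<subseteq> set F \<and> set (snd cl) \<subseteq> set F \<and> set (fst cl) \<inter> set (snd cl) = {}"
      proof cases
        case (3 r)
        then have "\<not> memb (snd r) (map snd (fst r))" using hull_rules_ok w unfolding weight_types_list by blast
        then show ?thesis using 3(3) unfolding 3(2) rule_clause_def memb_iff by auto
      qed (use vF in auto)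
    qed
    also have "\<dots> = 0"
      using separation_333 separation_244 separation_236 w ds unfolding weight_types_def F_def cls_def by fastforce
    finally have "card {U. U \<subseteq> set F \<and> (\<forall>cl\<in>set cls. holds U cl)} = 0" by simp
    moreover have "finite {U. U \<subseteq> set F \<and> (\<forall>cl\<in>set cls. holds U cl)}"
      by (rule finite_subset[of _ "Pow (set F)"]) auto
    ultimately have "{U. U \<subseteq> set F \<and> (\<forall>cl\<in>set cls. holds U cl)} = {}" by (simp add: card_eq_0_iff)
    then obtain cl where cl: "cl \<in> set cls" "\<not> holds (V \<inter> set F) cl" by blast
    have "holds (V \<inter> set F) cl" if "cl \<in> set (map rule_clause (hull_rules w))" "set (fst cl) \<subseteq> set F" "set (snd cl) \<subseteq> set F"
      using rules that unfolding holds_def by blast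
    moreover have "holds (V \<inter> set F) ([v], [])" using vV by (simp add: holds_def)
    moreover consider "cl = ([v], [])" | d where "d \<in> set ds" "cl = ([], filter (\<lambda>u. dot d u \<le> dot d v \<and> u \<noteq> v) F)"
      | "cl \<in> set (map rule_clause (hull_rules w))" "set (fst cl) \<subseteq> set F" "set (snd cl) \<subseteq> set F"
      using cl(1) by (auto simp: cls_def separation_clauses_def all_memb_iff)
    ultimately obtain d where d: "d \<in> set ds" "\<not> holds (V \<inter> set F) ([], filter (\<lambda>u. dot d u \<le> dot d v \<and> u \<noteq> v) F)"
      using cl(2) by cases blast+
    \<comment> \<open>Within the face this is the failed clause, outside it
      \<open>separators_ok\<close>.\<close>
    have "dot d v < dot d u" if u: "u \<in> V" for u
    proof (cases "u \<in> set F")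
      case True
      then have "u \<notin> set (filter (\<lambda>u. dot d u \<le> dot d v \<and> u \<noteq> v) F)"
        using d(2) u unfolding holds_def snd_conv by (meson IntI)
      moreover have "u \<noteq> v" using u vV by blast
      ultimately show ?thesis using True by (simp add: not_le)
    next
      case False
      have "u \<in> set (points w)" using u V by blast
      then have "memb u (face w v) \<or> dot d v < dot d u"
        using separators_ok w ds d(1) unfolding weight_types_list by blast
      then show ?thesis using False by (simp add: memb_iff F_def)
    qed
    then have "pt ` V \<subseteq> {x. pt d \<bullet> x > of_int (dot d v)}" by (auto simp: pt_inner)
    then have "convex hull (pt ` V) \<subseteq> {x. pt d \<bullet> x > of_int (dot d v)}"
      by (intro hull_minimal convex_halfspace_gt)
    then show False using v by (auto simp: pt_inner)
  qed
  then show "lattice_points (convex hull (pt ` V)) = V"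
    unfolding lattice_points_def by (blast intro: hull_inc)
qed

definition convex_clauses :: "int \<times> int \<times> int \<Rightarrow> ((int \<times> int \<times> int) list \<times> (int \<times> int \<times> int) list) list" where
  "convex_clauses w = map (\<lambda>L. ([], L)) (hit_sets w) @ map rule_clause (hull_rules w)"

text \<open>The clauses say that the image of \<open>V\<close> lies in \<open>V\<close>, which for
  an injective map and a finite set means equality. Fixed points give no clause, as the two sides of
  a clause must be disjoint.\<close>

definition fixed_clauses :: "int \<times> int \<times> int \<Rightarrow> nat \<times> nat \<times> nat \<Rightarrow>
    ((int \<times> int \<times> int) list \<times> (int \<times> int \<times> int) list) list" where
  "fixed_clauses w g = concat (map (\<lambda>t. if act w g t = t then [] else [([t], [act w g t])]) (points w))"

fun fixed_counts :: "int \<times> int \<times> int \<Rightarrow> trie \<Rightarrow> (nat \<times> nat \<times> nat) list \<Rightarrow> int" where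
  "fixed_counts w a [] = 0"
| "fixed_counts w a (g # gs) =
     models (length (points w)) (merge a (trie_of (points w) (fixed_clauses w g) Empty)) + fixed_counts w a gs"

text \<open>The right-hand side is the order of the group times the number of orbits, as in
  Burnside's lemma.\<close>

lemma fixed_counts_333:
  "fixed_counts (1, 1, 1) (trie_of (points (1, 1, 1)) (convex_clauses (1, 1, 1)) Empty) (autos (1, 1, 1)) = 24 * 300"
  by code_simp

lemma fixed_counts_244:
  "fixed_counts (2, 1, 1) (trie_of (points (2, 1, 1)) (convex_clauses (2, 1, 1)) Empty) (autos (2, 1, 1)) = 6 * 632"
  by code_simp

lemma fixed_counts_236:
  "fixed_counts (3, 2, 1) (trie_of (points (3, 2, 1)) (convex_clauses (3, 2, 1)) Empty) (autos (3, 2, 1)) = 2 * 436"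
  by code_simp

subsection \<open>Orbit counting\<close>

text \<open>The orbits are the fibres of \<open>f\<close>. Count the pairs of \<open>g\<close> and
  \<open>V\<close> with \<open>V\<close> fixed by \<open>g\<close>: by the orbit-stabilizer theorem
  each orbit contributes the order of \<open>G\<close>.\<close>

lemma burnside_image:
  fixes G :: "('a \<Rightarrow> 'a) set" and X :: "'a set set" and f :: "'a set \<Rightarrow> 'b"
  assumes "finite G" "finite X"
    and id: "id \<in> G" and comp: "\<And>g h. g \<in> G \<Longrightarrow> h \<in> G \<Longrightarrow> g \<circ> h \<in> G"
    and inv: "\<And>g. g \<in> G \<Longrightarrow> \<exists>h\<in>G. h \<circ> g = id \<and> g \<circ> h = id"
    and closed: "\<And>g V. g \<in> G \<Longrightarrow> V \<in> X \<Longrightarrow> g ` V \<in> X"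
    and f: "\<And>V U. V \<in> X \<Longrightarrow> U \<in> X \<Longrightarrow> f V = f U \<longleftrightarrow> (\<exists>g\<in>G. U = g ` V)"
  shows "(\<Sum>g\<in>G. card {V\<in>X. g ` V = V}) = card G * card (f ` X)"
proof -
  define stab where "stab V = card {g\<in>G. g ` V = V}" for V
  have orbit: "(\<Sum>V | V \<in> X \<and> f V = c. stab V) = card G" if c: "c \<in> f ` X" for c
  proof -
    obtain V0 where V0: "V0 \<in> X" "c = f V0" using c by blast
    define orb where "orb = {V\<in>X. f V = c}"
    have "finite orb" "orb \<noteq> {}" using assms(2) V0 by (auto simp: orb_def)
    have stab: "stab V * card orb = card G" if V: "V \<in> orb" for V
    proof -
      have VX: "V \<in> X" "f V = c" using V by (auto simp: orb_def)
      have "card {g\<in>G. g ` V = U} = stab V" if U: "U \<in> orb" for U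
      proof -
        obtain g where g: "g \<in> G" "U = g ` V" using f[of V U] U VX by (auto simp: orb_def)
        obtain h where h: "h \<in> G" "h \<circ> g = id" "g \<circ> h = id" using inv[OF g(1)] by blast
        have step: "a \<circ> s \<in> {s\<in>G. s ` V = T}" if "a \<in> G" "s \<in> G" "s ` V = S" "a ` S = T" for a s S T
          unfolding mem_Collect_eq image_comp[symmetric] using comp[OF that(1,2)] that(3,4) by blast
        \<comment> \<open>The elements sending \<open>V\<close> to \<open>U\<close> form a coset of
          the stabilizer of \<open>V\<close>.\<close>
        have "bij_betw ((\<circ>) g) {s\<in>G. s ` V = V} {s\<in>G. s ` V = U}"
        proof (rule bij_betwI[of _ _ _ "(\<circ>) h"])
          have hU: "h ` U = V" unfolding g(2) image_comp h(2) by simp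
          show "(\<circ>) g \<in> {s \<in> G. s ` V = V} \<rightarrow> {s \<in> G. s ` V = U}"
            using step[OF g(1)] g(2) by blast
          show "(\<circ>) h \<in> {s \<in> G. s ` V = U} \<rightarrow> {s \<in> G. s ` V = V}"
            using step[OF h(1) _ _ hU] by blast
          show "h \<circ> (g \<circ> s) = s" for s using h(2) by (simp add: o_assoc)
          show "g \<circ> (h \<circ> s) = s" for s using h(3) by (simp add: o_assoc)
        qed
        then show ?thesis unfolding stab_def by (rule bij_betw_same_card[symmetric])
      qed
      then have "stab V * card orb = (\<Sum>U\<in>orb. card {g\<in>G. g ` V = U})" by simp
      also have "\<dots> = card (\<Union>U\<in>orb. {g\<in>G. g ` V = U})"
        using \<open>finite orb\<close> assms(1) by (subst card_UN_disjoint) auto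
      also have "(\<Union>U\<in>orb. {g\<in>G. g ` V = U}) = G"
      proof -
        have "g ` V \<in> orb" if "g \<in> G" for g
          using f[OF VX(1) closed[OF that VX(1)]] that VX closed[OF that VX(1)] by (auto simp: orb_def)
        then show ?thesis by auto
      qed
      finally show ?thesis .
    qed
    have "(\<Sum>V\<in>orb. stab V) * card orb = card orb * card G"
      unfolding sum_distrib_right using stab by simp
    then have "(\<Sum>V\<in>orb. stab V) = card G"
      using \<open>finite orb\<close> \<open>orb \<noteq> {}\<close> by (simp add: mult.commute)
    then show ?thesis by (simp add: orb_def)
  qed
  have "(\<Sum>g\<in>G. card {V\<in>X. g ` V = V}) = (\<Sum>g\<in>G. \<Sum>V\<in>X. if g ` V = V then 1 else 0)"
    using assms(2) by (intro sum.cong) (simp_all add: sum.If_cases Int_def)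
  also have "\<dots> = (\<Sum>V\<in>X. \<Sum>g\<in>G. if g ` V = V then 1 else 0)" by (rule sum.swap)
  also have "\<dots> = (\<Sum>V\<in>X. stab V)"
    using assms(1) by (intro sum.cong) (simp_all add: stab_def sum.If_cases Int_def)
  also have "\<dots> = (\<Sum>c\<in>f ` X. \<Sum>V | V \<in> X \<and> f V = c. stab V)"
    using assms(2) by (rule sum.image_gen)
  also have "\<dots> = (\<Sum>c\<in>f ` X. card G)" using orbit by (intro sum.cong) auto
  finally show ?thesis by (simp add: mult.commute)
qed

section \<open>Sets of lattice points and the classes they represent\<close>

definition sporadic_sets :: "int \<times> int \<times> int \<Rightarrow> (int \<times> int \<times> int) set set" where
  "sporadic_sets w = {V. V \<subseteq> set (points w) \<and> hits w V \<and> lattice_points (convex hull (pt ` V)) = V}"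

lemma sporadic_sets_eq:
  assumes w: "w \<in> weight_types"
  shows "sporadic_sets w = {V. V \<subseteq> set (points w) \<and> (\<forall>cl\<in>set (convex_clauses w). holds V cl)}"
proof -
  have "hits w V \<longleftrightarrow> (\<forall>cl\<in>set (map (\<lambda>L. ([], L)) (hit_sets w)). holds V cl)" for V
    by (auto simp: hits_def holds_def)
  then show ?thesis
    unfolding sporadic_sets_def convex_clauses_def set_append ball_Un using lattice_convex_iff[OF w] by blast
qed

lemma act_points:
  assumes w: "w \<in> weight_types" and g: "g \<in> set (autos w)" and t: "t \<in> set (points w)"
  shows "act w g t \<in> set (points w)"
proof -
  have iff: "u \<in> set (points w) \<longleftrightarrow> (\<forall>i<4. 0 \<le> co w i u)" for u
  proof -
    have "(\<forall>i<4. Q i) \<longleftrightarrow> Q 0 \<and> Q 1 \<and> Q 2 \<and> Q 3" for Q :: "nat \<Rightarrow> bool"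
      by (auto simp: numeral_eq_Suc less_Suc_eq)
    then show ?thesis unfolding points_iff[OF w] by (simp add: co_def)
  qed
  have "perm g i < 4" if "i < 4" for i
    using w g that unfolding weight_types_list by (auto simp: autos_eq perm_def)
  then show ?thesis using t co_act[OF w g] unfolding iff by simp
qed

lemma inj_act:
  assumes w: "w \<in> weight_types" and g: "g \<in> set (autos w)"
  shows "inj (act w g)"
proof -
  obtain h where "h \<in> set (autos w)" "mult_autos h g = (0, 1, 2)" using autos_group(3)[OF w g] by blast
  then have "act w h (act w g t) = t" for t using act_mult(1)[OF w _ g] act_id(1) by simp
  then show ?thesis by (metis injI)
qed

text \<open>The invariance of \<open>hits\<close> is not read off from \<open>hit_list\<close>. The
  image polytope lies in the same simplex and has the same multiplier, so \<open>fine_ineq\<close>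
  holds for its lattice points, and this gives \<open>hits\<close> back.\<close>

lemma sporadic_sets_act:
  assumes w: "w \<in> weight_types" and g: "g \<in> set (autos w)" and V: "V \<in> sporadic_sets w"
  shows "act w g ` V \<in> sporadic_sets w"
proof -
  have V': "V \<subseteq> set (points w)" "hits w V" "lattice_points (convex hull (pt ` V)) = V"
    using V by (auto simp: sporadic_sets_def)
  have sub: "act w g ` V \<subseteq> set (points w)" using act_points[OF w g] V'(1) by blast
  obtain h where h: "h \<in> set (autos w)" "mult_autos g h = (0, 1, 2)" "mult_autos h g = (0, 1, 2)"
    using autos_group(3)[OF w g] by blast
  have inv: "act w h (act w g t) = t" "act w g (act w h t) = t" for t
    using act_mult(1)[OF w h(1) g] act_mult(1)[OF w g h(1)] h act_id(1) by simp_all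
  have rinv: "ract w h (ract w g x) = x" "ract w g (ract w h x) = x" for x
    using act_mult(2)[OF w h(1) g] act_mult(2)[OF w g h(1)] h act_id(2) by simp_all
  have hull: "convex hull (pt ` act w g ` V) = ract w g ` (convex hull (pt ` V))"
  proof -
    obtain A c where A: "linear A" "\<And>x. ract w g x = A x + c" using ract_affine by metis
    have im: "ract w g ` S = (+) c ` A ` S" for S
      by (simp add: image_image A(2) add.commute)
    have "ract w g ` (convex hull (pt ` V)) = convex hull (ract w g ` pt ` V)"
      unfolding im convex_hull_translation convex_hull_linear_image[OF A(1)] ..
    then show ?thesis by (simp add: image_image ract_pt)
  qed
  have lat: "lattice_points (convex hull (pt ` act w g ` V)) = act w g ` V"
  proof -
    have "t \<in> lattice_points (convex hull (pt ` act w g ` V)) \<longleftrightarrow> act w h t \<in> V" for t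
    proof -
      have "pt t \<in> ract w g ` (convex hull (pt ` V)) \<longleftrightarrow> ract w h (pt t) \<in> convex hull (pt ` V)"
      proof
        assume "ract w h (pt t) \<in> convex hull (pt ` V)"
        then have "ract w g (ract w h (pt t)) \<in> ract w g ` (convex hull (pt ` V))" by (rule imageI)
        then show "pt t \<in> ract w g ` (convex hull (pt ` V))" unfolding rinv .
      qed (use rinv in auto)
      moreover have "act w h t \<in> V \<longleftrightarrow> ract w h (pt t) \<in> convex hull (pt ` V)"
        unfolding ract_pt by (subst V'(3)[symmetric]) (simp add: lattice_points_def)
      ultimately show ?thesis by (simp add: lattice_points_def hull)
    qed
    moreover have "act w h t \<in> V \<longleftrightarrow> t \<in> act w g ` V" for t
    proof
      assume "act w h t \<in> V"
      then have "act w g (act w h t) \<in> act w g ` V" by (rule imageI)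
      then show "t \<in> act w g ` V" unfolding inv .
    qed (use inv in auto)
    ultimately show ?thesis by blast
  qed
  have "hits w (act w g ` V)"
  proof -
    let ?Q = "convex hull (pt ` V)"
    note Q = closed_finite_hull[OF w V'(1,2)]
    have u: "affine_unimodular (ract w g)" by (rule affine_unimodular_ract[OF w g])
    have "lattice_polytope (ract w g ` ?Q)" by (rule lattice_polytope_unimodular[OF u Q(1)])
    moreover have "min_multiplier (ract w g ` ?Q) = mult_of w"
      using min_multiplier_unimodular[OF u lattice_polytope_props(1,3)[OF Q(1)]] Q(3) by simp
    moreover have "ract w g ` ?Q \<subseteq> weighted_simplex w"
    proof -
      have "pt ` act w g ` V \<subseteq> weighted_simplex w" using sub pt_weighted_simplex_iff[OF w] by auto
      then show ?thesis unfolding hull[symmetric] using convex_weighted_simplex by (rule hull_minimal)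
    qed
    ultimately have "fine_ineq w (lattice_points (ract w g ` ?Q))"
      using fine_ineq_lattice_points[OF _ _ w] by blast
    then show ?thesis using fine_ineq_hits[OF w sub] lat hull by simp
  qed
  then show ?thesis using sub lat by (simp add: sporadic_sets_def)
qed

definition class_of :: "(int \<times> int \<times> int) set \<Rightarrow> (real^3) set set" where
  "class_of V = unimodular_equiv `` {convex hull (pt ` V)}"

lemma class_of_eq_iff:
  assumes w: "w \<in> weight_types" and V: "V \<in> sporadic_sets w" "U \<in> sporadic_sets w"
  shows "class_of V = class_of U \<longleftrightarrow> (\<exists>g\<in>act w ` set (autos w). U = g ` V)"
proof -
  have "class_of V = class_of U \<longleftrightarrow> (convex hull (pt ` V), convex hull (pt ` U)) \<in> unimodular_equiv"
    unfolding class_of_def using eq_equiv_class_iff[OF equiv_unimodular_equiv] by blast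
  also have "\<dots> \<longleftrightarrow> (\<exists>g\<in>set (autos w). U = act w g ` V)"
    using unique_embedding[OF w] act_unimodular_equiv[OF w] V unfolding sporadic_sets_def by blast
  finally show ?thesis by blast
qed

lemma card_sporadic_classes:
  assumes w: "w \<in> weight_types"
    and cnt: "fixed_counts w (trie_of (points w) (convex_clauses w) Empty) (autos w) = int (length (autos w)) * int N"
  shows "card (class_of ` sporadic_sets w) = N"
proof -
  define G where "G = act w ` set (autos w)"
  have finX: "finite (sporadic_sets w)"
    by (rule finite_subset[of _ "Pow (set (points w))"]) (auto simp: sporadic_sets_def)
  have dist: "distinct (autos w)"
  proof -
    have "\<forall>w\<in>set [(1,1,1), (2,1,1), (3,2,1)]. distinct (autos w)" by code_simp
    then show ?thesis using w unfolding weight_types_list by blast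
  qed
  have inj: "inj_on (act w) (set (autos w))"
  proof -
    \<comment> \<open>At \<open>(1, 2, 3)\<close> the four coordinates are pairwise distinct, so
      this point tells the automorphisms apart.\<close>
    have "\<forall>w\<in>set [(1,1,1), (2,1,1), (3,2,1)]. distinct (map (\<lambda>g. act w g (1, 2, 3)) (autos w))" by code_simp
    then have "inj_on (\<lambda>g. act w g (1, 2, 3)) (set (autos w))"
      using w unfolding weight_types_list by (auto simp: distinct_map)
    then show ?thesis by (auto simp: inj_on_def)
  qed
  have cardG: "card G = length (autos w)"
    unfolding G_def using card_image[OF inj] distinct_card[OF dist] by simp
  have "(\<Sum>g\<in>G. card {V\<in>sporadic_sets w. g ` V = V}) = card G * card (class_of ` sporadic_sets w)"
  proof (rule burnside_image)
    show "id \<in> G"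
    proof -
      have "act w (0, 1, 2) = id" by (rule ext) (simp only: act_id id_apply)
      then show ?thesis using autos_group(1)[OF w] unfolding G_def by force
    qed
    show "g \<circ> h \<in> G" if gh: "g \<in> G" "h \<in> G" for g h
    proof -
      obtain a b where ab: "a \<in> set (autos w)" "g = act w a" "b \<in> set (autos w)" "h = act w b"
        using gh by (auto simp: G_def)
      then have "g \<circ> h = act w (mult_autos a b)" using act_mult(1)[OF w ab(1,3)] by auto
      then show ?thesis using autos_group(2)[OF w ab(1,3)] by (auto simp: G_def)
    qed
    show "\<exists>h\<in>G. h \<circ> g = id \<and> g \<circ> h = id" if g: "g \<in> G" for g
    proof -
      obtain a where a: "a \<in> set (autos w)" "g = act w a" using g by (auto simp: G_def)
      obtain b where b: "b \<in> set (autos w)" "mult_autos a b = (0, 1, 2)" "mult_autos b a = (0, 1, 2)"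
        using autos_group(3)[OF w a(1)] by blast
      have "act w b \<circ> g = id" "g \<circ> act w b = id"
        using act_mult(1)[OF w a(1) b(1)] act_mult(1)[OF w b(1) a(1)] a(2) b(2,3) act_id(1) by auto
      then show ?thesis using b(1) by (auto simp: G_def)
    qed
    show "g ` V \<in> sporadic_sets w" if "g \<in> G" "V \<in> sporadic_sets w" for g V
      using that sporadic_sets_act[OF w] by (auto simp: G_def)
    show "class_of V = class_of U \<longleftrightarrow> (\<exists>g\<in>G. U = g ` V)" if "V \<in> sporadic_sets w" "U \<in> sporadic_sets w" for V U
      unfolding G_def by (rule class_of_eq_iff[OF w that])
  qed (use finX in \<open>auto simp: G_def\<close>)
  moreover have "int (\<Sum>g\<in>G. card {V\<in>sporadic_sets w. g ` V = V}) =
    fixed_counts w (trie_of (points w) (convex_clauses w) Empty) (autos w)"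
  proof -
    have one: "int (card {V\<in>sporadic_sets w. act w g ` V = V}) =
        models (length (points w)) (merge (trie_of (points w) (convex_clauses w) Empty) (trie_of (points w) (fixed_clauses w g) Empty))"
      if g: "g \<in> set (autos w)" for g
    proof -
      have fix_iff: "act w g ` V = V \<longleftrightarrow> (\<forall>cl\<in>set (fixed_clauses w g). holds V cl)" if V: "V \<subseteq> set (points w)" for V
      proof -
        have "finite V" using V finite_subset by blast
        have "act w g ` V = V \<longleftrightarrow> act w g ` V \<subseteq> V"
          using endo_inj_surj[OF \<open>finite V\<close>] inj_act[OF w g] by (metis inj_on_subset subset_UNIV order_refl)
        also have "\<dots> \<longleftrightarrow> (\<forall>cl\<in>set (fixed_clauses w g). holds V cl)"
          using V by (auto simp: fixed_clauses_def holds_def)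
        finally show ?thesis .
      qed
      have "{V\<in>sporadic_sets w. act w g ` V = V} =
          {V. V \<subseteq> set (points w) \<and> (\<forall>cl\<in>set (convex_clauses w @ fixed_clauses w g). holds V cl)}"
        unfolding sporadic_sets_eq[OF w] set_append ball_Un using fix_iff by blast
      also have "int (card \<dots>) = models (length (points w)) (trie_of (points w) (convex_clauses w @ fixed_clauses w g) Empty)"
      proof (rule card_models)
        show "distinct (points w)" using points_distinct w unfolding weight_types_list by blast
        fix cl assume "cl \<in> set (convex_clauses w @ fixed_clauses w g)"
        then consider L where "L \<in> set (hit_sets w)" "cl = ([], L)" | r where "r \<in> set (hull_rules w)" "cl = rule_clause r"
          | "cl \<in> set (fixed_clauses w g)" by (auto simp: convex_clauses_def)
        then show "set (fst cl) \<subseteq> set (points w) \<and> set (snd cl) \<subseteq> set (points w) \<and> set (fst cl) \<inter> set (snd cl) = {}"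
        proof cases
          case 1
          then show ?thesis by (auto simp: hit_sets_def)
        next
          case 2
          have "set (map snd (fst r)) \<subseteq> set (points w) \<and> snd r \<in> set (points w) \<and> snd r \<notin> set (map snd (fst r))"
            using hull_rules_ok w 2(1) unfolding weight_types_list memb_iff list_all_iff by blast
          then show ?thesis unfolding 2(2) rule_clause_def by simp
        next
          case 3
          then show ?thesis using act_points[OF w g] by (auto simp: fixed_clauses_def split: if_splits)
        qed
      qed
      finally show ?thesis
        by (simp add: models_eq sat_merge sat_trie_of_append cong: conj_cong)
    qed
    have "fixed_counts w a gs = (\<Sum>g\<leftarrow>gs. models (length (points w)) (merge a (trie_of (points w) (fixed_clauses w g) Empty)))" for a gs
      by (induction gs) auto
    then have "fixed_counts w (trie_of (points w) (convex_clauses w) Empty) (autos w) =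
        (\<Sum>g\<in>set (autos w). int (card {V\<in>sporadic_sets w. act w g ` V = V}))"
      using dist one by (simp add: sum_list_distinct_conv_sum_set)
    then show ?thesis unfolding G_def by (simp add: sum.reindex[OF inj])
  qed
  moreover have "length (autos w) > 0" using autos_group(1)[OF w] by (cases "autos w") auto
  ultimately show ?thesis
    using cnt cardG by (metis (no_types, lifting) of_nat_eq_iff of_nat_mult mult_cancel1 less_irrefl)
qed

text \<open>A lattice polytope is the hull of its lattice points, so those of the embedded polytope
  represent the class of \<open>P\<close>.\<close>

lemma sporadic_class_in_image:
  assumes P: "sporadic_F_hollow P"
  obtains w V where "w \<in> weight_types" "min_multiplier P = mult_of w" "V \<in> sporadic_sets w"
    "unimodular_equiv `` {P} = class_of V" "(P, convex hull (pt ` V)) \<in> unimodular_equiv"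
    "lattice_polytope (convex hull (pt ` V))" "convex hull (pt ` V) \<subseteq> weighted_simplex w"
proof -
  obtain w Q where Q: "w \<in> weight_types" "(P, Q) \<in> unimodular_equiv" "lattice_polytope Q"
    "Q \<subseteq> weighted_simplex w" "min_multiplier P = mult_of w" "min_multiplier Q = min_multiplier P"
    using sporadic_in_simplex[OF P] unfolding mult_of_def by metis
  define V where "V = lattice_points Q"
  have VX: "V \<subseteq> set (points w)"
    using Q(4) pt_weighted_simplex_iff[OF Q(1)] by (auto simp: V_def lattice_points_def)
  have "hits w V"
    using fine_ineq_hits[OF Q(1) VX] fine_ineq_lattice_points[OF Q(3,4,1)] Q(5,6) by (simp add: V_def)
  have hull: "convex hull (pt ` V) = Q"
  proof
    show "convex hull (pt ` V) \<subseteq> Q"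
      using lattice_polytope_props(2)[OF Q(3)] by (intro hull_minimal) (auto simp: V_def lattice_points_def)
    obtain W where W: "W \<subseteq> int_lattice" "Q = convex hull W" using lattice_polytope_vertices[OF Q(3)] by metis
    have "W \<subseteq> pt ` V"
    proof
      fix x assume x: "x \<in> W"
      then obtain t where "x = pt t" using W(1) int_lattice_ptE by blast
      moreover have "x \<in> Q" using x W(2) by (simp add: hull_inc)
      ultimately show "x \<in> pt ` V" by (auto simp: V_def lattice_points_def)
    qed
    then show "Q \<subseteq> convex hull (pt ` V)" unfolding W(2) by (rule hull_mono)
  qed
  show ?thesis
  proof (rule that)
    show "V \<in> sporadic_sets w" using VX \<open>hits w V\<close> hull by (simp add: sporadic_sets_def V_def)
    show "unimodular_equiv `` {P} = class_of V"
      unfolding class_of_def hull using Q(2) equiv_class_eq[OF equiv_unimodular_equiv] by blast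
  qed (use Q hull in auto)
qed

lemma sporadic_quotient:
  assumes w: "w \<in> weight_types"
  shows "{P. sporadic_F_hollow P \<and> min_multiplier P = mult_of w} // unimodular_equiv = class_of ` sporadic_sets w"
proof (intro equalityI subsetI)
  fix c assume "c \<in> {P. sporadic_F_hollow P \<and> min_multiplier P = mult_of w} // unimodular_equiv"
  then obtain P where P: "sporadic_F_hollow P" "min_multiplier P = mult_of w" "c = unimodular_equiv `` {P}"
    by (auto simp: quotient_def)
  obtain w' V where V: "w' \<in> weight_types" "min_multiplier P = mult_of w'" "V \<in> sporadic_sets w'"
    "unimodular_equiv `` {P} = class_of V"
    using sporadic_class_in_image[OF P(1)] by metis
  \<comment> \<open>The three values of \<open>mult_of\<close> differ, so the multiplier determines
    the simplex.\<close>
  have "w' = w" using w V(1,2) P(2) by (auto simp: weight_types_def mult_of_def dot_def)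
  then show "c \<in> class_of ` sporadic_sets w" using V P(3) by blast
next
  fix c assume "c \<in> class_of ` sporadic_sets w"
  then obtain V where V: "V \<in> sporadic_sets w" "c = class_of V" by blast
  have "sporadic_F_hollow (convex hull (pt ` V))" "min_multiplier (convex hull (pt ` V)) = mult_of w"
    using closed_finite_hull(2,3)[OF w] V(1) by (auto simp: sporadic_sets_def)
  then show "c \<in> {P. sporadic_F_hollow P \<and> min_multiplier P = mult_of w} // unimodular_equiv"
    unfolding V(2) class_of_def by (intro quotientI) simp
qed

theorem theorem6p11:
  "card ({P. sporadic_F_hollow P} // unimodular_equiv) = 1368 \<and>
   (\<forall>P. sporadic_F_hollow P \<longrightarrow>
     (\<exists>Q. (P, Q) \<in> unimodular_equiv \<and> lattice_polytope Q \<and>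
          (Q \<subseteq> Delta 3 3 3 \<or> Q \<subseteq> Delta 2 4 4 \<or> Q \<subseteq> Delta 2 3 6))) \<and>
   card ({P. sporadic_F_hollow P \<and> min_multiplier P = 4/3} // unimodular_equiv) = 300 \<and>
   card ({P. sporadic_F_hollow P \<and> min_multiplier P = 5/4} // unimodular_equiv) = 632 \<and>
   card ({P. sporadic_F_hollow P \<and> min_multiplier P = 7/6} // unimodular_equiv) = 436"
proof -
  let ?S = "\<lambda>\<mu>. {P. sporadic_F_hollow P \<and> min_multiplier P = \<mu>}"
  have w: "(1, 1, 1) \<in> weight_types" "(2, 1, 1) \<in> weight_types" "(3, 2, 1) \<in> weight_types"
    by (simp_all add: weight_types_def)
  have mu: "mult_of (1, 1, 1) = 4/3" "mult_of (2, 1, 1) = 5/4" "mult_of (3, 2, 1) = 7/6"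
    by (simp_all add: mult_of_def dot_def)
  have len: "length (autos (1, 1, 1)) = 24" "length (autos (2, 1, 1)) = 6" "length (autos (3, 2, 1)) = 2"
    by (simp_all add: autos_eq)
  have c1: "card (?S (4/3) // unimodular_equiv) = 300"
    using sporadic_quotient[OF w(1)] card_sporadic_classes[OF w(1), of 300] fixed_counts_333 len(1) mu(1) by simp
  have c2: "card (?S (5/4) // unimodular_equiv) = 632"
    using sporadic_quotient[OF w(2)] card_sporadic_classes[OF w(2), of 632] fixed_counts_244 len(2) mu(2) by simp
  have c3: "card (?S (7/6) // unimodular_equiv) = 436"
    using sporadic_quotient[OF w(3)] card_sporadic_classes[OF w(3), of 436] fixed_counts_236 len(3) mu(3) by simp
  \<comment> \<open>The multiplier is a unimodular invariant, so a class has only one.\<close>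
  have disj: "(?S \<mu> // unimodular_equiv) \<inter> (?S \<nu> // unimodular_equiv) = {}" if "\<mu> \<noteq> \<nu>" for \<mu> \<nu>
  proof (rule ccontr)
    assume "\<not> ?thesis"
    then obtain P P' where P: "P \<in> ?S \<mu>" "P' \<in> ?S \<nu>" "unimodular_equiv `` {P} = unimodular_equiv `` {P'}"
      by (auto simp: quotient_def)
    then have "(P, P') \<in> unimodular_equiv" using eq_equiv_class[OF _ equiv_unimodular_equiv] by blast
    then obtain f where f: "affine_unimodular f" "f ` P = P'" by (auto simp: unimodular_equiv_def)
    have "lattice_polytope P"
      using P(1) by (simp add: sporadic_F_hollow_def weakly_sporadic_F_hollow_def F_hollow_def)
    then have "min_multiplier P' = min_multiplier P"
      using min_multiplier_unimodular[OF f(1)] f(2) lattice_polytope_props(1,3) by metis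
    then show False using P that by simp
  qed
  have union: "{P. sporadic_F_hollow P} = ?S (4/3) \<union> ?S (5/4) \<union> ?S (7/6)"
  proof -
    have "min_multiplier P = 4/3 \<or> min_multiplier P = 5/4 \<or> min_multiplier P = 7/6" if "sporadic_F_hollow P" for P
    proof (rule sporadic_class_in_image[OF that])
      fix w assume "w \<in> weight_types" "min_multiplier P = mult_of w"
      then show ?thesis using mu unfolding weight_types_list list.set insert_iff empty_iff by metis
    qed
    then show ?thesis by blast
  qed
  have un_quot: "(A \<union> B) // unimodular_equiv = A // unimodular_equiv \<union> B // unimodular_equiv"
    for A B :: "(real^3) set set"
    by (auto simp: quotient_def)
  \<comment> \<open>Infinite sets have \<open>card\<close> 0, so the positive counts entail
    finiteness.\<close>
  have fin: "finite (?S (4/3) // unimodular_equiv)" "finite (?S (5/4) // unimodular_equiv)" "finite (?S (7/6) // unimodular_equiv)"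
    using c1 c2 c3 by (auto intro: card_ge_0_finite)
  have "card ({P. sporadic_F_hollow P} // unimodular_equiv) = 300 + 632 + 436"
    unfolding union un_quot using fin c1 c2 c3 disj[of "4/3" "5/4"] disj[of "4/3" "7/6"] disj[of "5/4" "7/6"]
    by (subst card_Un_disjoint; (subst card_Un_disjoint)?) auto
  moreover have "\<exists>Q. (P, Q) \<in> unimodular_equiv \<and> lattice_polytope Q \<and>
      (Q \<subseteq> Delta 3 3 3 \<or> Q \<subseteq> Delta 2 4 4 \<or> Q \<subseteq> Delta 2 3 6)" if "sporadic_F_hollow P" for P
  proof (rule sporadic_in_simplex[OF that])
    fix w Q assume "w \<in> weight_types" "(P, Q) \<in> unimodular_equiv" "lattice_polytope Q" "Q \<subseteq> weighted_simplex w"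
    then show ?thesis
      unfolding Delta_weighted_simplex weight_types_list list.set insert_iff empty_iff by metis
  qed
  ultimately show ?thesis using c1 c2 c3 by simp
qed

end
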